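(* Let $\theta=\mu+\sigma i$ with $\mu\in\mathbb{R}$, $\sigma>0$, let $X_1,X_2,\dots$ be i.i.d. random variables with the Cauchy distribution $C(\theta)$, and let $f$ be an admissible generator (see context). Let $Y_n=f^{-1}\left(\frac1n\sum_{j=1}^n f(X_j)\right)$ and let \[ Z_n=Y_n+\frac{2\,\mathrm{Im}(Y_n)\,i}{n}\sum_{j=1}^n\frac{X_j-Y_n}{X_j-\overline{Y_n}} \] be the associated one-step estimator. If $E\left[|f(X_1)|^2\right]<+\infty$ and \[ \lim_{n\to\infty}n\,\mathrm{Var}(Y_n)=\frac{\mathrm{Var}(f(X_1))}{|f'(\theta)|^2}, \] then \[ \lim_{n\to\infty}n\,E\left[|Z_n-\theta|^2\right]=4\,\mathrm{Im}(\theta)^2, \] and in particular \[ \lim_{n\to\infty}n\,\mathrm{Var}(Z_n)\le 4\,\mathrm{Im}(\theta)^2. \]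
   Context: $\mathbb{H}=\{z\in\mathbb{C}:\mathrm{Im}(z)>0\}$ and $\overline{\mathbb{H}}=\mathbb{H}\cup\mathbb{R}$. For $\theta=\mu+\sigma i\in\mathbb{H}$, $C(\theta)$ is the distribution on $\mathbb{R}$ with density $p(x;\theta)=\frac{\sigma}{\pi}\frac{1}{(x-\mu)^2+\sigma^2}$. For a complex-valued random variable $T$, $\mathrm{Var}(T)=E[|T-E[T]|^2]$. Admissible generator: a function $f:U\to\mathbb{C}$ for which there is a point $a\in\mathbb{C}$ with $\mathrm{Im}(a)\le 0$ such that $U\subset\mathbb{C}$ is a domain containing $\overline{\mathbb{H}}\setminus\{a\}$, $f$ is (continuous) injective and holomorphic on $U$, the set $f(\overline{\mathbb{H}}\setminus\{a\})$ is convex, $\lim_{z\to a}(z-a)f(z)=0$, and $\lim_{|z|\to\infty}f(z)/|z|=0$. By the residue theorem $E[f(X_1)]=f(\theta)$. By convexity, $\frac1n\sum_{j=1}^n f(X_j)$ lies almost surely in $f(\overline{\mathbb{H}}\setminus\{a\})$, so $Y_n$ is well defined with values in $\overline{\mathbb{H}}\setminus\{a\}$. *)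

theory Defs
  imports "HOL-Probability.Probability" "HOL-Complex_Analysis.Complex_Analysis"
begin

definition closed_upper_half_plane :: "complex set" where
  "closed_upper_half_plane = {z. 0 \<le> Im z}"

definition cauchy_density :: "complex \<Rightarrow> real \<Rightarrow> real" where
  "cauchy_density \<theta> x = Im \<theta> / pi * (1 / ((x - Re \<theta>)\<^sup>2 + (Im \<theta>)\<^sup>2))"

text \<open>
  The generator is a function on \<open>U\<close>; its values outside \<open>U\<close> are irrelevant, so both limits
  are taken with \<open>z\<close> ranging over \<open>U\<close>.
\<close>

definition admissible_generator :: "complex set \<Rightarrow> (complex \<Rightarrow> complex) \<Rightarrow> bool" where
  "admissible_generator U f \<longleftrightarrow>
     (\<exists>a. Im a \<le> 0 \<and>
          open U \<and> connected U \<and> closed_upper_half_plane - {a} \<subseteq> U \<and>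
          inj_on f U \<and> f holomorphic_on U \<and>
          convex (f ` (closed_upper_half_plane - {a})) \<and>
          ((\<lambda>z. (z - a) * f z) \<longlongrightarrow> 0) (at a within U) \<and>
          ((\<lambda>z. f z / complex_of_real (cmod z)) \<longlongrightarrow> 0) (inf at_infinity (principal U)))"

text \<open>
  Samples are indexed from 1. The inverse is that of \<open>f\<close> restricted to \<open>U\<close>. For an admissible
  generator and Cauchy samples the average lies almost surely in the image of the closed upper
  half-plane without \<open>a\<close>, so the arbitrary value of the inverse outside \<open>f ` U\<close>
  is taken with probability 0 only.
\<close>

definition quasi_arithmetic_mean ::
    "complex set \<Rightarrow> (complex \<Rightarrow> complex) \<Rightarrow> (nat \<Rightarrow> 'a \<Rightarrow> real) \<Rightarrow> nat \<Rightarrow> 'a \<Rightarrow> complex" where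
  "quasi_arithmetic_mean U f X n \<omega> =
     inv_into U f (1 / of_nat n * (\<Sum>j=1..n. f (complex_of_real (X j \<omega>))))"

text \<open>
  A denominator vanishes only if \<open>Y n \<omega>\<close> is real. The correction then has the factor
  \<open>Im (Y n \<omega>) = 0\<close>, so the convention for division by 0 does not matter.
\<close>

definition one_step_estimator ::
    "(nat \<Rightarrow> 'a \<Rightarrow> real) \<Rightarrow> (nat \<Rightarrow> 'a \<Rightarrow> complex) \<Rightarrow> nat \<Rightarrow> 'a \<Rightarrow> complex" where
  "one_step_estimator X Y n \<omega> =
     Y n \<omega> + 2 * complex_of_real (Im (Y n \<omega>)) * \<i> / of_nat n *
       (\<Sum>j=1..n. (complex_of_real (X j \<omega>) - Y n \<omega>) / (complex_of_real (X j \<omega>) - cnj (Y n \<omega>)))"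

text \<open>
  Second moments and variances are extended nonnegative reals, since estimators such as the
  quasi-arithmetic mean of one Cauchy sample have infinite variance. If \<open>T\<close> is measurable but not
  integrable, \<open>integral\<^sup>L M T\<close> is 0 and \<open>complex_variance M T\<close> is \<open>\<infinity>\<close> on a probability space,
  because a square-integrable \<open>T\<close> would be integrable.
\<close>

definition second_moment :: "'a measure \<Rightarrow> ('a \<Rightarrow> complex) \<Rightarrow> ennreal" where
  "second_moment M T = (\<integral>\<^sup>+\<omega>. ennreal ((cmod (T \<omega>))\<^sup>2) \<partial>M)"

definition complex_variance :: "'a measure \<Rightarrow> ('a \<Rightarrow> complex) \<Rightarrow> ennreal" where
  "complex_variance M T = second_moment M (\<lambda>\<omega>. T \<omega> - integral\<^sup>L M T)"

end

theory Submission imports Defs begin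

text \<open>
  Put \<open>u\<^sub>j = (X\<^sub>j - \<theta>) / (X\<^sub>j - cnj \<theta>)\<close>. By the mean value property of the upper half-plane,
  \<open>f(X\<^sub>j) - f(\<theta>)\<close>, \<open>u\<^sub>j\<close> and \<open>u\<^sub>j\<^sup>2\<close> are centered, and \<open>\<bar>u\<^sub>j\<bar> = 1\<close>. Expanding the correction term
  around \<open>\<theta>\<close>, the part linear in \<open>Y\<^sub>n - \<theta>\<close> cancels up to averages of \<open>u\<^sub>j\<close> and \<open>u\<^sub>j\<^sup>2\<close>, so
  \<open>Z\<^sub>n - \<theta>\<close> equals \<open>2 i Im(\<theta>)\<close> times the average of the \<open>u\<^sub>j\<close>, whose second moment is exactly
  \<open>4 Im(\<theta>)\<^sup>2 / n\<close>, up to an error \<open>D\<^sub>n\<close> with \<open>n E\<bar>D\<^sub>n\<bar>\<^sup>2 \<rightarrow> 0\<close>. Where all three averages are small this is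
  the pointwise expansion. The complementary events have probability \<open>o(1/n)\<close>, by
  Hoeffding's inequality and truncation; that \<open>Y\<^sub>n\<close> has no asymptotic second moment
  there is what the assumption on \<open>n Var(Y\<^sub>n)\<close> provides.
\<close>

section \<open>The mean value property for Cauchy variables\<close>

text \<open>The obstacle is that control of the inverse of \<open>f\<close> is only local. Far from
  f(\<theta>) nothing bounds it, so a rare sample may throw Y_n far away, and a central limit
  theorem would say nothing about n E|Y_n - \<theta>|^2. The assumed limit is exactly n times the
  second moment of the linearization (mean of the f(X_j) minus f(\<theta>)) / f'(\<theta>). This
  equality, not mere boundedness, leaves no mass for the rare events. D_n inherits it because the
  quotients in the correction have modulus at most 1: D_n grows at most linearly in Y_n - \<theta>,
  up to an additive constant, and that constant is why the probabilities have to be o(1/n). Powers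
  of u_j up to 2 occur because 1 / (X_j - \<open>cnj \<theta>\<close>) equals (1 - u_j) / (2 i
  Im(\<theta>)), so the coefficients of the first-order expansion are polynomials in u_j. For the
  mean values, a generator may be unbounded at infinity and near a real point \<open>a\<close>; it
  is therefore first multiplied by a bounded holomorphic factor.\<close>

lemma half_disc_integral_bound:
  assumes cont: "continuous_on closed_upper_half_plane h"
    and holo: "h holomorphic_on {z. 0 < Im z}"
    and bound: "\<And>z. 0 \<le> Im z \<Longrightarrow> cmod (h z) \<le> C"
    and \<theta>: "0 < Im \<theta>" and R: "cmod \<theta> < R"
  shows "\<exists>I. ((\<lambda>x. (h (of_real x) - h \<theta>) / (of_real x - cnj \<theta>) / (of_real x - \<theta>)) has_integral I) {-R..R}
             \<and> cmod I \<le> 2 * C / (R - cmod \<theta>)\<^sup>2 * R * pi"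
proof -
  \<comment> \<open>Together with the factor 1 / (w - \<theta>), the denominators form on the real
    line the Cauchy density up to Im(\<theta>) / \<pi>. The pole \<open>cnj \<theta>\<close> lies
    below the axis, and the numerator vanishes at \<theta>. So Cauchy's formula on the closed
    half-disc gives integral 0: the integral over the segment is minus that over the arc, where the
    integrand is O(1/R^2) and the length is \<pi> R.\<close>
  define f where "f w = (h w - h \<theta>) / (w - cnj \<theta>)" for w
  define S where "S = closed_upper_half_plane"
  define c where "c = part_circlepath 0 R 0 pi"
  define l where "l = linepath (- of_real R) (of_real R :: complex)"
  have R0: "R > 0" using R norm_ge_zero[of \<theta>] by linarith
  have Seq: "S = {z. Im z \<ge> 0}" by (simp add: S_def closed_upper_half_plane_def)
  have intS: "interior S = {z. 0 < Im z}"
    unfolding Seq using interior_halfspace_ge[of \<i> 0] by (simp add: inner_complex_def)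
  have convS: "convex S" unfolding Seq by (rule convex_halfspace_Im_ge)
  have ne: "w - cnj \<theta> \<noteq> 0" if "Im w \<ge> 0" for w
    using that \<theta> by (auto simp: complex_eq_iff)
  have contf: "continuous_on S f" unfolding f_def
    by (intro continuous_intros) (use cont ne in \<open>auto simp: S_def closed_upper_half_plane_def\<close>)
  have holf: "f holomorphic_on {z. 0 < Im z}" unfolding f_def
    by (intro holomorphic_intros holo) (use ne in force)
  have op: "open {z. 0 < Im z}" by (rule open_halfspace_Im_gt)
  have diff: "f field_differentiable at x" if "x \<in> interior S - {}" for x
    using holf op that intS by (auto intro: holomorphic_on_imp_differentiable_at)
  have pc: "path_image c \<subseteq> S \<inter> sphere 0 R"
    unfolding c_def path_image_part_circlepath[OF pi_ge_zero]
    using R0 by (auto simp: Seq Im_exp norm_mult sin_ge_zero)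
  have pl: "path_image l \<subseteq> S \<inter> {z. Im z = 0}"
    unfolding l_def by (auto simp: Seq closed_segment_def)
  have *: "((\<lambda>w. f w / (w - \<theta>)) has_contour_integral
      (2 * pi * \<i> * winding_number (c +++ l) \<theta> * f \<theta>)) (c +++ l)"
  proof (rule Cauchy_integral_formula_weak[OF convS finite.emptyI contf diff])
    show "\<theta> \<in> interior S - {}" using intS \<theta> by auto
    show "valid_path (c +++ l)"
      unfolding c_def l_def by (intro valid_path_join) auto
    show "pathfinish (c +++ l) = pathstart (c +++ l)"
      unfolding c_def l_def by auto
    have "path_image (c +++ l) \<subseteq> path_image c \<union> path_image l"
      by (rule path_image_join_subset)
    then show "path_image (c +++ l) \<subseteq> S - {\<theta>}"
      using pc pl R \<theta> by (auto dest!: subsetD)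
  qed
  \<comment> \<open>This spares the computation of the winding number.\<close>
  moreover have "f \<theta> = 0" by (simp add: f_def)
  ultimately have *: "((\<lambda>w. f w / (w - \<theta>)) has_contour_integral 0) (c +++ l)"
    by simp
  have ci: "(\<lambda>w. f w / (w - \<theta>)) contour_integrable_on (c +++ l)"
    using * by (auto simp: contour_integrable_on_def)
  have vp: "valid_path c" "valid_path l" by (auto simp: c_def l_def)
  have cic: "(\<lambda>w. f w / (w - \<theta>)) contour_integrable_on c"
    and cil: "(\<lambda>w. f w / (w - \<theta>)) contour_integrable_on l"
    using contour_integrable_joinD1[OF ci vp(1)] contour_integrable_joinD2[OF ci vp(2)] by auto
  have sum0: "contour_integral c (\<lambda>w. f w / (w - \<theta>)) + contour_integral l (\<lambda>w. f w / (w - \<theta>)) = 0"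
    using contour_integral_join[OF cic cil vp] contour_integral_unique[OF *] by simp
  have C0: "C \<ge> 0" using bound[of 0] order_trans[OF norm_ge_zero] by fastforce
  have bd: "cmod (f w / (w - \<theta>)) \<le> 2 * C / (R - cmod \<theta>)\<^sup>2" if "w \<in> path_image c" for w
  proof -
    have w: "Im w \<ge> 0" "cmod w = R" using that pc by (auto simp: Seq)
    have 1: "cmod (h w - h \<theta>) \<le> 2 * C"
      using norm_triangle_ineq4[of "h w" "h \<theta>"] bound[OF w(1)] bound[of \<theta>] \<theta> by linarith
    have 2: "R - cmod \<theta> \<le> cmod (w - cnj \<theta>)" "R - cmod \<theta> \<le> cmod (w - \<theta>)"
      using norm_triangle_ineq2[of w "cnj \<theta>"] norm_triangle_ineq2[of w "\<theta>"] w by auto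
    have "(R - cmod \<theta>)\<^sup>2 \<le> cmod (w - cnj \<theta>) * cmod (w - \<theta>)"
      unfolding power2_eq_square using 2 R by (intro mult_mono) auto
    moreover have "(R - cmod \<theta>)\<^sup>2 > 0" using R by simp
    ultimately have "cmod (h w - h \<theta>) / (cmod (w - cnj \<theta>) * cmod (w - \<theta>)) \<le> 2 * C / (R - cmod \<theta>)\<^sup>2"
      using 1 C0 by (intro frac_le) auto
    then show ?thesis by (simp add: f_def norm_divide norm_mult)
  qed
  have "norm (contour_integral c (\<lambda>w. f w / (w - \<theta>))) \<le> 2 * C / (R - cmod \<theta>)\<^sup>2 * R * \<bar>pi - 0\<bar>"
    using bd cic unfolding c_def
    by (intro contour_integral_bound_part_circlepath) (use R0 C0 in auto)
  moreover have "contour_integral l (\<lambda>w. f w / (w - \<theta>)) = - contour_integral c (\<lambda>w. f w / (w - \<theta>))"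
    using sum0 by (simp add: eq_neg_iff_add_eq_0 add.commute)
  ultimately have b: "cmod (contour_integral l (\<lambda>w. f w / (w - \<theta>))) \<le> 2 * C / (R - cmod \<theta>)\<^sup>2 * R * pi"
    by simp
  have "((\<lambda>x. f (of_real x) / (of_real x - \<theta>)) has_integral (contour_integral l (\<lambda>w. f w / (w - \<theta>)))) {-R..R}"
    using has_contour_integral_integral[OF cil] R0 unfolding l_def
    by (subst (asm) has_contour_integral_linepath_Reals_iff) auto
  then show ?thesis using b unfolding f_def by blast
qed

lemma cauchy_density_eq:
  assumes "0 < Im \<theta>"
  shows "of_real (cauchy_density \<theta> x) =
    of_real (Im \<theta> / pi) / ((of_real x - cnj \<theta>) * (of_real x - \<theta>))"
proof -
  have "(of_real x - cnj \<theta>) * (of_real x - \<theta>) = of_real ((x - Re \<theta>)\<^sup>2 + (Im \<theta>)\<^sup>2)"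
    by (simp add: complex_eq_iff power2_eq_square algebra_simps)
  then show ?thesis by (simp add: cauchy_density_def)
qed

lemma cauchy_density_nonneg: "0 < Im \<theta> \<Longrightarrow> 0 \<le> cauchy_density \<theta> x"
  by (simp add: cauchy_density_def)

lemma cauchy_density_measurable [measurable]: "cauchy_density \<theta> \<in> borel_measurable borel"
  unfolding cauchy_density_def by measurable

lemma measurable_halfplane_of_real:
  assumes "continuous_on closed_upper_half_plane h"
  shows "(\<lambda>x. h (complex_of_real x)) \<in> borel_measurable borel"
proof -
  have "continuous_on UNIV (\<lambda>x. h (complex_of_real x))"
    by (rule continuous_on_compose2[OF assms]) (auto simp: closed_upper_half_plane_def intro: continuous_intros)
  then show ?thesis by (rule borel_measurable_continuous_onI)
qed

lemma distributed_integral_complex: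
  fixes q :: "real \<Rightarrow> complex"
  assumes D: "distributed M lborel X (\<lambda>x. ennreal (p x))" and [measurable]: "p \<in> borel_measurable borel"
    and p: "\<And>x. 0 \<le> p x" and [measurable]: "q \<in> borel_measurable borel"
  shows "integrable M (\<lambda>\<omega>. q (X \<omega>)) \<longleftrightarrow> integrable lborel (\<lambda>x. of_real (p x) * q x)"
    and "integral\<^sup>L M (\<lambda>\<omega>. q (X \<omega>)) = integral\<^sup>L lborel (\<lambda>x. of_real (p x) * q x)"
proof -
  have X[measurable]: "X \<in> borel_measurable M" using distributed_measurable[OF D] by simp
  have e: "distr M lborel X = density lborel (\<lambda>x. ennreal (p x))"
    using distributed_distr_eq_density[OF D] by simp
  have "integrable M (\<lambda>\<omega>. q (X \<omega>)) \<longleftrightarrow> integrable (distr M lborel X) q"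
    by (subst integrable_distr_eq) auto
  also have "\<dots> \<longleftrightarrow> integrable lborel (\<lambda>x. of_real (p x) * q x)"
    unfolding e by (subst integrable_density) (auto simp: p scaleR_conv_of_real)
  finally show "integrable M (\<lambda>\<omega>. q (X \<omega>)) \<longleftrightarrow> integrable lborel (\<lambda>x. of_real (p x) * q x)" .
  have "integral\<^sup>L M (\<lambda>\<omega>. q (X \<omega>)) = integral\<^sup>L (distr M lborel X) q"
    by (subst integral_distr) auto
  also have "\<dots> = integral\<^sup>L lborel (\<lambda>x. of_real (p x) * q x)"
    unfolding e by (subst integral_density) (auto simp: p scaleR_conv_of_real)
  finally show "integral\<^sup>L M (\<lambda>\<omega>. q (X \<omega>)) = integral\<^sup>L lborel (\<lambda>x. of_real (p x) * q x)" .
qed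

text \<open>The integral of h - h(\<theta>) against the density over [-n, n] tends to the full
  expectation by dominated convergence, and it is O(1/n) by the half-disc bound.\<close>

lemma (in prob_space) cauchy_mean_value:
  assumes D: "distributed M lborel X (\<lambda>x. ennreal (cauchy_density \<theta> x))" and \<theta>: "0 < Im \<theta>"
    and cont: "continuous_on closed_upper_half_plane h"
    and holo: "h holomorphic_on {z. 0 < Im z}"
    and bound: "\<And>z. 0 \<le> Im z \<Longrightarrow> cmod (h z) \<le> C"
  shows "expectation (\<lambda>\<omega>. h (of_real (X \<omega>))) = h \<theta>"
proof -
  have X[measurable]: "X \<in> borel_measurable M" using distributed_measurable[OF D] by simp
  have hm[measurable]: "(\<lambda>x. h (complex_of_real x)) \<in> borel_measurable borel"
    by (rule measurable_halfplane_of_real[OF cont])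
  define q where "q x = h (complex_of_real x) - h \<theta>" for x
  define k where "k x = of_real (cauchy_density \<theta> x) * q x" for x
  have qm[measurable]: "q \<in> borel_measurable borel" unfolding q_def by measurable
  note di = distributed_integral_complex[OF D cauchy_density_measurable cauchy_density_nonneg[OF \<theta>] qm]
  have qb: "cmod (q x) \<le> 2 * C" for x
    using norm_triangle_ineq4[of "h (of_real x)" "h \<theta>"] bound[of "of_real x"] bound[of \<theta>] \<theta>
    unfolding q_def by simp
  have "integrable M (\<lambda>\<omega>. q (X \<omega>))"
    by (rule integrable_const_bound[where B="2*C"]) (use qb in auto)
  then have ki: "integrable lborel k" using di(1) by (simp add: k_def[abs_def])
  define I where "I n = (LBINT x:{- real n .. real n}. k x)" for n
  have lim1: "I \<longlonglongrightarrow> integral\<^sup>L lborel k"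
    unfolding I_def set_lebesgue_integral_def
  proof (rule integral_dominated_convergence[where w="\<lambda>x. cmod (k x)"])
    show "AE x in lborel. (\<lambda>n. indicat_real {- real n..real n} x *\<^sub>R k x) \<longlonglongrightarrow> k x"
    proof (rule AE_I2)
      fix x :: real
      obtain N where N: "\<bar>x\<bar> \<le> real N" using real_arch_simple by blast
      have "eventually (\<lambda>n. indicat_real {- real n..real n} x *\<^sub>R k x = k x) sequentially"
        using eventually_ge_at_top[of N] by eventually_elim (use N in \<open>auto simp: indicator_def\<close>)
      then show "(\<lambda>n. indicat_real {- real n..real n} x *\<^sub>R k x) \<longlonglongrightarrow> k x"
        by (rule tendsto_eventually)
    qed
  qed (use ki in \<open>auto simp: indicator_def\<close>)
  have keq: "k = (\<lambda>x. of_real (Im \<theta> / pi) * ((h (of_real x) - h \<theta>) / (of_real x - cnj \<theta>) / (of_real x - \<theta>)))"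
    unfolding k_def q_def cauchy_density_eq[OF \<theta>] by (auto simp: fun_eq_iff)
  have Ib: "cmod (I n) \<le> Im \<theta> / pi * (2 * C / (real n - cmod \<theta>)\<^sup>2 * real n * pi)" if n: "cmod \<theta> < real n" for n
  proof -
    obtain J where J: "((\<lambda>x. (h (of_real x) - h \<theta>) / (of_real x - cnj \<theta>) / (of_real x - \<theta>)) has_integral J) {- real n..real n}"
      "cmod J \<le> 2 * C / (real n - cmod \<theta>)\<^sup>2 * real n * pi"
      using half_disc_integral_bound[OF cont holo bound \<theta> n] by blast
    have "(k has_integral (of_real (Im \<theta> / pi) * J)) {- real n..real n}"
      unfolding keq by (rule has_integral_mult_right[OF J(1)])
    moreover have "(k has_integral (I n)) {- real n..real n}"
    proof -
      have "set_integrable lborel {- real n..real n} k"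
        unfolding set_integrable_def by (intro integrable_mult_indicator ki) auto
      from set_borel_integral_eq_integral[OF this] show ?thesis
        unfolding I_def by (simp add: integrable_integral)
    qed
    ultimately have "I n = of_real (Im \<theta> / pi) * J" by (metis has_integral_unique)
    then have "cmod (I n) = Im \<theta> / pi * cmod J" using \<theta> by (simp add: norm_mult norm_divide)
    also have "\<dots> \<le> Im \<theta> / pi * (2 * C / (real n - cmod \<theta>)\<^sup>2 * real n * pi)"
      using J(2) \<theta> by (intro mult_left_mono) auto
    finally show ?thesis .
  qed
  have "((\<lambda>n. Im \<theta> / pi * (2 * C / (real n - cmod \<theta>)\<^sup>2 * real n * pi)) \<longlonglongrightarrow> 0)"
    by real_asymp
  moreover have "eventually (\<lambda>n. cmod (I n) \<le> Im \<theta> / pi * (2 * C / (real n - cmod \<theta>)\<^sup>2 * real n * pi)) sequentially"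
    using eventually_gt_at_top[of "nat \<lceil>cmod \<theta>\<rceil>"] by eventually_elim (intro Ib, linarith)
  ultimately have "I \<longlonglongrightarrow> 0" by (rule Lim_null_comparison[rotated])
  then have "integral\<^sup>L lborel k = 0" using lim1 LIMSEQ_unique by blast
  then have "expectation (\<lambda>\<omega>. q (X \<omega>)) = 0" using di(2) by (simp add: k_def[abs_def])
  moreover have "integrable M (\<lambda>\<omega>. h (of_real (X \<omega>)))"
    by (rule integrable_const_bound[where B="C"]) (use bound in auto)
  ultimately show ?thesis by (simp add: q_def prob_space)
qed

section \<open>From bounded functions to admissible generators\<close>

lemma (in prob_space) AE_distributed_ne:
  fixes X :: "'a \<Rightarrow> real"
  assumes D: "distributed M lborel X (\<lambda>x. ennreal (p x))"
  shows "AE \<omega> in M. X \<omega> \<noteq> c"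
proof -
  have m: "X \<in> measurable M lborel" using distributed_measurable[OF D] .
  have "(\<lambda>x. ennreal (p x)) \<in> borel_measurable lborel"
    using distributed_borel_measurable[OF D] .
  moreover have "AE x in lborel. x \<noteq> c" by (rule AE_lborel_singleton)
  ultimately have "AE x in density lborel (\<lambda>x. ennreal (p x)). x \<noteq> c"
    by (subst AE_density) (auto elim: eventually_mono)
  then have "AE x in distr M lborel X. x \<noteq> c"
    by (subst distributed_distr_eq_density[OF D])
  then show ?thesis by (rule AE_distrD[OF m])
qed

text \<open>On the real line \<open>f\<close> is continuous except possibly at \<open>Re a\<close>,
  which is an issue only for real \<open>a\<close>, where the value of \<open>f\<close> may be
  arbitrary. A single exceptional point does not affect Borel measurability.\<close>

lemma measurable_boundary_values:
  assumes "closed_upper_half_plane - {a} \<subseteq> U" "f holomorphic_on U"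
  shows "(\<lambda>x. f (complex_of_real x)) \<in> borel_measurable borel"
proof -
  have "complex_of_real x \<in> U" if "x \<noteq> Re a" for x
  proof -
    have "complex_of_real x \<noteq> a" using that by (metis Re_complex_of_real)
    then show ?thesis using assms(1) by (auto simp: closed_upper_half_plane_def)
  qed
  then have "continuous_on (UNIV - {Re a}) (\<lambda>x. f (complex_of_real x))"
    by (intro continuous_on_compose2[OF holomorphic_on_imp_continuous_on[OF assms(2)]])
      (auto intro!: continuous_intros)
  then have "(\<lambda>x. indicator (UNIV - {Re a}) x *\<^sub>R f (complex_of_real x)) \<in> borel_measurable borel"
    by (intro borel_measurable_continuous_on_indicator) auto
  then show ?thesis
    by (rule measurable_discrete_difference[where X="{Re a}"]) auto
qed

lemma cmod_add_imaginary_ge: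
  assumes "0 \<le> Im w" "0 \<le> t"
  shows "cmod w \<le> cmod (w + \<i> * of_real t)" "t \<le> cmod (w + \<i> * of_real t)"
proof -
  have "(Im w)\<^sup>2 \<le> (Im w + t)\<^sup>2" using assms by (intro power_mono) auto
  then show "cmod w \<le> cmod (w + \<i> * of_real t)" by (simp add: cmod_def)
  show "t \<le> cmod (w + \<i> * of_real t)"
    using abs_Im_le_cmod[of "w + \<i> * of_real t"] assms by simp
qed

text \<open>
  The multiplier removes the possible singularity of the generator at the boundary point \<open>a\<close> and
  its growth at infinity, is bounded by 1 on the half-plane, and tends to 1 as \<open>\<kappa>\<close> grows.
\<close>

definition damping :: "complex \<Rightarrow> real \<Rightarrow> complex \<Rightarrow> complex" where
  "damping a \<kappa> z = \<i> * of_real \<kappa> / (z + \<i> * of_real \<kappa>) * ((z - a) / (z - a + \<i> * of_real (1 / \<kappa>)))"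

text \<open>The two poles lie strictly below the real axis: one on the negative imaginary axis, the
  other at distance 1 / \<kappa> below \<open>a\<close>.\<close>

lemma damping_denominators:
  assumes "0 \<le> Im z" "Im a \<le> 0" "0 < \<kappa>"
  shows "z + \<i> * of_real \<kappa> \<noteq> 0" "z - a + \<i> * of_real (1 / \<kappa>) \<noteq> 0"
proof -
  have "\<kappa> \<le> cmod (z + \<i> * of_real \<kappa>)" using assms by (intro cmod_add_imaginary_ge) auto
  then show "z + \<i> * of_real \<kappa> \<noteq> 0" using assms by auto
  have "1 / \<kappa> \<le> cmod (z - a + \<i> * of_real (1 / \<kappa>))"
    using assms by (intro cmod_add_imaginary_ge) auto
  moreover have "0 < 1 / \<kappa>" using assms by simp
  ultimately show "z - a + \<i> * of_real (1 / \<kappa>) \<noteq> 0" by (metis norm_zero not_le)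
qed

text \<open>The first factor of \<open>damping\<close> alone provides the decay \<kappa> / |z|; the
  second, which supplies the zero at \<open>a\<close>, has modulus at most 1.\<close>

lemma damping_bounds:
  assumes "0 \<le> Im z" "Im a \<le> 0" "0 < \<kappa>"
  shows "cmod (damping a \<kappa> z) \<le> 1" "cmod z * cmod (damping a \<kappa> z) \<le> \<kappa>"
proof -
  note ne = damping_denominators[OF assms]
  have A: "cmod ((z - a) / (z - a + \<i> * of_real (1 / \<kappa>))) \<le> 1"
    using cmod_add_imaginary_ge(1)[of "z - a" "1 / \<kappa>"] assms ne(2) by (simp add: norm_divide)
  have B: "cmod (\<i> * of_real \<kappa> / (z + \<i> * of_real \<kappa>)) \<le> 1"
    using cmod_add_imaginary_ge(2)[of z \<kappa>] assms ne(1) by (simp add: norm_divide norm_mult)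
  have C: "cmod z * cmod (\<i> * of_real \<kappa> / (z + \<i> * of_real \<kappa>)) \<le> \<kappa>"
    using cmod_add_imaginary_ge(1)[of z \<kappa>] assms ne(1)
    by (simp add: norm_divide norm_mult field_simps)
  show "cmod (damping a \<kappa> z) \<le> 1"
    unfolding damping_def norm_mult[of "_ / _"] using mult_mono[OF B A] by simp
  have "cmod z * cmod (\<i> * of_real \<kappa> / (z + \<i> * of_real \<kappa>)) *
        cmod ((z - a) / (z - a + \<i> * of_real (1 / \<kappa>))) \<le> \<kappa> * 1"
    using mult_mono[OF C A] assms by simp
  then show "cmod z * cmod (damping a \<kappa> z) \<le> \<kappa>"
    unfolding damping_def norm_mult[of "_ / _"] by (simp add: mult.assoc)
qed

lemma damping_tendsto_1:
  assumes "z \<noteq> a"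
  shows "(\<lambda>k. damping a (real (Suc k)) z) \<longlonglongrightarrow> 1"
proof -
  have inv: "(\<lambda>k. 1 / real (Suc k)) \<longlonglongrightarrow> 0" by real_asymp
  have 0: "(\<lambda>k. complex_of_real (1 / real (Suc k))) \<longlonglongrightarrow> of_real 0"
    by (rule tendsto_of_real[OF inv])
  have lim: "(\<lambda>k. \<i> / (z * of_real (1 / real (Suc k)) + \<i>) *
      ((z - a) / (z - a + \<i> * of_real (1 / real (Suc k))))) \<longlonglongrightarrow>
      \<i> / (z * of_real 0 + \<i>) * ((z - a) / (z - a + \<i> * of_real 0))"
    by (intro tendsto_intros 0) (use assms in auto)
  \<comment> \<open>Dividing numerator and denominator by \<open>r\<close> leaves an expression in 1
    / r alone, whose limit can be taken termwise.\<close>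
  have "\<i> / (z * of_real (1 / r) + \<i>) = \<i> * of_real r / (z + \<i> * of_real r)" if "r \<noteq> 0" for r
  proof -
    have "z + \<i> * of_real r = (z * of_real (1 / r) + \<i>) * of_real r"
      using that by (simp add: algebra_simps)
    then show ?thesis using that by simp
  qed
  then have "damping a (real (Suc k)) z = \<i> / (z * of_real (1 / real (Suc k)) + \<i>) *
      ((z - a) / (z - a + \<i> * of_real (1 / real (Suc k))))" for k
    unfolding damping_def by (metis of_nat_neq_0)
  moreover have "\<i> / (z * of_real 0 + \<i>) * ((z - a) / (z - a + \<i> * of_real 0)) = 1"
    using assms by simp
  ultimately show ?thesis using lim by presburger
qed

text \<open>Each limit in the definition of an admissible generator is matched by one factor of
  \<open>damping\<close>: the zero at \<open>a\<close> turns the first limit into continuity with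
  value 0, and the decay at infinity compensates |f(z)| < |z|, which the second limit gives for
  large |z|. A compact part of the half-plane remains, where continuity suffices.\<close>

lemma damped_generator:
  assumes a: "Im a \<le> 0" and U: "open U" "closed_upper_half_plane - {a} \<subseteq> U"
    and holo: "f holomorphic_on U"
    and lim_a: "((\<lambda>z. (z - a) * f z) \<longlongrightarrow> 0) (at a within U)"
    and lim_inf: "((\<lambda>z. f z / complex_of_real (cmod z)) \<longlongrightarrow> 0) (inf at_infinity (principal U))"
    and \<kappa>: "0 < \<kappa>"
  defines "h \<equiv> \<lambda>z. if z = a then 0 else f z * damping a \<kappa> z"
  shows "continuous_on closed_upper_half_plane h"
    and "h holomorphic_on {z. 0 < Im z}"
    and "\<exists>C. \<forall>z. 0 \<le> Im z \<longrightarrow> cmod (h z) \<le> C"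
proof -
  let ?H = "closed_upper_half_plane"
  have HD: "z \<in> ?H \<longleftrightarrow> 0 \<le> Im z" for z by (simp add: closed_upper_half_plane_def)
  note ne = damping_denominators[OF _ a \<kappa>]
  show "h holomorphic_on {z. 0 < Im z}"
  proof -
    have "(\<lambda>z. f z * damping a \<kappa> z) holomorphic_on {z. 0 < Im z}"
      unfolding damping_def using ne a U
      by (intro holomorphic_intros holomorphic_on_subset[OF holo]) (auto simp: closed_upper_half_plane_def)
    then show ?thesis
      by (rule holomorphic_transform) (use a in \<open>auto simp: h_def\<close>)
  qed
  show cont: "continuous_on ?H h"
    unfolding continuous_on_eq_continuous_within
  proof
    fix z assume z: "z \<in> ?H"
    show "continuous (at z within ?H) h"
    proof (cases "z = a")
      case False
      have cf: "continuous (at z) f"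
        using holomorphic_on_imp_continuous_on[OF holo] U z False
        by (auto simp: continuous_on_eq_continuous_at)
      have "continuous (at z) (\<lambda>z. f z * damping a \<kappa> z)"
        unfolding damping_def using ne[of z] z HD by (intro continuous_intros cf) auto
      moreover have "\<forall>\<^sub>F w in nhds z. h w = f w * damping a \<kappa> w"
        using t1_space_nhds[OF False] by eventually_elim (simp add: h_def)
      ultimately have "continuous (at z) h" by (simp add: isCont_cong)
      then show ?thesis by (rule continuous_at_imp_continuous_within)
    next
      case True
      have ima: "0 \<le> Im a" using z HD True by simp
      have "at a within ?H = at a within (?H - {a})" by (simp add: at_within_def)
      also have "\<dots> \<le> at a within U" using U(2) by (rule at_le)
      finally have lim: "((\<lambda>z. (z - a) * f z) \<longlongrightarrow> 0) (at a within ?H)"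
        by (rule tendsto_mono[OF _ lim_a])
      \<comment> \<open>\<open>m\<close> is \<open>damping\<close> with its zero at \<open>a\<close>
        taken out. It is continuous at \<open>a\<close>, so the limit of the product is governed by
        \<open>lim_a\<close>.\<close>
      define m where "m z = \<i> * of_real \<kappa> / (z + \<i> * of_real \<kappa>) / (z - a + \<i> * of_real (1 / \<kappa>))" for z
      have "continuous (at a within ?H) m"
        unfolding m_def using ne[OF ima] by (intro continuous_intros) auto
      then have "((\<lambda>z. (z - a) * f z * m z) \<longlongrightarrow> 0 * m a) (at a within ?H)"
        unfolding continuous_within by (rule tendsto_mult[OF lim])
      then have "((\<lambda>z. (z - a) * f z * m z) \<longlongrightarrow> 0) (at a within ?H)"
        by (simp only: mult_zero_left)
      moreover have "(z - a) * f z * m z = h z" if "z \<noteq> a" for z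
      proof -
        have "A * B * (C / D / E) = B * (C / D * (A / E))" for A B C D E :: complex
          by (simp add: divide_inverse mult_ac)
        then show ?thesis unfolding h_def damping_def m_def using that by presburger
      qed
      then have "\<forall>\<^sub>F z in at a within ?H. (z - a) * f z * m z = h z"
        by (simp add: eventually_at_filter)
      ultimately have "(h \<longlongrightarrow> 0) (at a within ?H)"
        by (rule Lim_transform_eventually)
      then show ?thesis unfolding True continuous_within by (simp add: h_def)
    qed
  qed
  have "\<forall>\<^sub>F z in inf at_infinity (principal U). cmod (f z / complex_of_real (cmod z)) < 1"
    using lim_inf[THEN tendstoD, of 1] by simp
  then obtain B where B: "\<And>z. B \<le> cmod z \<Longrightarrow> z \<in> U \<Longrightarrow> cmod (f z / complex_of_real (cmod z)) < 1"
    by (auto simp: eventually_inf_principal eventually_at_infinity)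
  \<comment> \<open>At least 1, so that |z| is positive outside the ball and the division by |z| can
    be undone.\<close>
  define B' where "B' = max B 1"
  have "compact (?H \<inter> cball 0 B')"
    by (intro closed_Int_compact) (auto simp: closed_upper_half_plane_def closed_halfspace_Im_ge)
  then have "compact (h ` (?H \<inter> cball 0 B'))"
    by (intro compact_continuous_image continuous_on_subset[OF cont]) auto
  then have "bounded (h ` (?H \<inter> cball 0 B'))" by (rule compact_imp_bounded)
  then obtain C where C: "\<And>z. z \<in> ?H \<inter> cball 0 B' \<Longrightarrow> cmod (h z) \<le> C"
    unfolding bounded_iff by blast
  have "cmod (h z) \<le> max C \<kappa>" if z: "0 \<le> Im z" for z
  proof (cases "z = a \<or> cmod z \<le> B'")
    case True
    then show ?thesis
    proof
      assume "z = a"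
      then show ?thesis using \<kappa> by (simp add: h_def)
    next
      assume "cmod z \<le> B'"
      then show ?thesis using C[of z] z HD by simp
    qed
  next
    case False
    then have "z \<in> U" using z U HD by blast
    moreover have z0: "B \<le> cmod z" "0 < cmod z" using False by (auto simp: B'_def)
    ultimately have "cmod (f z / complex_of_real (cmod z)) < 1" using B by blast
    then have "cmod (f z) \<le> cmod z" using z0 by (simp add: norm_divide)
    then have "cmod (h z) \<le> cmod z * cmod (damping a \<kappa> z)"
      using False by (simp add: h_def norm_mult mult_right_mono)
    then show ?thesis using damping_bounds(2)[OF z a \<kappa>] by linarith
  qed
  then show "\<exists>C. \<forall>z. 0 \<le> Im z \<longrightarrow> cmod (h z) \<le> C" by blast
qed

text \<open>The damped generators are bounded and have the mean value property. Since the
  multipliers have modulus at most 1 and tend to 1, dominated convergence with majorant |f(X)|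
  carries the property over to \<open>f\<close>.\<close>

lemma (in prob_space) cauchy_mean_value_generator:
  assumes D: "distributed M lborel X (\<lambda>x. ennreal (cauchy_density \<theta> x))" and \<theta>: "0 < Im \<theta>"
    and a: "Im a \<le> 0" and U: "open U" "closed_upper_half_plane - {a} \<subseteq> U"
    and holo: "f holomorphic_on U"
    and lim_a: "((\<lambda>z. (z - a) * f z) \<longlongrightarrow> 0) (at a within U)"
    and lim_inf: "((\<lambda>z. f z / complex_of_real (cmod z)) \<longlongrightarrow> 0) (inf at_infinity (principal U))"
    and int: "integrable M (\<lambda>\<omega>. f (of_real (X \<omega>)))"
  shows "expectation (\<lambda>\<omega>. f (of_real (X \<omega>))) = f \<theta>"
proof -
  have [measurable]: "X \<in> borel_measurable M" using distributed_measurable[OF D] by simp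
  define h where "h k z = (if z = a then 0 else f z * damping a (real (Suc k)) z)" for k z
  have h: "continuous_on closed_upper_half_plane (h k)" "h k holomorphic_on {z. 0 < Im z}"
    "\<exists>C. \<forall>z. 0 \<le> Im z \<longrightarrow> cmod (h k z) \<le> C" for k
    using damped_generator[OF a U holo lim_a lim_inf, of "real (Suc k)"] unfolding h_def by auto
  have E: "expectation (\<lambda>\<omega>. h k (of_real (X \<omega>))) = h k \<theta>" for k
    using cauchy_mean_value[OF D \<theta> h(1,2)[of k]] h(3)[of k] by blast
  have [measurable]: "(\<lambda>x. h k (complex_of_real x)) \<in> borel_measurable borel" for k
    by (rule measurable_halfplane_of_real[OF h(1)])
  have lim: "(\<lambda>k. h k z) \<longlonglongrightarrow> f z" if "z \<noteq> a" for z
    using tendsto_mult[OF tendsto_const[of "f z"] damping_tendsto_1[OF that]] that by (simp add: h_def)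
  have "(\<lambda>k. expectation (\<lambda>\<omega>. h k (of_real (X \<omega>)))) \<longlonglongrightarrow> expectation (\<lambda>\<omega>. f (of_real (X \<omega>)))"
  proof (rule integral_dominated_convergence[where w="\<lambda>\<omega>. cmod (f (of_real (X \<omega>)))"])
    \<comment> \<open>If \<open>a\<close> is real, the damped functions are all 0 there and need not
      converge to \<open>f\<close>; a sample hits this point with probability 0.\<close>
    show "AE \<omega> in M. (\<lambda>k. h k (of_real (X \<omega>))) \<longlonglongrightarrow> f (of_real (X \<omega>))"
      using AE_distributed_ne[OF D, of "Re a"]
      by eventually_elim (auto intro: lim)
    show "AE \<omega> in M. cmod (h k (of_real (X \<omega>))) \<le> cmod (f (of_real (X \<omega>)))" for k
      using damping_bounds(1)[OF _ a, of "of_real (X _)" "real (Suc k)"]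
      by (auto simp: h_def norm_mult intro!: mult_right_le_one_le)
  qed (use int in auto)
  moreover have "\<theta> \<noteq> a" using \<theta> a by auto
  ultimately show ?thesis using lim[of \<theta>] LIMSEQ_unique unfolding E by blast
qed

section \<open>The one-step correction near the parameter\<close>

definition cayley :: "complex \<Rightarrow> real \<Rightarrow> complex" where
  "cayley y x = (of_real x - y) / (of_real x - cnj y)"

lemma cayley_measurable [measurable]: "cayley y \<in> borel_measurable borel"
  unfolding cayley_def by measurable

text \<open>For real \<open>y\<close> the quotient is 1, except that it is 0 at \<open>x = y\<close>
  by the convention for division. The inequality therefore needs no condition on \<open>y\<close>,
  which matters because it is applied to the random values of Y_n.\<close>

lemma cmod_cayley_le: "cmod (cayley y x) \<le> 1"
proof -
  have "cmod (of_real x - y) = cmod (of_real x - cnj y)"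
    using complex_mod_cnj[of "of_real x - y"] by simp
  then show ?thesis by (simp add: cayley_def norm_divide)
qed

lemma cmod_cayley: "Im y \<noteq> 0 \<Longrightarrow> cmod (cayley y x) = 1"
proof -
  assume "Im y \<noteq> 0"
  moreover have "cmod (of_real x - y) = cmod (of_real x - cnj y)"
    using complex_mod_cnj[of "of_real x - y"] by simp
  moreover have "of_real x - cnj y \<noteq> 0" using \<open>Im y \<noteq> 0\<close> by (auto simp: complex_eq_iff)
  ultimately show ?thesis by (simp add: cayley_def norm_divide)
qed

text \<open>Exactly, \<open>cayley y x - u\<close> is (- d + \<open>cnj d\<close> u) / p. Replacing
  p by t = x - \<open>cnj \<theta>\<close> and using 1/t = (1 - u) / (2 i Im(\<theta>)) produces the
  linear term. The bounds are uniform in \<open>x\<close> because |t| is at least Im(\<theta>) and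
  |p| at least Im(\<theta>) / 2; the constant 4 is the numerator bound 2 |d| over the
  latter.\<close>

lemma cayley_expansion:
  fixes \<theta> y :: complex and x :: real
  assumes s: "0 < Im \<theta>" and small: "cmod (y - \<theta>) \<le> Im \<theta> / 2"
  defines "d \<equiv> y - \<theta>" and "u \<equiv> cayley \<theta> x"
  shows "cmod (cayley y x - u) \<le> 4 * cmod d / Im \<theta>"
    and "cmod (cayley y x - u - (- d + d * u + cnj d * u - cnj d * u\<^sup>2) / (2 * \<i> * of_real (Im \<theta>)))
      \<le> 4 * (cmod d)\<^sup>2 / (Im \<theta>)\<^sup>2"
proof -
  let ?s = "Im \<theta>"
  define p where "p = of_real x - cnj y"
  define t where "t = of_real x - cnj \<theta>"
  have tp: "t - p = cnj d" by (simp add: t_def p_def d_def)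
  have tim: "Im t = ?s" by (simp add: t_def)
  have t_ge: "?s \<le> cmod t" using abs_Im_le_cmod[of t] s tim by simp
  have "\<bar>Im d\<bar> \<le> ?s / 2" using abs_Im_le_cmod[of d] small by (simp add: d_def)
  moreover have "Im p = ?s + Im d" by (simp add: p_def d_def)
  ultimately have p_ge: "?s / 2 \<le> cmod p" using abs_Im_le_cmod[of p] s by linarith
  have ne: "t \<noteq> 0" "p \<noteq> 0" using t_ge p_ge s by auto
  have ut: "u * t = of_real x - \<theta>" using ne by (simp add: u_def cayley_def t_def)
  have st: "(1 - u) * t = 2 * \<i> * of_real ?s"
    unfolding left_diff_distrib ut by (simp add: t_def complex_eq_iff)
  have cy: "cayley y x * p = u * t - d" using ne unfolding ut by (simp add: cayley_def p_def d_def)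
  have diff: "(cayley y x - u) * p = - d + cnj d * u"
    unfolding left_diff_distrib cy tp[symmetric] by (simp add: algebra_simps)
  have u1: "cmod u \<le> 1" unfolding u_def by (rule cmod_cayley_le)
  have num: "cmod (- d + cnj d * u) \<le> 2 * cmod d"
    using norm_triangle_ineq[of "- d" "cnj d * u"] mult_left_mono[OF u1, of "cmod d"] by (simp add: norm_mult)
  have A: "cmod (cayley y x - u) * cmod p \<le> 2 * cmod d"
    using num unfolding norm_mult[symmetric] diff .
  have "cmod (cayley y x - u) * (?s / 2) \<le> cmod (cayley y x - u) * cmod p"
    by (intro mult_left_mono p_ge) auto
  then show B: "cmod (cayley y x - u) \<le> 4 * cmod d / ?s" using A s by (simp add: field_simps)
  let ?e = "cayley y x - u - (- d + d * u + cnj d * u - cnj d * u\<^sup>2) / (2 * \<i> * of_real ?s)"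
  have u0: "1 - u \<noteq> 0" using st s by auto
  have "(- d + d * u + cnj d * u - cnj d * u\<^sup>2) = (- d + cnj d * u) * (1 - u)"
    by (simp add: algebra_simps power2_eq_square)
  then have "(- d + d * u + cnj d * u - cnj d * u\<^sup>2) / (2 * \<i> * of_real ?s) = (- d + cnj d * u) / t"
    unfolding st[symmetric] using u0 by simp
  moreover have "(A - B / t) * t = A * t - B" for A B using ne by (simp add: left_diff_distrib)
  \<comment> \<open>The remainder is exactly \<open>(cayley y x - u) * cnj d / t\<close>, so the
    first-order bound \<open>B\<close>, used once more, makes it quadratic in d.\<close>
  ultimately have "?e * t = (cayley y x - u) * t - (- d + cnj d * u)" by presburger
  also have "\<dots> = (cayley y x - u) * t - (cayley y x - u) * p" by (simp only: diff)
  also have "\<dots> = (cayley y x - u) * cnj d" by (simp only: tp[symmetric] right_diff_distrib)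
  finally have "cmod ?e * cmod t = cmod (cayley y x - u) * cmod d" by (metis norm_mult complex_mod_cnj)
  moreover have "cmod ?e * ?s \<le> cmod ?e * cmod t" by (intro mult_left_mono t_ge) auto
  moreover have "cmod (cayley y x - u) * cmod d \<le> 4 * cmod d / ?s * cmod d" by (intro mult_right_mono B) auto
  ultimately have "cmod ?e * ?s \<le> 4 * cmod d / ?s * cmod d" by linarith
  then show "cmod ?e \<le> 4 * (cmod d)\<^sup>2 / ?s\<^sup>2" using s by (simp add: field_simps power2_eq_square)
qed

lemma cmod_average_le:
  fixes g :: "nat \<Rightarrow> complex"
  assumes "\<And>j. cmod (g j) \<le> K"
  shows "cmod ((\<Sum>j=1..n. g j) / of_nat n) \<le> K"
proof -
  have "cmod (\<Sum>j=1..n. g j) \<le> (\<Sum>j=1..n. K)" by (intro order_trans[OF norm_sum] sum_mono assms)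
  moreover have "0 \<le> K" using order_trans[OF norm_ge_zero assms] .
  ultimately show ?thesis by (cases "n = 0") (simp_all add: norm_divide field_simps)
qed

text \<open>The first bound holds however far \<open>y\<close> is from \<theta>, since averages of
  \<open>cayley\<close> have modulus at most 1; it serves on the rare events. In the second, the
  term - d of the expansion cancels the d in y - \<theta>, and every surviving term carries a second
  factor: an average at \<theta>, or d again. The 4 collects two terms of the expansion and the term
  with 2 Im(d); the 16 is 8 from the remainder and 8 from 2 Im(d) times the increment of
  \<Phi>.\<close>

lemma one_step_error_bounds:
  fixes \<theta> y :: complex and x :: "nat \<Rightarrow> real" and n :: nat
  assumes s: "0 < Im \<theta>" and n: "1 \<le> n"
  defines "\<Phi> \<equiv> (\<lambda>z. (\<Sum>j=1..n. cayley z (x j)) / of_nat n)"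
    and "\<Psi> \<equiv> (\<Sum>j=1..n. (cayley \<theta> (x j))\<^sup>2) / of_nat n"
    and "d \<equiv> y - \<theta>"
  defines "D \<equiv> y + 2 * \<i> * of_real (Im y) * \<Phi> y - \<theta> - 2 * \<i> * of_real (Im \<theta>) * \<Phi> \<theta>"
  shows "cmod D \<le> 3 * cmod d + 4 * Im \<theta>"
    and "cmod d \<le> Im \<theta> / 2 \<Longrightarrow> cmod D \<le> cmod d * (4 * cmod (\<Phi> \<theta>) + cmod \<Psi> + 16 * cmod d / Im \<theta>)"
proof -
  let ?s = "Im \<theta>"
  have \<Phi>1: "cmod (\<Phi> z) \<le> 1" for z unfolding \<Phi>_def by (intro cmod_average_le cmod_cayley_le)
  have Imd: "\<bar>Im d\<bar> \<le> cmod d" by (rule abs_Im_le_cmod)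
  have Imy: "Im y = ?s + Im d" by (simp add: d_def)
  have "cmod D \<le> cmod d + cmod (2 * \<i> * of_real (Im y) * \<Phi> y) + cmod (2 * \<i> * of_real ?s * \<Phi> \<theta>)"
    using norm_triangle_ineq4[of "d + 2 * \<i> * of_real (Im y) * \<Phi> y" "2 * \<i> * of_real ?s * \<Phi> \<theta>"]
      norm_triangle_ineq[of d "2 * \<i> * of_real (Im y) * \<Phi> y"]
    unfolding D_def d_def by (simp add: algebra_simps)
  also have "cmod (2 * \<i> * of_real (Im y) * \<Phi> y) \<le> 2 * \<bar>Im y\<bar>"
    using mult_left_mono[OF \<Phi>1[of y], of "2 * \<bar>Im y\<bar>"] by (simp add: norm_mult)
  also have "cmod (2 * \<i> * of_real ?s * \<Phi> \<theta>) \<le> 2 * ?s"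
    using mult_left_mono[OF \<Phi>1[of \<theta>], of "2 * ?s"] s by (simp add: norm_mult)
  finally show "cmod D \<le> 3 * cmod d + 4 * ?s" using Imy Imd s by linarith
  assume small: "cmod d \<le> ?s / 2"
  define e where "e j = cayley y (x j) - cayley \<theta> (x j) - (- d + d * cayley \<theta> (x j) + cnj d * cayley \<theta> (x j)
      - cnj d * (cayley \<theta> (x j))\<^sup>2) / (2 * \<i> * of_real ?s)" for j
  define \<epsilon> where "\<epsilon> = (\<Sum>j=1..n. e j) / of_nat n"
  have eb: "cmod \<epsilon> \<le> 4 * (cmod d)\<^sup>2 / ?s\<^sup>2"
    unfolding \<epsilon>_def e_def d_def
    by (intro cmod_average_le cayley_expansion(2)) (use s small d_def in auto)
  have \<Phi>diff: "\<Phi> y - \<Phi> \<theta> = (\<Sum>j=1..n. cayley y (x j) - cayley \<theta> (x j)) / of_nat n"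
    by (simp add: \<Phi>_def sum_subtractf diff_divide_distrib)
  have fb: "cmod (\<Phi> y - \<Phi> \<theta>) \<le> 4 * cmod d / ?s"
    unfolding \<Phi>diff d_def
    by (intro cmod_average_le cayley_expansion(1)) (use s small d_def in auto)
  have exp: "2 * \<i> * of_real ?s * (\<Phi> y - \<Phi> \<theta>) = - d + d * \<Phi> \<theta> + cnj d * \<Phi> \<theta> - cnj d * \<Psi> + 2 * \<i> * of_real ?s * \<epsilon>"
  proof -
    have s0: "2 * \<i> * complex_of_real ?s \<noteq> 0" using s by simp
    have "2 * \<i> * of_real ?s * (cayley y (x j) - cayley \<theta> (x j)) =
        - d + d * cayley \<theta> (x j) + cnj d * cayley \<theta> (x j) - cnj d * (cayley \<theta> (x j))\<^sup>2 + 2 * \<i> * of_real ?s * e j" for j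
      unfolding e_def right_diff_distrib using s0 by simp
    then have "2 * \<i> * of_real ?s * (\<Sum>j=1..n. cayley y (x j) - cayley \<theta> (x j)) =
       (\<Sum>j=1..n. - d + d * cayley \<theta> (x j) + cnj d * cayley \<theta> (x j) - cnj d * (cayley \<theta> (x j))\<^sup>2 + 2 * \<i> * of_real ?s * e j)"
      unfolding sum_distrib_left by (intro sum.cong refl)
    also have "\<dots> = - d * of_nat n + d * (\<Sum>j=1..n. cayley \<theta> (x j)) + cnj d * (\<Sum>j=1..n. cayley \<theta> (x j))
       - cnj d * (\<Sum>j=1..n. (cayley \<theta> (x j))\<^sup>2) + 2 * \<i> * of_real ?s * (\<Sum>j=1..n. e j)"
      by (simp only: sum.distrib sum_subtractf sum_distrib_left sum_constant card_atLeastAtMost) simp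
    finally have "2 * \<i> * of_real ?s * (\<Phi> y - \<Phi> \<theta>) = (- d * of_nat n + d * (\<Sum>j=1..n. cayley \<theta> (x j)) + cnj d * (\<Sum>j=1..n. cayley \<theta> (x j))
       - cnj d * (\<Sum>j=1..n. (cayley \<theta> (x j))\<^sup>2) + 2 * \<i> * of_real ?s * (\<Sum>j=1..n. e j)) / of_nat n"
      unfolding \<Phi>diff by simp
    then show ?thesis using n unfolding \<Phi>_def \<Psi>_def \<epsilon>_def by (simp add: add_divide_distrib diff_divide_distrib)
  qed
  \<comment> \<open>Splitting Im(y) into Im(\<theta>) + Im(d) isolates the increment of \<Phi> with
    the factor 2 i Im(\<theta>), whose expansion \<open>exp\<close> starts with - d.\<close>
  have "D = d + 2 * \<i> * of_real ?s * (\<Phi> y - \<Phi> \<theta>) + 2 * \<i> * of_real (Im d) * (\<Phi> y - \<Phi> \<theta>) + 2 * \<i> * of_real (Im d) * \<Phi> \<theta>"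
    unfolding D_def Imy of_real_add by (simp add: d_def algebra_simps)
  also have "\<dots> = d * \<Phi> \<theta> + cnj d * \<Phi> \<theta> - cnj d * \<Psi> + 2 * \<i> * of_real ?s * \<epsilon>
      + 2 * \<i> * of_real (Im d) * (\<Phi> y - \<Phi> \<theta>) + 2 * \<i> * of_real (Im d) * \<Phi> \<theta>"
    unfolding exp by simp
  finally have D: "D = d * \<Phi> \<theta> + cnj d * \<Phi> \<theta> - cnj d * \<Psi> + 2 * \<i> * of_real ?s * \<epsilon>
      + 2 * \<i> * of_real (Im d) * (\<Phi> y - \<Phi> \<theta>) + 2 * \<i> * of_real (Im d) * \<Phi> \<theta>" .
  have "cmod D \<le> cmod d * cmod (\<Phi> \<theta>) + cmod d * cmod (\<Phi> \<theta>) + cmod d * cmod \<Psi> + 2 * ?s * cmod \<epsilon>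
      + 2 * \<bar>Im d\<bar> * cmod (\<Phi> y - \<Phi> \<theta>) + 2 * \<bar>Im d\<bar> * cmod (\<Phi> \<theta>)"
    unfolding D by (rule norm_triangle_le norm_triangle_le_diff add_mono order_refl; simp add: norm_mult s less_imp_le)+
  also have "\<dots> \<le> cmod d * cmod (\<Phi> \<theta>) + cmod d * cmod (\<Phi> \<theta>) + cmod d * cmod \<Psi> + 2 * ?s * (4 * (cmod d)\<^sup>2 / ?s\<^sup>2)
      + 2 * cmod d * (4 * cmod d / ?s) + 2 * cmod d * cmod (\<Phi> \<theta>)"
    using eb fb Imd s by (intro add_mono mult_mono order_refl) auto
  also have "\<dots> = cmod d * (4 * cmod (\<Phi> \<theta>) + cmod \<Psi> + 16 * cmod d / ?s)"
    using s by (simp add: field_simps power2_eq_square)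
  finally show "cmod D \<le> cmod d * (4 * cmod (\<Phi> \<theta>) + cmod \<Psi> + 16 * cmod d / ?s)" .
qed

section \<open>Second moments of complex random variables\<close>

lemma cnj_measurable [measurable]: "cnj \<in> borel_measurable borel"
  by (intro borel_measurable_continuous_onI continuous_intros)

lemma (in prob_space) complex_square_integrable:
  fixes Y :: "'a \<Rightarrow> complex"
  assumes [measurable]: "Y \<in> borel_measurable M" and sq: "integrable M (\<lambda>\<omega>. (cmod (Y \<omega>))\<^sup>2)"
  shows "integrable M Y"
proof (rule square_integrable_imp_integrable)
  show "integrable M (\<lambda>\<omega>. (Y \<omega>)\<^sup>2)"
    by (rule Bochner_Integration.integrable_bound[OF sq]) (auto simp: norm_power)
qed auto

lemma (in prob_space) complex_second_moment_shift:
  fixes Y :: "'a \<Rightarrow> complex"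
  assumes [measurable]: "Y \<in> borel_measurable M" and sq: "integrable M (\<lambda>\<omega>. (cmod (Y \<omega>))\<^sup>2)"
  shows "integrable M (\<lambda>\<omega>. (cmod (Y \<omega> - c))\<^sup>2)"
    and "expectation (\<lambda>\<omega>. (cmod (Y \<omega> - c))\<^sup>2) =
      expectation (\<lambda>\<omega>. (cmod (Y \<omega>))\<^sup>2) - 2 * Re (cnj c * expectation Y) + (cmod c)\<^sup>2"
proof -
  have i: "integrable M Y" by (rule complex_square_integrable[OF assms])
  have e: "(cmod (Y \<omega> - c))\<^sup>2 = (cmod (Y \<omega>))\<^sup>2 - 2 * Re (cnj c * Y \<omega>) + (cmod c)\<^sup>2" for \<omega>
    by (simp add: cmod_power2 power2_diff algebra_simps)
  have j: "integrable M (\<lambda>\<omega>. Re (cnj c * Y \<omega>))"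
    by (intro integrable_Re integrable_mult_right i)
  show "integrable M (\<lambda>\<omega>. (cmod (Y \<omega> - c))\<^sup>2)"
    unfolding e using sq j by (intro Bochner_Integration.integrable_add Bochner_Integration.integrable_diff integrable_mult_right) auto
  show "expectation (\<lambda>\<omega>. (cmod (Y \<omega> - c))\<^sup>2) =
      expectation (\<lambda>\<omega>. (cmod (Y \<omega>))\<^sup>2) - 2 * Re (cnj c * expectation Y) + (cmod c)\<^sup>2"
  proof -
    have "expectation (\<lambda>\<omega>. Re (cnj c * Y \<omega>)) = Re (cnj c * expectation Y)"
      using i by (subst integral_Re) (auto intro: integrable_mult_right)
    then show ?thesis
      unfolding e using sq j by (simp add: prob_space del: times_complex.sel)
  qed
qed

text \<open>The inequality is taken for the moduli as extended nonnegative integrals and transferred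
  back once the product is known to be integrable.\<close>

lemma (in prob_space) Cauchy_Schwarz_expectation:
  fixes Y Z :: "'a \<Rightarrow> complex"
  assumes [measurable]: "Y \<in> borel_measurable M" "Z \<in> borel_measurable M"
    and Y: "integrable M (\<lambda>\<omega>. (cmod (Y \<omega>))\<^sup>2)" and Z: "integrable M (\<lambda>\<omega>. (cmod (Z \<omega>))\<^sup>2)"
  shows "integrable M (\<lambda>\<omega>. Y \<omega> * cnj (Z \<omega>))"
    and "(cmod (expectation (\<lambda>\<omega>. Y \<omega> * cnj (Z \<omega>))))\<^sup>2
      \<le> expectation (\<lambda>\<omega>. (cmod (Y \<omega>))\<^sup>2) * expectation (\<lambda>\<omega>. (cmod (Z \<omega>))\<^sup>2)"
proof -
  have "norm (Y \<omega> * cnj (Z \<omega>)) \<le> norm ((cmod (Y \<omega>))\<^sup>2 + (cmod (Z \<omega>))\<^sup>2)" for \<omega>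
  proof -
    have "0 \<le> cmod (Y \<omega>) * cmod (Z \<omega>)" by simp
    then have "cmod (Y \<omega>) * cmod (Z \<omega>) \<le> (cmod (Y \<omega>))\<^sup>2 + (cmod (Z \<omega>))\<^sup>2"
      using sum_squares_bound[of "cmod (Y \<omega>)" "cmod (Z \<omega>)"] by linarith
    then show ?thesis by (simp add: norm_mult)
  qed
  then show i: "integrable M (\<lambda>\<omega>. Y \<omega> * cnj (Z \<omega>))"
    using Y Z by (intro Bochner_Integration.integrable_bound[OF Bochner_Integration.integrable_add[OF Y Z]]) auto
  have ia: "integrable M (\<lambda>\<omega>. cmod (Y \<omega>) * cmod (Z \<omega>))"
    using integrable_norm[OF i] by (simp add: norm_mult)
  have "(\<integral>\<^sup>+\<omega>. ennreal (cmod (Y \<omega>)) * ennreal (cmod (Z \<omega>)) \<partial>M)\<^sup>2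
      \<le> (\<integral>\<^sup>+\<omega>. (ennreal (cmod (Y \<omega>)))\<^sup>2 \<partial>M) * (\<integral>\<^sup>+\<omega>. (ennreal (cmod (Z \<omega>)))\<^sup>2 \<partial>M)"
    by (rule Cauchy_Schwarz_nn_integral) auto
  then have "ennreal ((expectation (\<lambda>\<omega>. cmod (Y \<omega>) * cmod (Z \<omega>)))\<^sup>2)
      \<le> ennreal (expectation (\<lambda>\<omega>. (cmod (Y \<omega>))\<^sup>2) * expectation (\<lambda>\<omega>. (cmod (Z \<omega>))\<^sup>2))"
    using ia Y Z by (simp add: ennreal_mult'[symmetric] ennreal_power nn_integral_eq_integral integral_nonneg_AE)
  then have c: "(expectation (\<lambda>\<omega>. cmod (Y \<omega>) * cmod (Z \<omega>)))\<^sup>2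
      \<le> expectation (\<lambda>\<omega>. (cmod (Y \<omega>))\<^sup>2) * expectation (\<lambda>\<omega>. (cmod (Z \<omega>))\<^sup>2)"
    by (subst (asm) ennreal_le_iff) (auto intro!: mult_nonneg_nonneg integral_nonneg_AE)
  have "cmod (expectation (\<lambda>\<omega>. Y \<omega> * cnj (Z \<omega>))) \<le> expectation (\<lambda>\<omega>. cmod (Y \<omega>) * cmod (Z \<omega>))"
    using integral_norm_bound[of M "\<lambda>\<omega>. Y \<omega> * cnj (Z \<omega>)"] by (simp add: norm_mult)
  then show "(cmod (expectation (\<lambda>\<omega>. Y \<omega> * cnj (Z \<omega>))))\<^sup>2
      \<le> expectation (\<lambda>\<omega>. (cmod (Y \<omega>))\<^sup>2) * expectation (\<lambda>\<omega>. (cmod (Z \<omega>))\<^sup>2)"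
    by (intro order_trans[OF power_mono c]) auto
qed

lemma (in prob_space) expectation_square_bound:
  fixes Y :: "'a \<Rightarrow> complex"
  assumes [measurable]: "Y \<in> borel_measurable M" and Y: "integrable M (\<lambda>\<omega>. (cmod (Y \<omega>))\<^sup>2)"
  shows "(cmod (expectation Y))\<^sup>2 \<le> expectation (\<lambda>\<omega>. (cmod (Y \<omega>))\<^sup>2)"
  using Cauchy_Schwarz_expectation(2)[OF assms(1) borel_measurable_const[of 1] Y] by (simp add: prob_space)

lemma (in prob_space) second_moment_add:
  fixes Y Z :: "'a \<Rightarrow> complex"
  assumes [measurable]: "Y \<in> borel_measurable M" "Z \<in> borel_measurable M"
    and Y: "integrable M (\<lambda>\<omega>. (cmod (Y \<omega>))\<^sup>2)" and Z: "integrable M (\<lambda>\<omega>. (cmod (Z \<omega>))\<^sup>2)"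
  shows "integrable M (\<lambda>\<omega>. (cmod (Y \<omega> + Z \<omega>))\<^sup>2)"
    and "expectation (\<lambda>\<omega>. (cmod (Y \<omega> + Z \<omega>))\<^sup>2) = expectation (\<lambda>\<omega>. (cmod (Y \<omega>))\<^sup>2)
      + expectation (\<lambda>\<omega>. (cmod (Z \<omega>))\<^sup>2) + 2 * Re (expectation (\<lambda>\<omega>. Y \<omega> * cnj (Z \<omega>)))"
proof -
  have i: "integrable M (\<lambda>\<omega>. Re (Y \<omega> * cnj (Z \<omega>)))"
    by (intro integrable_Re Cauchy_Schwarz_expectation assms)
  have e: "(cmod (Y \<omega> + Z \<omega>))\<^sup>2 = (cmod (Y \<omega>))\<^sup>2 + (cmod (Z \<omega>))\<^sup>2 + 2 * Re (Y \<omega> * cnj (Z \<omega>))" for \<omega>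
    unfolding cmod_power2 by (simp add: power2_sum algebra_simps)
  show "integrable M (\<lambda>\<omega>. (cmod (Y \<omega> + Z \<omega>))\<^sup>2)"
    unfolding e by (intro Bochner_Integration.integrable_add integrable_mult_right Y Z i)
  show "expectation (\<lambda>\<omega>. (cmod (Y \<omega> + Z \<omega>))\<^sup>2) = expectation (\<lambda>\<omega>. (cmod (Y \<omega>))\<^sup>2)
      + expectation (\<lambda>\<omega>. (cmod (Z \<omega>))\<^sup>2) + 2 * Re (expectation (\<lambda>\<omega>. Y \<omega> * cnj (Z \<omega>)))"
    unfolding e using Y Z i
    by (simp add: integral_Re[OF Cauchy_Schwarz_expectation(1)[OF assms]] del: times_complex.sel)
qed

text \<open>The threshold \<open>N\<close> is there because Y_n is known to be square-integrable
  only for large n.\<close>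

lemma (in prob_space) cross_expectation_tendsto_0:
  fixes Y Z :: "nat \<Rightarrow> 'a \<Rightarrow> complex"
  assumes meas: "\<And>n. N \<le> n \<Longrightarrow> Y n \<in> borel_measurable M" "\<And>n. N \<le> n \<Longrightarrow> Z n \<in> borel_measurable M"
    and Y: "\<And>n. N \<le> n \<Longrightarrow> integrable M (\<lambda>\<omega>. (cmod (Y n \<omega>))\<^sup>2)"
    and Z: "\<And>n. N \<le> n \<Longrightarrow> integrable M (\<lambda>\<omega>. (cmod (Z n \<omega>))\<^sup>2)"
    and limY: "(\<lambda>n. expectation (\<lambda>\<omega>. (cmod (Y n \<omega>))\<^sup>2)) \<longlonglongrightarrow> b"
    and limZ: "(\<lambda>n. expectation (\<lambda>\<omega>. (cmod (Z n \<omega>))\<^sup>2)) \<longlonglongrightarrow> 0"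
  shows "(\<lambda>n. expectation (\<lambda>\<omega>. Y n \<omega> * cnj (Z n \<omega>))) \<longlonglongrightarrow> 0"
proof -
  have "(\<lambda>n. sqrt (expectation (\<lambda>\<omega>. (cmod (Y n \<omega>))\<^sup>2) * expectation (\<lambda>\<omega>. (cmod (Z n \<omega>))\<^sup>2))) \<longlonglongrightarrow> sqrt (b * 0)"
    by (intro tendsto_intros limY limZ)
  then have "(\<lambda>n. sqrt (expectation (\<lambda>\<omega>. (cmod (Y n \<omega>))\<^sup>2) * expectation (\<lambda>\<omega>. (cmod (Z n \<omega>))\<^sup>2))) \<longlonglongrightarrow> 0" by simp
  then show ?thesis
  proof (rule Lim_null_comparison[rotated])
    show "\<forall>\<^sub>F n in sequentially. norm (expectation (\<lambda>\<omega>. Y n \<omega> * cnj (Z n \<omega>)))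
        \<le> sqrt (expectation (\<lambda>\<omega>. (cmod (Y n \<omega>))\<^sup>2) * expectation (\<lambda>\<omega>. (cmod (Z n \<omega>))\<^sup>2))"
      using eventually_ge_at_top[of N]
      by eventually_elim (intro real_le_rsqrt Cauchy_Schwarz_expectation meas Y Z)
  qed
qed

lemma cmod_sum_squared_le:
  "(cmod (x + y))\<^sup>2 \<le> 2 * (cmod x)\<^sup>2 + 2 * (cmod y)\<^sup>2"
proof -
  have "(cmod (x + y))\<^sup>2 \<le> (cmod x + cmod y)\<^sup>2" by (intro power_mono norm_triangle_ineq) auto
  then show ?thesis using sum_squares_bound[of "cmod x" "cmod y"] by (simp add: power2_sum)
qed

lemma (in prob_space) integrable_indicator_event:
  "B \<in> events \<Longrightarrow> integrable M (indicat_real B)"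
  by (rule integrable_const_bound[where B=1]) (auto simp: indicator_def)

lemma (in prob_space) integrable_restricted:
  fixes f :: "'a \<Rightarrow> real"
  assumes [measurable]: "B \<in> sets M" and f: "integrable M f"
  shows "integrable M (\<lambda>\<omega>. indicat_real B \<omega> * f \<omega>)" "integrable M (\<lambda>\<omega>. (1 - indicat_real B \<omega>) * f \<omega>)"
proof -
  show *: "integrable M (\<lambda>\<omega>. indicat_real B \<omega> * f \<omega>)"
    using integrable_real_mult_indicator[OF assms] by (simp add: mult.commute)
  show "integrable M (\<lambda>\<omega>. (1 - indicat_real B \<omega>) * f \<omega>)"
    unfolding left_diff_distrib using f * by simp
qed

text \<open>
  The variance of \<open>W n\<close> converges to the limiting second moment of its linearization \<open>G n\<close>,
  which is only known to approximate \<open>W n\<close> off \<open>B n\<close>. So nothing is left for \<open>B n\<close>: the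
  inner product of \<open>W n - E (W n)\<close> with \<open>G n\<close> converges to \<open>v\<close> as well, hence the two are
  asymptotically equal in mean square.
\<close>

lemma (in prob_space) no_second_moment_on_rare_events:
  fixes W G :: "nat \<Rightarrow> 'a \<Rightarrow> complex" and B :: "nat \<Rightarrow> 'a set"
  assumes W[measurable]: "\<And>n. W n \<in> borel_measurable M" and G[measurable]: "\<And>n. G n \<in> borel_measurable M"
    and B[measurable]: "\<And>n. B n \<in> sets M"
    and sqW: "\<And>n. N \<le> n \<Longrightarrow> integrable M (\<lambda>\<omega>. (cmod (W n \<omega>))\<^sup>2)"
    and sqG: "\<And>n. N \<le> n \<Longrightarrow> integrable M (\<lambda>\<omega>. (cmod (G n \<omega>))\<^sup>2)"
    and meanG: "\<And>n. N \<le> n \<Longrightarrow> expectation (G n) = 0"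
    and limG: "(\<lambda>n. expectation (\<lambda>\<omega>. (cmod (G n \<omega>))\<^sup>2)) \<longlonglongrightarrow> v"
    and limGB: "(\<lambda>n. expectation (\<lambda>\<omega>. indicat_real (B n) \<omega> * (cmod (G n \<omega>))\<^sup>2)) \<longlonglongrightarrow> 0"
    and limB: "(\<lambda>n. prob (B n)) \<longlonglongrightarrow> 0"
    and lim\<Delta>: "(\<lambda>n. expectation (\<lambda>\<omega>. (1 - indicat_real (B n) \<omega>) * (cmod (W n \<omega> - G n \<omega>))\<^sup>2)) \<longlonglongrightarrow> 0"
    and limW: "(\<lambda>n. expectation (\<lambda>\<omega>. (cmod (W n \<omega> - expectation (W n)))\<^sup>2)) \<longlonglongrightarrow> v"
  shows "(\<lambda>n. expectation (\<lambda>\<omega>. indicat_real (B n) \<omega> * (cmod (W n \<omega>))\<^sup>2)) \<longlonglongrightarrow> 0"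
proof -
  define w where "w n = expectation (W n)" for n
  define T where "T n \<omega> = W n \<omega> - w n" for n \<omega>
  \<comment> \<open>\<open>\<Delta> n\<close> is the linearization error off \<open>B n\<close> and
    \<open>H n\<close> the linearization on \<open>B n\<close>; both tend to 0 in mean square,
    whereas nothing is known yet about \<open>W n\<close> on \<open>B n\<close>.\<close>
  define \<Delta> where "\<Delta> n \<omega> = of_real (1 - indicat_real (B n) \<omega>) * (W n \<omega> - G n \<omega>)" for n \<omega>
  define H where "H n \<omega> = of_real (indicat_real (B n) \<omega>) * G n \<omega>" for n \<omega>
  define \<rho> where "\<rho> n = expectation (\<lambda>\<omega>. (cmod (T n \<omega> - G n \<omega>))\<^sup>2)" for n
  have [measurable]: "T n \<in> borel_measurable M" "\<Delta> n \<in> borel_measurable M" "H n \<in> borel_measurable M" for n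
    unfolding T_def[abs_def] \<Delta>_def[abs_def] H_def[abs_def] by measurable
  have iG: "integrable M (G n)" if "N \<le> n" for n
    by (rule complex_square_integrable[OF G sqG[OF that]])
  have sqT: "integrable M (\<lambda>\<omega>. (cmod (T n \<omega>))\<^sup>2)" if "N \<le> n" for n
    unfolding T_def by (rule complex_second_moment_shift(1)[OF W sqW[OF that]])
  have H2: "(cmod (H n \<omega>))\<^sup>2 = indicat_real (B n) \<omega> * (cmod (G n \<omega>))\<^sup>2"
    and \<Delta>2: "(cmod (\<Delta> n \<omega>))\<^sup>2 = (1 - indicat_real (B n) \<omega>) * (cmod (W n \<omega> - G n \<omega>))\<^sup>2" for n \<omega>
    by (auto simp: H_def \<Delta>_def norm_mult power_mult_distrib indicator_def)
  have sqH: "integrable M (\<lambda>\<omega>. (cmod (H n \<omega>))\<^sup>2)" if "N \<le> n" for n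
    unfolding H2 by (rule integrable_restricted[OF B sqG[OF that]])
  have sqWG: "integrable M (\<lambda>\<omega>. (cmod (W n \<omega> - G n \<omega>))\<^sup>2)" if "N \<le> n" for n
    using second_moment_add(1)[of "W n" "\<lambda>\<omega>. - G n \<omega>"] sqW[OF that] sqG[OF that] by simp
  have sq\<Delta>: "integrable M (\<lambda>\<omega>. (cmod (\<Delta> n \<omega>))\<^sup>2)" if "N \<le> n" for n
    unfolding \<Delta>2 by (rule integrable_restricted[OF B sqWG[OF that]])
  have sqTG: "integrable M (\<lambda>\<omega>. (cmod (T n \<omega> - G n \<omega>))\<^sup>2)" if "N \<le> n" for n
    using second_moment_add(1)[of "T n" "\<lambda>\<omega>. - G n \<omega>"] sqT[OF that] sqG[OF that] by simp
  have limT: "(\<lambda>n. expectation (\<lambda>\<omega>. (cmod (T n \<omega>))\<^sup>2)) \<longlonglongrightarrow> v"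
    using limW by (simp add: T_def w_def)
  have \<rho>_eq: "\<rho> n = expectation (\<lambda>\<omega>. (cmod (T n \<omega>))\<^sup>2) + expectation (\<lambda>\<omega>. (cmod (G n \<omega>))\<^sup>2)
      - 2 * Re (expectation (\<lambda>\<omega>. T n \<omega> * cnj (G n \<omega>)))" if "N \<le> n" for n
    unfolding \<rho>_def using second_moment_add(2)[of "T n" "\<lambda>\<omega>. - G n \<omega>"] sqT[OF that] sqG[OF that] by simp
  \<comment> \<open>On \<open>B n\<close> the product is kept as
    \<open>T n \<omega> * cnj (H n \<omega>)\<close>, which Cauchy-Schwarz controls; off
    \<open>B n\<close>, \<open>T n\<close> is \<open>G n + \<Delta> n - w n\<close>. As
    \<open>G n\<close> is centered, the constant \<open>w n\<close> survives only against
    \<open>H n\<close>.\<close>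
  have TG: "expectation (\<lambda>\<omega>. T n \<omega> * cnj (G n \<omega>)) =
      of_real (expectation (\<lambda>\<omega>. (cmod (G n \<omega>))\<^sup>2) - expectation (\<lambda>\<omega>. indicat_real (B n) \<omega> * (cmod (G n \<omega>))\<^sup>2))
      + expectation (\<lambda>\<omega>. \<Delta> n \<omega> * cnj (G n \<omega>)) + expectation (\<lambda>\<omega>. T n \<omega> * cnj (H n \<omega>))
      + w n * cnj (expectation (H n))" if n: "N \<le> n" for n
  proof -
    have cs: "integrable M (\<lambda>\<omega>. \<Delta> n \<omega> * cnj (G n \<omega>))" "integrable M (\<lambda>\<omega>. T n \<omega> * cnj (H n \<omega>))"
      by (intro Cauchy_Schwarz_expectation sqT sq\<Delta> sqG sqH n; measurable)+
    have iH: "integrable M (H n)" by (rule complex_square_integrable[OF _ sqH[OF n]]) simp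
    have "T n \<omega> * cnj (G n \<omega>) = of_real ((cmod (G n \<omega>))\<^sup>2 - indicat_real (B n) \<omega> * (cmod (G n \<omega>))\<^sup>2)
      + \<Delta> n \<omega> * cnj (G n \<omega>) + T n \<omega> * cnj (H n \<omega>) + w n * cnj (H n \<omega>) - w n * cnj (G n \<omega>)" for \<omega>
    proof -
      have c: "complex_of_real ((cmod (G n \<omega>))\<^sup>2) = G n \<omega> * cnj (G n \<omega>)" by (rule complex_norm_square)
      have "of_real ((cmod (G n \<omega>))\<^sup>2 - indicat_real (B n) \<omega> * (cmod (G n \<omega>))\<^sup>2) =
          (1 - of_real (indicat_real (B n) \<omega>)) * (G n \<omega> * cnj (G n \<omega>))"
        unfolding c[symmetric] by (simp add: algebra_simps)
      then show ?thesis
        by (simp add: T_def \<Delta>_def H_def algebra_simps)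
    qed
    then have "expectation (\<lambda>\<omega>. T n \<omega> * cnj (G n \<omega>)) = expectation (\<lambda>\<omega>.
      of_real ((cmod (G n \<omega>))\<^sup>2 - indicat_real (B n) \<omega> * (cmod (G n \<omega>))\<^sup>2)
      + \<Delta> n \<omega> * cnj (G n \<omega>) + T n \<omega> * cnj (H n \<omega>) + w n * cnj (H n \<omega>) - w n * cnj (G n \<omega>))"
      by presburger
    also have "\<dots> = expectation (\<lambda>\<omega>. of_real ((cmod (G n \<omega>))\<^sup>2 - indicat_real (B n) \<omega> * (cmod (G n \<omega>))\<^sup>2))
      + expectation (\<lambda>\<omega>. \<Delta> n \<omega> * cnj (G n \<omega>)) + expectation (\<lambda>\<omega>. T n \<omega> * cnj (H n \<omega>))
      + w n * cnj (expectation (H n)) - w n * cnj (expectation (G n))"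
      using cs iH iG[OF n] sqG[OF n] integrable_restricted(1)[OF B sqG[OF n]]
      by (simp del: of_real_diff)
    also have "expectation (\<lambda>\<omega>. complex_of_real ((cmod (G n \<omega>))\<^sup>2 - indicat_real (B n) \<omega> * (cmod (G n \<omega>))\<^sup>2)) =
      of_real (expectation (\<lambda>\<omega>. (cmod (G n \<omega>))\<^sup>2) - expectation (\<lambda>\<omega>. indicat_real (B n) \<omega> * (cmod (G n \<omega>))\<^sup>2))"
      using sqG[OF n] integrable_restricted(1)[OF B sqG[OF n]] by (simp del: of_real_diff)
    finally show ?thesis using meanG[OF n] by simp
  qed
  \<comment> \<open>Off \<open>B n\<close>, \<open>w n\<close> is the difference of
    \<open>W n - G n\<close> and \<open>T n - G n\<close>. The estimate is used twice: first to see
    that \<open>w n\<close> is bounded, and again, once \<open>\<rho>\<close> is known to vanish in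
    the limit, to see that \<open>w n\<close> does too.\<close>
  have w_le: "(cmod (w n))\<^sup>2 * (1 - prob (B n)) \<le> 2 * \<rho> n
      + 2 * expectation (\<lambda>\<omega>. (1 - indicat_real (B n) \<omega>) * (cmod (W n \<omega> - G n \<omega>))\<^sup>2)" if n: "N \<le> n" for n
  proof -
    have "(cmod (w n))\<^sup>2 * (1 - prob (B n)) = expectation (\<lambda>\<omega>. (1 - indicat_real (B n) \<omega>) * (cmod (w n))\<^sup>2)"
      using integrable_indicator_event[OF B, of n] by (simp add: prob_space)
    also have "\<dots> \<le> expectation (\<lambda>\<omega>. 2 * (cmod (T n \<omega> - G n \<omega>))\<^sup>2 +
        2 * ((1 - indicat_real (B n) \<omega>) * (cmod (W n \<omega> - G n \<omega>))\<^sup>2))"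
    proof (intro integral_mono)
      fix \<omega>
      have "(cmod (w n))\<^sup>2 \<le> 2 * (cmod (T n \<omega> - G n \<omega>))\<^sup>2 + 2 * (cmod (W n \<omega> - G n \<omega>))\<^sup>2"
        using cmod_sum_squared_le[of "- (T n \<omega> - G n \<omega>)" "W n \<omega> - G n \<omega>"] unfolding T_def norm_minus_cancel by simp
      then show "(1 - indicat_real (B n) \<omega>) * (cmod (w n))\<^sup>2 \<le> 2 * (cmod (T n \<omega> - G n \<omega>))\<^sup>2 +
        2 * ((1 - indicat_real (B n) \<omega>) * (cmod (W n \<omega> - G n \<omega>))\<^sup>2)" by (simp add: indicator_def)
    next
      show "integrable M (\<lambda>\<omega>. (1 - indicat_real (B n) \<omega>) * (cmod (w n))\<^sup>2)"
        by (intro integrable_restricted(2)) auto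
    qed (use integrable_restricted(2)[OF B sqWG[OF n]] sqTG[OF n] in simp)
    also have "\<dots> = 2 * \<rho> n + 2 * expectation (\<lambda>\<omega>. (1 - indicat_real (B n) \<omega>) * (cmod (W n \<omega> - G n \<omega>))\<^sup>2)"
      unfolding \<rho>_def using integrable_restricted(2)[OF B sqWG[OF n]] sqTG[OF n] by simp
    finally show ?thesis .
  qed
  have limH: "(\<lambda>n. expectation (\<lambda>\<omega>. (cmod (H n \<omega>))\<^sup>2)) \<longlonglongrightarrow> 0" unfolding H2 by (rule limGB)
  have lim\<Delta>': "(\<lambda>n. expectation (\<lambda>\<omega>. (cmod (\<Delta> n \<omega>))\<^sup>2)) \<longlonglongrightarrow> 0" unfolding \<Delta>2 by (rule lim\<Delta>)
  have limTH: "(\<lambda>n. expectation (\<lambda>\<omega>. T n \<omega> * cnj (H n \<omega>))) \<longlonglongrightarrow> 0"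
    by (rule cross_expectation_tendsto_0[OF _ _ sqT sqH limT limH]) auto
  have "(\<lambda>n. expectation (\<lambda>\<omega>. G n \<omega> * cnj (\<Delta> n \<omega>))) \<longlonglongrightarrow> 0"
    by (rule cross_expectation_tendsto_0[OF _ _ sqG sq\<Delta> limG lim\<Delta>']) auto
  then have *: "(\<lambda>n. cnj (expectation (\<lambda>\<omega>. G n \<omega> * cnj (\<Delta> n \<omega>)))) \<longlonglongrightarrow> cnj 0" by (rule tendsto_cnj)
  have lim\<Delta>G: "(\<lambda>n. expectation (\<lambda>\<omega>. \<Delta> n \<omega> * cnj (G n \<omega>))) \<longlonglongrightarrow> 0"
  proof -
    have "cnj (expectation (\<lambda>\<omega>. G n \<omega> * cnj (\<Delta> n \<omega>))) = expectation (\<lambda>\<omega>. \<Delta> n \<omega> * cnj (G n \<omega>))" for n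
      unfolding Bochner_Integration.integral_cnj[symmetric] by (simp add: mult.commute)
    then show ?thesis using * by simp
  qed
  have limEH: "(\<lambda>n. cnj (expectation (H n))) \<longlonglongrightarrow> 0"
  proof -
    have "(\<lambda>n. sqrt (expectation (\<lambda>\<omega>. (cmod (H n \<omega>))\<^sup>2))) \<longlonglongrightarrow> 0"
      using tendsto_real_sqrt[OF limH] by simp
    then show ?thesis
    proof (rule Lim_null_comparison[rotated])
      show "\<forall>\<^sub>F n in sequentially. norm (cnj (expectation (H n))) \<le> sqrt (expectation (\<lambda>\<omega>. (cmod (H n \<omega>))\<^sup>2))"
        using eventually_ge_at_top[of N]
      proof eventually_elim
        case (elim n)
        show ?case unfolding complex_mod_cnj
          by (intro real_le_rsqrt expectation_square_bound sqH elim) measurable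
      qed
    qed
  qed
  have evB: "\<forall>\<^sub>F n in sequentially. prob (B n) < 1 / 2"
    using limB by (rule order_tendstoD(2)) simp
  \<comment> \<open>Only variances of \<open>W n\<close> are assumed to converge, so its mean needs
    an a priori bound before the last term of \<open>TG\<close> can be sent to 0. The constant comes
    from \<open>w_le\<close> with \<open>\<rho> n\<close> at most 4 (v + 1) and
    \<open>prob (B n)\<close> below 1/2.\<close>
  have Bw: "Bseq w"
  proof -
    have "\<forall>\<^sub>F n in sequentially. expectation (\<lambda>\<omega>. (cmod (T n \<omega>))\<^sup>2) < v + 1"
         "\<forall>\<^sub>F n in sequentially. expectation (\<lambda>\<omega>. (cmod (G n \<omega>))\<^sup>2) < v + 1"
         "\<forall>\<^sub>F n in sequentially. expectation (\<lambda>\<omega>. (1 - indicat_real (B n) \<omega>) * (cmod (W n \<omega> - G n \<omega>))\<^sup>2) < 1"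
      using order_tendstoD(2)[OF limT, of "v + 1"] order_tendstoD(2)[OF limG, of "v + 1"]
        order_tendstoD(2)[OF lim\<Delta>, of 1] by auto
    then have "\<forall>\<^sub>F n in sequentially. norm (w n) \<le> sqrt (16 * (v + 1) + 4)"
      using evB eventually_ge_at_top[of N]
    proof eventually_elim
      case (elim n)
      have "\<rho> n \<le> expectation (\<lambda>\<omega>. 2 * (cmod (T n \<omega>))\<^sup>2 + 2 * (cmod (G n \<omega>))\<^sup>2)"
        unfolding \<rho>_def
      proof (intro integral_mono)
        show "(cmod (T n \<omega> - G n \<omega>))\<^sup>2 \<le> 2 * (cmod (T n \<omega>))\<^sup>2 + 2 * (cmod (G n \<omega>))\<^sup>2" for \<omega>
          using cmod_sum_squared_le[of "T n \<omega>" "- G n \<omega>"] by simp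
      qed (use sqTG[OF elim(5)] sqT[OF elim(5)] sqG[OF elim(5)] in auto)
      also have "\<dots> = 2 * expectation (\<lambda>\<omega>. (cmod (T n \<omega>))\<^sup>2) + 2 * expectation (\<lambda>\<omega>. (cmod (G n \<omega>))\<^sup>2)"
        using sqT[OF elim(5)] sqG[OF elim(5)] by simp
      also have "\<dots> \<le> 4 * (v + 1)" using elim by simp
      finally have "(cmod (w n))\<^sup>2 * (1 - prob (B n)) \<le> 8 * (v + 1) + 2" using w_le[OF elim(5)] elim(3) by simp
      moreover have "(cmod (w n))\<^sup>2 * (1 / 2) \<le> (cmod (w n))\<^sup>2 * (1 - prob (B n))"
        using elim(4) by (intro mult_left_mono) auto
      ultimately have "(cmod (w n))\<^sup>2 \<le> 16 * (v + 1) + 4" by simp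
      then show ?case by (rule real_le_rsqrt)
    qed
    then show ?thesis by (rule BfunI)
  qed
  then obtain K where "\<And>n. cmod (w n) \<le> K" by (auto simp: Bseq_def)
  then have "(\<lambda>n. w n * cnj (expectation (H n))) \<longlonglongrightarrow> 0"
    by (intro lim_null_mult_left_bounded[where B=K] limEH always_eventually) auto
  then have "(\<lambda>n. of_real (expectation (\<lambda>\<omega>. (cmod (G n \<omega>))\<^sup>2) - expectation (\<lambda>\<omega>. indicat_real (B n) \<omega> * (cmod (G n \<omega>))\<^sup>2))
      + expectation (\<lambda>\<omega>. \<Delta> n \<omega> * cnj (G n \<omega>)) + expectation (\<lambda>\<omega>. T n \<omega> * cnj (H n \<omega>))
      + w n * cnj (expectation (H n))) \<longlonglongrightarrow> of_real (v - 0) + 0 + 0 + 0"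
    by (intro tendsto_add tendsto_of_real tendsto_diff limG limGB lim\<Delta>G limTH)
  then have limTG: "(\<lambda>n. expectation (\<lambda>\<omega>. T n \<omega> * cnj (G n \<omega>))) \<longlonglongrightarrow> of_real (v - 0) + 0 + 0 + 0"
    by (rule Lim_transform_eventually) (rule eventually_mono[OF eventually_ge_at_top[of N] TG[symmetric]])
  have "(\<lambda>n. expectation (\<lambda>\<omega>. (cmod (T n \<omega>))\<^sup>2) + expectation (\<lambda>\<omega>. (cmod (G n \<omega>))\<^sup>2)
      - 2 * Re (expectation (\<lambda>\<omega>. T n \<omega> * cnj (G n \<omega>)))) \<longlonglongrightarrow> v + v - 2 * Re (of_real (v - 0) + 0 + 0 + 0)"
    by (intro tendsto_add tendsto_diff tendsto_mult tendsto_const limT limG tendsto_Re limTG)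
  then have "(\<lambda>n. expectation (\<lambda>\<omega>. (cmod (T n \<omega>))\<^sup>2) + expectation (\<lambda>\<omega>. (cmod (G n \<omega>))\<^sup>2)
      - 2 * Re (expectation (\<lambda>\<omega>. T n \<omega> * cnj (G n \<omega>)))) \<longlonglongrightarrow> 0" by simp
  then have lim\<rho>: "\<rho> \<longlonglongrightarrow> 0"
    by (rule Lim_transform_eventually) (rule eventually_mono[OF eventually_ge_at_top[of N] \<rho>_eq[symmetric]])
  define \<epsilon> where "\<epsilon> n = 2 * \<rho> n + 2 * expectation (\<lambda>\<omega>. (1 - indicat_real (B n) \<omega>) * (cmod (W n \<omega> - G n \<omega>))\<^sup>2)" for n
  have "\<epsilon> \<longlonglongrightarrow> 2 * 0 + 2 * 0" unfolding \<epsilon>_def by (intro tendsto_intros lim\<rho> lim\<Delta>)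
  then have lim\<epsilon>: "\<epsilon> \<longlonglongrightarrow> 0" by simp
  have "(\<lambda>n. 4 * (2 * \<epsilon> n + \<rho> n) + 2 * expectation (\<lambda>\<omega>. indicat_real (B n) \<omega> * (cmod (G n \<omega>))\<^sup>2)) \<longlonglongrightarrow> 4 * (2 * 0 + 0) + 2 * 0"
    by (intro tendsto_intros lim\<epsilon> lim\<rho> limGB)
  then have lim: "(\<lambda>n. 4 * (2 * \<epsilon> n + \<rho> n) + 2 * expectation (\<lambda>\<omega>. indicat_real (B n) \<omega> * (cmod (G n \<omega>))\<^sup>2)) \<longlonglongrightarrow> 0"
    by simp
  show ?thesis
  proof (rule Lim_null_comparison[OF _ lim])
    show "\<forall>\<^sub>F n in sequentially. norm (expectation (\<lambda>\<omega>. indicat_real (B n) \<omega> * (cmod (W n \<omega>))\<^sup>2))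
      \<le> 4 * (2 * \<epsilon> n + \<rho> n) + 2 * expectation (\<lambda>\<omega>. indicat_real (B n) \<omega> * (cmod (G n \<omega>))\<^sup>2)"
      using evB eventually_ge_at_top[of N]
    proof eventually_elim
      case (elim n)
      note n = elim(2)
      have "(cmod (w n))\<^sup>2 * (1 / 2) \<le> (cmod (w n))\<^sup>2 * (1 - prob (B n))"
        using elim(1) by (intro mult_left_mono) auto
      then have w: "(cmod (w n))\<^sup>2 \<le> 2 * \<epsilon> n" using w_le[OF n] by (simp add: \<epsilon>_def)
      \<comment> \<open>\<open>W n\<close> is the sum of \<open>w n\<close>,
        \<open>T n - G n\<close> and \<open>G n\<close>: the first two are small in mean square
        everywhere, the third on \<open>B n\<close>.\<close>
      have "expectation (\<lambda>\<omega>. indicat_real (B n) \<omega> * (cmod (W n \<omega>))\<^sup>2) \<le> expectation (\<lambda>\<omega>.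
          4 * (2 * \<epsilon> n + (cmod (T n \<omega> - G n \<omega>))\<^sup>2) + 2 * (indicat_real (B n) \<omega> * (cmod (G n \<omega>))\<^sup>2))"
      proof (intro integral_mono)
        fix \<omega>
        have "(cmod (W n \<omega>))\<^sup>2 \<le> 2 * (cmod (w n + (T n \<omega> - G n \<omega>)))\<^sup>2 + 2 * (cmod (G n \<omega>))\<^sup>2"
          using cmod_sum_squared_le[of "w n + (T n \<omega> - G n \<omega>)" "G n \<omega>"] by (simp add: T_def)
        then have "(cmod (W n \<omega>))\<^sup>2 \<le> 4 * (2 * \<epsilon> n + (cmod (T n \<omega> - G n \<omega>))\<^sup>2) + 2 * (cmod (G n \<omega>))\<^sup>2"
          using w cmod_sum_squared_le[of "w n" "T n \<omega> - G n \<omega>"] by simp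
        moreover have "0 \<le> \<epsilon> n" using order_trans[OF zero_le_power2 w] by simp
        ultimately show "indicat_real (B n) \<omega> * (cmod (W n \<omega>))\<^sup>2 \<le>
            4 * (2 * \<epsilon> n + (cmod (T n \<omega> - G n \<omega>))\<^sup>2) + 2 * (indicat_real (B n) \<omega> * (cmod (G n \<omega>))\<^sup>2)"
          by (simp add: indicator_def)
      next
        show "integrable M (\<lambda>\<omega>. indicat_real (B n) \<omega> * (cmod (W n \<omega>))\<^sup>2)"
          by (rule integrable_restricted(1)[OF B sqW[OF n]])
      qed (use sqTG[OF n] integrable_restricted(1)[OF B sqG[OF n]] in simp)
      also have "\<dots> = 4 * (2 * \<epsilon> n + \<rho> n) + 2 * expectation (\<lambda>\<omega>. indicat_real (B n) \<omega> * (cmod (G n \<omega>))\<^sup>2)"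
        using sqTG[OF n] integrable_restricted(1)[OF B sqG[OF n]] by (simp add: \<rho>_def prob_space)
      finally show ?case by (subst real_norm_def, subst abs_of_nonneg) (auto intro!: integral_nonneg_AE)
    qed
  qed
qed

section \<open>Averages of independent samples\<close>

locale iid_sample = prob_space M for M :: "'a measure" +
  fixes X :: "nat \<Rightarrow> 'a \<Rightarrow> real"
  assumes indep: "indep_vars (\<lambda>_. borel) X {1..}"
    and ident: "1 \<le> j \<Longrightarrow> distr M borel (X j) = distr M borel (X 1)"
begin

definition average :: "(real \<Rightarrow> complex) \<Rightarrow> nat \<Rightarrow> 'a \<Rightarrow> complex" where
  "average q n \<omega> = (\<Sum>j=1..n. q (X j \<omega>)) / of_nat n"

lemma rv_sample [measurable (raw)]: "1 \<le> j \<Longrightarrow> random_variable borel (X j)"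
  using indep by (auto simp: indep_vars_def)

lemma rv_average [measurable (raw)]:
  assumes [measurable]: "q \<in> borel_measurable borel"
  shows "random_variable borel (average q n)"
  unfolding average_def[abs_def]
  by (intro borel_measurable_divide borel_measurable_sum borel_measurable_const
        measurable_compose[OF _ assms] rv_sample) auto

lemma sample_transfer:
  fixes q :: "real \<Rightarrow> 'b::{banach, second_countable_topology}"
  assumes [measurable]: "q \<in> borel_measurable borel" and j: "1 \<le> j"
  shows "integrable M (\<lambda>\<omega>. q (X j \<omega>)) \<longleftrightarrow> integrable M (\<lambda>\<omega>. q (X 1 \<omega>))"
    and "expectation (\<lambda>\<omega>. q (X j \<omega>)) = expectation (\<lambda>\<omega>. q (X 1 \<omega>))"
proof -
  have m: "X j \<in> borel_measurable M" "X 1 \<in> borel_measurable M" using j by auto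
  show "integrable M (\<lambda>\<omega>. q (X j \<omega>)) \<longleftrightarrow> integrable M (\<lambda>\<omega>. q (X 1 \<omega>))"
    using integrable_distr_eq[OF m(1) assms(1)] integrable_distr_eq[OF m(2) assms(1)] ident[OF j] by simp
  show "expectation (\<lambda>\<omega>. q (X j \<omega>)) = expectation (\<lambda>\<omega>. q (X 1 \<omega>))"
    using integral_distr[OF m(1) assms(1)] integral_distr[OF m(2) assms(1)] ident[OF j] by simp
qed

text \<open>Independence and centering remove the off-diagonal terms of the double sum. At
  \<open>n = 0\<close> both sides are 0 by the convention for division.\<close>

lemma average_second_moment:
  assumes q[measurable]: "q \<in> borel_measurable borel"
    and sq: "integrable M (\<lambda>\<omega>. (cmod (q (X 1 \<omega>)))\<^sup>2)" and mean: "expectation (\<lambda>\<omega>. q (X 1 \<omega>)) = 0"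
  shows "integrable M (\<lambda>\<omega>. (cmod (average q n \<omega>))\<^sup>2)"
    and "expectation (\<lambda>\<omega>. (cmod (average q n \<omega>))\<^sup>2) = expectation (\<lambda>\<omega>. (cmod (q (X 1 \<omega>)))\<^sup>2) / real n"
proof -
  define V where "V = expectation (\<lambda>\<omega>. (cmod (q (X 1 \<omega>)))\<^sup>2)"
  have m: "(\<lambda>\<omega>. q (X j \<omega>)) \<in> borel_measurable M" if "1 \<le> j" for j
    using that by (intro measurable_compose[OF _ q] rv_sample)
  have i1: "integrable M (\<lambda>\<omega>. q (X 1 \<omega>))"
    by (rule complex_square_integrable[OF m sq]) simp
  have i: "integrable M (\<lambda>\<omega>. q (X j \<omega>))" "expectation (\<lambda>\<omega>. q (X j \<omega>)) = 0" if "1 \<le> j" for j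
    using sample_transfer[OF q that] i1 mean by auto
  have s: "integrable M (\<lambda>\<omega>. (cmod (q (X j \<omega>)))\<^sup>2)" "expectation (\<lambda>\<omega>. (cmod (q (X j \<omega>)))\<^sup>2) = V" if "1 \<le> j" for j
    using sample_transfer[of "\<lambda>x. (cmod (q x))\<^sup>2", OF _ that] sq by (auto simp: V_def)
  have ij: "integrable M (\<lambda>\<omega>. q (X j \<omega>) * cnj (q (X k \<omega>)))
      \<and> expectation (\<lambda>\<omega>. q (X j \<omega>) * cnj (q (X k \<omega>))) = (if j = k then of_real V else 0)"
    if jk: "j \<in> {1..n}" "k \<in> {1..n}" for j k
  proof (cases "j = k")
    case True
    have "q (X j \<omega>) * cnj (q (X j \<omega>)) = of_real ((cmod (q (X j \<omega>)))\<^sup>2)" for \<omega>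
      by (simp add: complex_norm_square del: of_real_power)
    then show ?thesis using True s[of j] jk by (simp del: of_real_power)
  next
    case False
    \<comment> \<open>A sum over the singleton \<open>{k}\<close> turns independence of the family
      into independence of the pair.\<close>
    have "indep_var borel (X j) borel (X k)"
      using indep_vars_sum[of "{k}" j X] indep_vars_subset[OF indep, of "{j, k}"] jk False by simp
    then have "indep_var borel (q \<circ> X j) borel ((\<lambda>x. cnj (q x)) \<circ> X k)"
      by (intro indep_var_compose) (use q in auto)
    then have v: "indep_var borel (\<lambda>\<omega>. q (X j \<omega>)) borel (\<lambda>\<omega>. cnj (q (X k \<omega>)))"
      by (simp add: comp_def)
    have c: "integrable M (\<lambda>\<omega>. cnj (q (X k \<omega>)))" using i(1)[of k] jk by simp
    have j: "integrable M (\<lambda>\<omega>. q (X j \<omega>))" using i(1)[of j] jk by simp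
    show ?thesis using indep_var_lebesgue_integral[OF v j c] indep_var_integrable[OF v j c] i(2)[of j] jk False
      by simp
  qed
  let ?S = "\<lambda>\<omega>. \<Sum>j=1..n. \<Sum>k=1..n. q (X j \<omega>) * cnj (q (X k \<omega>))"
  have int: "integrable M ?S"
    using ij by (intro Bochner_Integration.integrable_sum) blast
  have S: "(cmod (\<Sum>j=1..n. q (X j \<omega>)))\<^sup>2 = Re (?S \<omega>)" for \<omega>
  proof -
    have "complex_of_real ((cmod (\<Sum>j=1..n. q (X j \<omega>)))\<^sup>2) = ?S \<omega>"
      by (simp only: complex_norm_square cnj_sum sum_product)
    then show ?thesis by (metis Re_complex_of_real)
  qed
  have "expectation ?S = (\<Sum>j=1..n. \<Sum>k=1..n. if j = k then of_real V else 0)"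
    using ij by (subst Bochner_Integration.integral_sum, force, intro sum.cong refl,
      subst Bochner_Integration.integral_sum) auto
  also have "\<dots> = of_real (real n * V)" by simp
  finally have E: "expectation ?S = of_real (real n * V)" .
  have A: "(cmod (average q n \<omega>))\<^sup>2 = Re (?S \<omega>) / (real n)\<^sup>2" for \<omega>
    unfolding average_def S[symmetric] by (simp add: norm_divide power_divide)
  show "integrable M (\<lambda>\<omega>. (cmod (average q n \<omega>))\<^sup>2)"
    unfolding A using int by (intro integrable_divide integrable_Re)
  have "expectation (\<lambda>\<omega>. (cmod (average q n \<omega>))\<^sup>2) = Re (expectation ?S) / (real n)\<^sup>2"
    unfolding A using int by (simp only: integral_divide_zero integral_Re)
  then show "expectation (\<lambda>\<omega>. (cmod (average q n \<omega>))\<^sup>2) = V / real n"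
    unfolding E by (simp add: power2_eq_square)
qed

text \<open>Hoeffding's bound decays exponentially in n and so beats the factor n.\<close>

lemma real_average_tail:
  fixes p :: "real \<Rightarrow> real"
  assumes p[measurable]: "p \<in> borel_measurable borel" and bd: "\<And>x. \<bar>p x\<bar> \<le> K"
    and mean: "expectation (\<lambda>\<omega>. p (X 1 \<omega>)) = 0" and r: "0 < r"
  shows "(\<lambda>n. real n * prob {\<omega>\<in>space M. r \<le> \<bar>(\<Sum>j=1..n. p (X j \<omega>)) / real n\<bar>}) \<longlonglongrightarrow> 0"
proof -
  \<comment> \<open>Enlarging \<open>K\<close>, which may be 0, keeps the interval from - L to L
    nondegenerate.\<close>
  define L where "L = K + 1"
  have L: "L > 0" using order_trans[OF abs_ge_zero bd[of 0]] by (simp add: L_def)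
  have mp: "(\<lambda>\<omega>. p (X j \<omega>)) \<in> borel_measurable M" if "1 \<le> j" for j
    using that by (intro measurable_compose[OF _ p] rv_sample)
  have b: "prob {\<omega>\<in>space M. r \<le> \<bar>(\<Sum>j=1..n. p (X j \<omega>)) / real n\<bar>} \<le> 2 * exp (-2 * real n * r\<^sup>2 / (L + L)\<^sup>2)"
    if n: "n \<ge> 1" for n
  proof -
    interpret H: Hoeffding_ineq_iid M "{1..n}" "\<lambda>j \<omega>. p (X j \<omega>)" "\<lambda>\<omega>. p (X 1 \<omega>)" "-L" L 0
    proof unfold_locales
      show "indep_vars (\<lambda>_. borel) (\<lambda>j \<omega>. p (X j \<omega>)) {1..n}"
        by (rule indep_vars_compose2[OF indep_vars_subset[OF indep]]) auto
      show "distr M borel (\<lambda>\<omega>. p (X j \<omega>)) = distr M borel (\<lambda>\<omega>. p (X 1 \<omega>))" if "j \<in> {1..n}" for j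
      proof -
        have "distr M borel (\<lambda>\<omega>. p (X i \<omega>)) = distr (distr M borel (X i)) borel p" if "1 \<le> i" for i
          using rv_sample[OF that] by (subst distr_distr) (auto simp: comp_def)
        then show ?thesis using that ident[of j] by simp
      qed
      show "random_variable borel (\<lambda>\<omega>. p (X 1 \<omega>))" using mp[of 1] by simp
      have "p x \<in> {- L..L}" for x using bd[of x] by (simp add: L_def abs_le_iff)
      then show "AE \<omega> in M. p (X 1 \<omega>) \<in> {- L..L}" by blast
      show "0 \<equiv> expectation (\<lambda>\<omega>. p (X 1 \<omega>))" using mean by simp
    qed auto
    show ?thesis using H.Hoeffding_ineq_abs_ge'[of r] r L n by simp
  qed
  have "(\<lambda>n. real n * (2 * exp (-2 * real n * r\<^sup>2 / (L + L)\<^sup>2))) \<longlonglongrightarrow> 0"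
    using r L by real_asymp
  moreover have "\<forall>\<^sub>F n in sequentially.
      norm (real n * prob {\<omega>\<in>space M. r \<le> \<bar>(\<Sum>j=1..n. p (X j \<omega>)) / real n\<bar>})
        \<le> real n * (2 * exp (-2 * real n * r\<^sup>2 / (L + L)\<^sup>2))"
    using eventually_ge_at_top[of 1] by eventually_elim (use b in \<open>auto intro!: mult_left_mono\<close>)
  ultimately show ?thesis by (rule Lim_null_comparison[rotated])
qed

text \<open>Hoeffding's inequality concerns real variables; if |z| > r, then the real or the
  imaginary part of z has modulus at least r / 2.\<close>

lemma average_tail_bounded:
  assumes q[measurable]: "q \<in> borel_measurable borel" and bd: "\<And>x. cmod (q x) \<le> K"
    and mean: "expectation (\<lambda>\<omega>. q (X 1 \<omega>)) = 0" and r: "0 < r"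
  shows "(\<lambda>n. real n * prob {\<omega>\<in>space M. r < cmod (average q n \<omega>)}) \<longlonglongrightarrow> 0"
proof -
  have "integrable M (\<lambda>\<omega>. q (X 1 \<omega>))"
    by (rule integrable_const_bound[where B=K]) (use bd in \<open>auto intro!: measurable_compose[OF rv_sample q]\<close>)
  then have "expectation (\<lambda>\<omega>. Re (q (X 1 \<omega>))) = 0" "expectation (\<lambda>\<omega>. Im (q (X 1 \<omega>))) = 0"
    using mean by (simp_all add: integral_Re integral_Im)
  then have lim: "(\<lambda>n. real n * prob {\<omega>\<in>space M. r / 2 \<le> \<bar>(\<Sum>j=1..n. Re (q (X j \<omega>))) / real n\<bar>}
      + real n * prob {\<omega>\<in>space M. r / 2 \<le> \<bar>(\<Sum>j=1..n. Im (q (X j \<omega>))) / real n\<bar>}) \<longlonglongrightarrow> 0 + 0"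
    using bd r abs_Re_le_cmod abs_Im_le_cmod
    by (intro tendsto_add real_average_tail[where K=K]) (auto intro: order_trans)
  have le: "prob {\<omega>\<in>space M. r < cmod (average q n \<omega>)} \<le>
     prob {\<omega>\<in>space M. r / 2 \<le> \<bar>(\<Sum>j=1..n. Re (q (X j \<omega>))) / real n\<bar>}
      + prob {\<omega>\<in>space M. r / 2 \<le> \<bar>(\<Sum>j=1..n. Im (q (X j \<omega>))) / real n\<bar>}" for n
  proof -
    have m: "(\<lambda>\<omega>. q (X j \<omega>)) \<in> borel_measurable M" if "j \<in> {1..n}" for j
      using that by (intro measurable_compose[OF _ q] rv_sample) auto
    have [measurable]: "(\<lambda>\<omega>. (\<Sum>j=1..n. Re (q (X j \<omega>))) / real n) \<in> borel_measurable M"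
      "(\<lambda>\<omega>. (\<Sum>j=1..n. Im (q (X j \<omega>))) / real n) \<in> borel_measurable M"
      by (intro borel_measurable_divide borel_measurable_sum measurable_compose[OF m borel_measurable_Re]
           measurable_compose[OF m borel_measurable_Im] borel_measurable_const; simp)+
    have "r / 2 \<le> \<bar>Re z\<bar> \<or> r / 2 \<le> \<bar>Im z\<bar>" if "r < cmod z" for z
      using cmod_le[of z] that by linarith
    moreover have "Re (average q n \<omega>) = (\<Sum>j=1..n. Re (q (X j \<omega>))) / real n"
      "Im (average q n \<omega>) = (\<Sum>j=1..n. Im (q (X j \<omega>))) / real n" for \<omega>
      by (simp_all add: average_def Re_divide_of_nat Im_divide_of_nat)
    ultimately have "{\<omega>\<in>space M. r < cmod (average q n \<omega>)} \<subseteq>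
       {\<omega>\<in>space M. r / 2 \<le> \<bar>(\<Sum>j=1..n. Re (q (X j \<omega>))) / real n\<bar>} \<union>
       {\<omega>\<in>space M. r / 2 \<le> \<bar>(\<Sum>j=1..n. Im (q (X j \<omega>))) / real n\<bar>}"
      by fastforce
    then have "prob {\<omega>\<in>space M. r < cmod (average q n \<omega>)} \<le> prob (
       {\<omega>\<in>space M. r / 2 \<le> \<bar>(\<Sum>j=1..n. Re (q (X j \<omega>))) / real n\<bar>} \<union>
       {\<omega>\<in>space M. r / 2 \<le> \<bar>(\<Sum>j=1..n. Im (q (X j \<omega>))) / real n\<bar>})"
      by (intro finite_measure_mono) measurable
    also have "\<dots> \<le> prob {\<omega>\<in>space M. r / 2 \<le> \<bar>(\<Sum>j=1..n. Re (q (X j \<omega>))) / real n\<bar>}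
      + prob {\<omega>\<in>space M. r / 2 \<le> \<bar>(\<Sum>j=1..n. Im (q (X j \<omega>))) / real n\<bar>}"
      by (intro measure_Un_le) measurable
    finally show ?thesis .
  qed
  show ?thesis
    by (rule Lim_null_comparison[OF _ lim[unfolded add_0]])
      (use le in \<open>auto intro!: always_eventually mult_left_mono simp flip: distrib_left\<close>)
qed

text \<open>
  Beyond a truncation at level \<open>K\<close> with small remaining variance, the contribution of the
  bounded part is controlled by Hoeffding's inequality.
\<close>

lemma average_tail_moment:
  assumes q[measurable]: "q \<in> borel_measurable borel"
    and sq: "integrable M (\<lambda>\<omega>. (cmod (q (X 1 \<omega>)))\<^sup>2)" and mean: "expectation (\<lambda>\<omega>. q (X 1 \<omega>)) = 0"
    and r: "0 < r"
  shows "(\<lambda>n. real n * expectation (\<lambda>\<omega>. indicat_real {\<omega>\<in>space M. r < cmod (average q n \<omega>)} \<omega>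
            * (cmod (average q n \<omega>))\<^sup>2)) \<longlonglongrightarrow> 0"
    (is "(\<lambda>n. real n * ?E n) \<longlonglongrightarrow> 0")
proof (rule tendstoI)
  fix e :: real assume e: "0 < e"
  have [measurable]: "X (Suc 0) \<in> borel_measurable M" using rv_sample[of 1] by simp
  have i1: "integrable M (\<lambda>\<omega>. q (X 1 \<omega>))"
    by (rule complex_square_integrable[OF _ sq]) simp
  define t where "t K x = (if cmod (q x) \<le> K then q x else 0)" for K x
  have tm[measurable]: "t K \<in> borel_measurable borel" for K unfolding t_def by measurable
  have tb: "cmod (q x - t K x) \<le> cmod (q x)" for K x by (simp add: t_def)
  have "(\<lambda>k. expectation (\<lambda>\<omega>. (cmod (q (X 1 \<omega>) - t (real k) (X 1 \<omega>)))\<^sup>2)) \<longlonglongrightarrow> expectation (\<lambda>\<omega>. 0)"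
  proof (rule integral_dominated_convergence[where w="\<lambda>\<omega>. (cmod (q (X 1 \<omega>)))\<^sup>2"])
    show "AE \<omega> in M. (\<lambda>k. (cmod (q (X 1 \<omega>) - t (real k) (X 1 \<omega>)))\<^sup>2) \<longlonglongrightarrow> 0"
    proof (rule AE_I2)
      fix \<omega>
      obtain N where N: "cmod (q (X 1 \<omega>)) \<le> real N" using real_arch_simple by blast
      have "\<forall>\<^sub>F k in sequentially. (cmod (q (X 1 \<omega>) - t (real k) (X 1 \<omega>)))\<^sup>2 = 0"
        using eventually_ge_at_top[of N] by eventually_elim (use N in \<open>auto simp: t_def\<close>)
      then show "(\<lambda>k. (cmod (q (X 1 \<omega>) - t (real k) (X 1 \<omega>)))\<^sup>2) \<longlonglongrightarrow> 0" by (rule tendsto_eventually)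
    qed
    show "AE \<omega> in M. norm ((cmod (q (X 1 \<omega>) - t (real k) (X 1 \<omega>)))\<^sup>2) \<le> (cmod (q (X 1 \<omega>)))\<^sup>2" for k
      using tb by (auto intro: power_mono)
  qed (use sq in auto)
  \<comment> \<open>The remaining variance enters \<open>bound\<close> with the factor 4, so e / 8
    leaves half of the tolerance for the bounded part.\<close>
  then have "\<forall>\<^sub>F k in sequentially. expectation (\<lambda>\<omega>. (cmod (q (X 1 \<omega>) - t (real k) (X 1 \<omega>)))\<^sup>2) < e / 8"
    using e by (intro order_tendstoD(2)) auto
  then obtain k where k: "expectation (\<lambda>\<omega>. (cmod (q (X 1 \<omega>) - t (real k) (X 1 \<omega>)))\<^sup>2) < e / 8"
    by (auto simp: eventually_sequentially)
  define K where "K = real k"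
  \<comment> \<open>Truncation destroys the centering. Moving the constant \<open>m\<close> from one
    part to the other centers both without changing their sum; \<open>q''\<close> is written as a
    shift by - m to fit \<open>complex_second_moment_shift\<close>.\<close>
  define m where "m = expectation (\<lambda>\<omega>. t K (X 1 \<omega>))"
  define q' where "q' x = t K x - m" for x
  define q'' where "q'' x = (q x - t K x) - (- m)" for x
  have [measurable]: "q' \<in> borel_measurable borel" "q'' \<in> borel_measurable borel"
    unfolding q'_def q''_def by measurable
  have tK: "cmod (t K x) \<le> K" for x by (auto simp: K_def t_def)
  have it: "integrable M (\<lambda>\<omega>. t K (X 1 \<omega>))"
    by (rule integrable_const_bound[where B=K]) (use tK in auto)
  have mK: "cmod m \<le> K"
  proof -
    have "cmod m \<le> expectation (\<lambda>\<omega>. cmod (t K (X 1 \<omega>)))" unfolding m_def by (rule integral_norm_bound)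
    also have "\<dots> \<le> expectation (\<lambda>\<omega>. K)" using it tK by (intro integral_mono) auto
    finally show ?thesis by (simp add: prob_space)
  qed
  have q'K: "cmod (q' x) \<le> 2 * K" for x
    using norm_triangle_ineq4[of "t K x" m] tK[of x] mK by (simp add: q'_def)
  have mean': "expectation (\<lambda>\<omega>. q' (X 1 \<omega>)) = 0" unfolding q'_def using it by (simp add: prob_space m_def)
  have mean'': "expectation (\<lambda>\<omega>. q'' (X 1 \<omega>)) = 0" unfolding q''_def using it i1 mean by (simp add: prob_space m_def)
  have sqt: "integrable M (\<lambda>\<omega>. (cmod (q (X 1 \<omega>) - t K (X 1 \<omega>)))\<^sup>2)"
    by (rule Bochner_Integration.integrable_bound[OF sq]) (use tb in \<open>auto intro: power_mono\<close>)
  have mt: "expectation (\<lambda>\<omega>. q (X 1 \<omega>) - t K (X 1 \<omega>)) = - m" using it i1 mean by (simp add: m_def)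
  have sq'': "integrable M (\<lambda>\<omega>. (cmod (q'' (X 1 \<omega>)))\<^sup>2)"
    unfolding q''_def by (rule complex_second_moment_shift(1)[OF _ sqt]) simp
  \<comment> \<open>Centering only lowers the second moment, here by |m|^2, so the bound e / 8
    persists.\<close>
  have "expectation (\<lambda>\<omega>. (cmod (q'' (X 1 \<omega>)))\<^sup>2) =
    expectation (\<lambda>\<omega>. (cmod (q (X 1 \<omega>) - t K (X 1 \<omega>)))\<^sup>2) - 2 * Re (cnj (- m) * (- m)) + (cmod (- m))\<^sup>2"
    unfolding q''_def by (subst complex_second_moment_shift(2)[OF _ sqt]) (simp, simp only: mt)
  moreover have "Re (cnj (- m) * (- m)) = (cmod m)\<^sup>2"
    unfolding cmod_power2 by (simp add: power2_eq_square)
  ultimately have V'': "expectation (\<lambda>\<omega>. (cmod (q'' (X 1 \<omega>)))\<^sup>2) < e / 8"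
    using k zero_le_power2[of "cmod m"] unfolding norm_minus_cancel K_def by linarith
  note a'' = average_second_moment[OF _ sq'' mean'']
  have av: "average q n \<omega> = average q' n \<omega> + average q'' n \<omega>" for n \<omega>
    unfolding average_def by (simp add: q'_def q''_def flip: add_divide_distrib sum.distrib)
  have a'K: "cmod (average q' n \<omega>) \<le> 2 * K" for n \<omega>
    unfolding average_def by (intro cmod_average_le q'K)
  define B where "B n = {\<omega>\<in>space M. r < cmod (average q n \<omega>)}" for n
  define B' where "B' n = {\<omega>\<in>space M. r / 2 < cmod (average q' n \<omega>)}" for n
  have [measurable]: "B n \<in> sets M" "B' n \<in> sets M" for n unfolding B_def B'_def by measurable
  have pw: "indicat_real (B n) \<omega> * (cmod (average q n \<omega>))\<^sup>2
      \<le> 4 * (cmod (average q'' n \<omega>))\<^sup>2 + 8 * K\<^sup>2 * indicat_real (B' n) \<omega>" if "\<omega> \<in> space M" for n \<omega>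
  proof (cases "r < cmod (average q n \<omega>)")
    case True
    \<comment> \<open>Either the bounded part exceeds r / 2, an event \<open>B' n\<close> on which
      it is still at most 2 K, or it is below half of A, and then A is at most 2 A''.\<close>
    define A A' A'' where "A = cmod (average q n \<omega>)" and "A' = cmod (average q' n \<omega>)" and "A'' = cmod (average q'' n \<omega>)"
    have le: "A \<le> A' + A''" unfolding A_def A'_def A''_def av by (rule norm_triangle_ineq)
    have pos: "0 \<le> A" "0 \<le> A'" "0 \<le> A''" "A' \<le> 2 * K" using a'K by (auto simp: A_def A'_def A''_def)
    have "A\<^sup>2 \<le> 4 * A''\<^sup>2 + 8 * K\<^sup>2 * (if r / 2 < A' then 1 else 0)"
    proof (cases "r / 2 < A'")
      case True
      have "A\<^sup>2 \<le> (A' + A'')\<^sup>2" using le pos by (intro power_mono)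
      also have "\<dots> \<le> 2 * A'\<^sup>2 + 2 * A''\<^sup>2" using sum_squares_bound[of A' A''] by (simp add: power2_sum)
      also have "A'\<^sup>2 \<le> (2 * K)\<^sup>2" using pos by (intro power_mono)
      finally have "A\<^sup>2 \<le> 2 * (2 * K)\<^sup>2 + 2 * A''\<^sup>2" by simp
      moreover have "(2 * K)\<^sup>2 = 4 * K\<^sup>2" by (simp add: power_mult_distrib)
      ultimately have "A\<^sup>2 \<le> 4 * A''\<^sup>2 + 8 * K\<^sup>2" using zero_le_power2[of A''] by linarith
      then show ?thesis using True by simp
    next
      case False
      have "A \<le> 2 * A''" using le False \<open>r < cmod (average q n \<omega>)\<close> by (simp add: A_def)
      then have "A\<^sup>2 \<le> (2 * A'')\<^sup>2" using pos by (intro power_mono)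
      then show ?thesis using False by (simp add: power_mult_distrib)
    qed
    then show ?thesis using that True by (simp add: A_def A'_def A''_def B_def B'_def indicator_def split: if_splits)
  qed (simp add: B_def indicator_def)
  have bound: "real n * ?E n \<le> 4 * expectation (\<lambda>\<omega>. (cmod (q'' (X 1 \<omega>)))\<^sup>2) + 8 * K\<^sup>2 * (real n * prob (B' n))"
    if n: "n \<ge> 1" for n
  proof -
    have int: "integrable M (\<lambda>\<omega>. (cmod (average q n \<omega>))\<^sup>2)" by (rule average_second_moment(1)[OF q sq mean])
    have iB: "integrable M (indicat_real (B' n))" by (rule integrable_indicator_event) simp
    have "?E n \<le> expectation (\<lambda>\<omega>. 4 * (cmod (average q'' n \<omega>))\<^sup>2 + 8 * K\<^sup>2 * indicat_real (B' n) \<omega>)"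
      unfolding B_def[symmetric]
      using iB a''(1)[of n] pw integrable_real_mult_indicator[OF _ int, of "B n"]
      by (intro integral_mono) (auto simp: mult.commute intro!: Bochner_Integration.integrable_add integrable_mult_right)
    also have "\<dots> = 4 * expectation (\<lambda>\<omega>. (cmod (average q'' n \<omega>))\<^sup>2) + 8 * K\<^sup>2 * prob (B' n)"
      using a''(1)[of n] iB by simp
    finally have "real n * ?E n \<le> real n * (4 * (expectation (\<lambda>\<omega>. (cmod (q'' (X 1 \<omega>)))\<^sup>2) / real n) + 8 * K\<^sup>2 * prob (B' n))"
      using a''(2)[of n] by (intro mult_left_mono) simp_all
    also have "\<dots> = 4 * expectation (\<lambda>\<omega>. (cmod (q'' (X 1 \<omega>)))\<^sup>2) + 8 * K\<^sup>2 * (real n * prob (B' n))"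
      using n by (simp add: algebra_simps)
    finally show ?thesis .
  qed
  have "(\<lambda>n. 8 * K\<^sup>2 * (real n * prob (B' n))) \<longlonglongrightarrow> 8 * K\<^sup>2 * 0"
    unfolding B'_def using r by (intro tendsto_mult tendsto_const average_tail_bounded[OF _ q'K mean']) auto
  then have "\<forall>\<^sub>F n in sequentially. 8 * K\<^sup>2 * (real n * prob (B' n)) < e / 2"
    using e by (intro order_tendstoD(2)) auto
  then show "\<forall>\<^sub>F n in sequentially. dist (real n * ?E n) 0 < e"
    using eventually_ge_at_top[of 1]
  proof eventually_elim
    case (elim n)
    have "0 \<le> ?E n" by (intro integral_nonneg_AE) auto
    then have "0 \<le> real n * ?E n" by simp
    moreover have "real n * ?E n < e" using bound[OF elim(2)] elim(1) V'' by linarith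
    ultimately show ?case by simp
  qed
qed

section \<open>Asymptotics of the one-step estimator\<close>

lemma average_one_step_error_bounds:
  assumes s: "0 < Im \<theta>" and n: "1 \<le> n"
  defines "D \<equiv> \<lambda>y \<omega>. y + 2 * \<i> * of_real (Im y) * average (cayley y) n \<omega> - \<theta>
      - 2 * \<i> * of_real (Im \<theta>) * average (cayley \<theta>) n \<omega>"
  shows "cmod (D y \<omega>) \<le> 3 * cmod (y - \<theta>) + 4 * Im \<theta>"
    and "cmod (y - \<theta>) \<le> Im \<theta> / 2 \<Longrightarrow> cmod (D y \<omega>) \<le> cmod (y - \<theta>) *
      (4 * cmod (average (cayley \<theta>) n \<omega>) + cmod (average (\<lambda>x. (cayley \<theta> x)\<^sup>2) n \<omega>) + 16 * cmod (y - \<theta>) / Im \<theta>)"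
  using one_step_error_bounds[OF s n, of y "\<lambda>j. X j \<omega>"] unfolding D_def average_def by auto

definition large_deviation :: "(real \<Rightarrow> complex) \<Rightarrow> complex \<Rightarrow> real \<Rightarrow> nat \<Rightarrow> 'a set" where
  "large_deviation q \<theta> r n = {\<omega>\<in>space M. r < cmod (average q n \<omega>) \<or> r < cmod (average (cayley \<theta>) n \<omega>)
      \<or> r < cmod (average (\<lambda>x. (cayley \<theta> x)\<^sup>2) n \<omega>)}"

lemma large_deviation_measurable [measurable]:
  assumes [measurable]: "q \<in> borel_measurable borel"
  shows "large_deviation q \<theta> r n \<in> sets M"
  unfolding large_deviation_def by measurable

text \<open>Where the average of \<open>q\<close> is at most \<open>r\<close>, its square is at most
  r^2, so the two events for powers of \<open>cayley\<close> contribute at most r^2 times their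
  probabilities. Those are handled by Hoeffding's inequality, and the tail of the average of
  \<open>q\<close> by truncation.\<close>

lemma large_deviation_negligible:
  assumes q[measurable]: "q \<in> borel_measurable borel"
    and sq: "integrable M (\<lambda>\<omega>. (cmod (q (X 1 \<omega>)))\<^sup>2)" and mean: "expectation (\<lambda>\<omega>. q (X 1 \<omega>)) = 0"
    and c1: "expectation (\<lambda>\<omega>. cayley \<theta> (X 1 \<omega>)) = 0" and c2: "expectation (\<lambda>\<omega>. (cayley \<theta> (X 1 \<omega>))\<^sup>2) = 0"
    and r: "0 < r"
  shows "(\<lambda>n. real n * prob (large_deviation q \<theta> r n)) \<longlonglongrightarrow> 0"
    and "(\<lambda>n. real n * expectation (\<lambda>\<omega>. indicat_real (large_deviation q \<theta> r n) \<omega> * (cmod (average q n \<omega>))\<^sup>2)) \<longlonglongrightarrow> 0"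
proof -
  define A where "A n = {\<omega>\<in>space M. r < cmod (average q n \<omega>)}" for n
  define A1 where "A1 n = {\<omega>\<in>space M. r < cmod (average (cayley \<theta>) n \<omega>)}" for n
  define A2 where "A2 n = {\<omega>\<in>space M. r < cmod (average (\<lambda>x. (cayley \<theta> x)\<^sup>2) n \<omega>)}" for n
  define B where "B n = large_deviation q \<theta> r n" for n
  define E where "E n = expectation (\<lambda>\<omega>. indicat_real (A n) \<omega> * (cmod (average q n \<omega>))\<^sup>2)" for n
  have meas[measurable]: "A n \<in> sets M" "A1 n \<in> sets M" "A2 n \<in> sets M" "B n \<in> sets M" for n
    unfolding A_def A1_def A2_def B_def by measurable
  have B: "B n = A n \<union> A1 n \<union> A2 n" for n by (auto simp: B_def A_def A1_def A2_def large_deviation_def)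
  have limE: "(\<lambda>n. real n * E n) \<longlonglongrightarrow> 0"
    unfolding E_def A_def by (rule average_tail_moment[OF q sq mean r])
  have lim1: "(\<lambda>n. real n * prob (A1 n)) \<longlonglongrightarrow> 0"
    unfolding A1_def by (rule average_tail_bounded[OF _ cmod_cayley_le c1 r]) simp
  have "cmod ((cayley \<theta> x)\<^sup>2) \<le> 1" for x
    using cmod_cayley_le[of \<theta> x] by (simp add: norm_power power_le_one)
  then have lim2: "(\<lambda>n. real n * prob (A2 n)) \<longlonglongrightarrow> 0"
    unfolding A2_def by (intro average_tail_bounded[OF _ _ c2 r]) auto
  have sqA: "integrable M (\<lambda>\<omega>. (cmod (average q n \<omega>))\<^sup>2)" for n by (rule average_second_moment(1)[OF q sq mean])
  have iA: "integrable M (\<lambda>\<omega>. indicat_real (A n) \<omega> * (cmod (average q n \<omega>))\<^sup>2)" for n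
    by (rule integrable_restricted(1)[OF _ sqA]) simp
  \<comment> \<open>Chebyshev's inequality would only give O(1/n). Keeping the indicator in Markov's
    inequality replaces the full second moment by its tail, which is o(1/n).\<close>
  have PA: "prob (A n) \<le> E n / r\<^sup>2" for n
  proof -
    have "r\<^sup>2 * prob (A n) = expectation (\<lambda>\<omega>. r\<^sup>2 * indicat_real (A n) \<omega>)" using integrable_indicator_event[of "A n"] by simp
    also have "\<dots> \<le> E n" unfolding E_def
    proof (rule integral_mono)
      show "r\<^sup>2 * indicat_real (A n) \<omega> \<le> indicat_real (A n) \<omega> * (cmod (average q n \<omega>))\<^sup>2" for \<omega>
        using r by (auto simp: A_def indicator_def intro: power_mono)
    qed (use iA integrable_indicator_event in auto)
    finally show ?thesis using r by (simp add: field_simps)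
  qed
  have "prob (B n) \<le> E n / r\<^sup>2 + prob (A1 n) + prob (A2 n)" for n
    unfolding B using measure_Un_le[of "A n \<union> A1 n" M "A2 n"] measure_Un_le[of "A n" M "A1 n"] PA[of n]
      sets.Un[of "A n" M "A1 n"] meas by fastforce
  then have le: "real n * prob (B n) \<le> (real n * E n) / r\<^sup>2 + real n * prob (A1 n) + real n * prob (A2 n)" for n
    using mult_left_mono[of "prob (B n)" "E n / r\<^sup>2 + prob (A1 n) + prob (A2 n)" "real n"] by (simp add: algebra_simps)
  have "(\<lambda>n. (real n * E n) / r\<^sup>2 + real n * prob (A1 n) + real n * prob (A2 n)) \<longlonglongrightarrow> 0 / r\<^sup>2 + 0 + 0"
    by (intro tendsto_intros limE lim1 lim2) (use r in auto)
  then have lim: "(\<lambda>n. (real n * E n) / r\<^sup>2 + real n * prob (A1 n) + real n * prob (A2 n)) \<longlonglongrightarrow> 0" by simp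
  show "(\<lambda>n. real n * prob (large_deviation q \<theta> r n)) \<longlonglongrightarrow> 0"
    unfolding B_def[symmetric] by (rule Lim_null_comparison[OF _ lim]) (use le in auto)
  have "expectation (\<lambda>\<omega>. indicat_real (B n) \<omega> * (cmod (average q n \<omega>))\<^sup>2) \<le> E n + r\<^sup>2 * prob (A1 n) + r\<^sup>2 * prob (A2 n)" for n
  proof -
    have "expectation (\<lambda>\<omega>. indicat_real (B n) \<omega> * (cmod (average q n \<omega>))\<^sup>2) \<le>
      expectation (\<lambda>\<omega>. indicat_real (A n) \<omega> * (cmod (average q n \<omega>))\<^sup>2 + r\<^sup>2 * indicat_real (A1 n) \<omega> + r\<^sup>2 * indicat_real (A2 n) \<omega>)"
    proof (rule integral_mono)
      show "integrable M (\<lambda>\<omega>. indicat_real (B n) \<omega> * (cmod (average q n \<omega>))\<^sup>2)"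
        by (rule integrable_restricted(1)[OF _ sqA]) simp
      show "indicat_real (B n) \<omega> * (cmod (average q n \<omega>))\<^sup>2 \<le>
        indicat_real (A n) \<omega> * (cmod (average q n \<omega>))\<^sup>2 + r\<^sup>2 * indicat_real (A1 n) \<omega> + r\<^sup>2 * indicat_real (A2 n) \<omega>"
        if "\<omega> \<in> space M" for \<omega>
      proof (cases "\<omega> \<in> A n")
        case False
        then have "(cmod (average q n \<omega>))\<^sup>2 \<le> r\<^sup>2" using that by (intro power_mono) (auto simp: A_def)
        moreover from this have "(cmod (average q n \<omega>))\<^sup>2 \<le> 2 * r\<^sup>2" using zero_le_power2[of r] by linarith
        ultimately show ?thesis using False by (auto simp: B indicator_def)
      qed (auto simp: indicator_def)
    qed (use iA integrable_indicator_event in auto)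
    also have "\<dots> = E n + r\<^sup>2 * prob (A1 n) + r\<^sup>2 * prob (A2 n)"
      unfolding E_def using iA integrable_indicator_event[of "A1 n"] integrable_indicator_event[of "A2 n"] by simp
    finally show ?thesis .
  qed
  then have le2: "real n * expectation (\<lambda>\<omega>. indicat_real (B n) \<omega> * (cmod (average q n \<omega>))\<^sup>2) \<le>
      real n * E n + r\<^sup>2 * (real n * prob (A1 n)) + r\<^sup>2 * (real n * prob (A2 n))" for n
    using mult_left_mono[of "expectation (\<lambda>\<omega>. indicat_real (B n) \<omega> * (cmod (average q n \<omega>))\<^sup>2)"
        "E n + r\<^sup>2 * prob (A1 n) + r\<^sup>2 * prob (A2 n)" "real n"] by (simp add: algebra_simps)
  have "(\<lambda>n. real n * E n + r\<^sup>2 * (real n * prob (A1 n)) + r\<^sup>2 * (real n * prob (A2 n))) \<longlonglongrightarrow> 0 + r\<^sup>2 * 0 + r\<^sup>2 * 0"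
    by (intro tendsto_intros limE lim1 lim2)
  then have lim: "(\<lambda>n. real n * E n + r\<^sup>2 * (real n * prob (A1 n)) + r\<^sup>2 * (real n * prob (A2 n))) \<longlonglongrightarrow> 0" by simp
  show "(\<lambda>n. real n * expectation (\<lambda>\<omega>. indicat_real (large_deviation q \<theta> r n) \<omega> * (cmod (average q n \<omega>))\<^sup>2)) \<longlonglongrightarrow> 0"
    unfolding B_def[symmetric]
    by (rule Lim_null_comparison[OF _ lim]) (use le2 in \<open>auto simp: integral_nonneg_AE\<close>)
qed

text \<open>The first two summands are the one-step estimator, so this is the error D_n of the
  overview.\<close>

definition one_step_error :: "(nat \<Rightarrow> 'a \<Rightarrow> complex) \<Rightarrow> complex \<Rightarrow> nat \<Rightarrow> 'a \<Rightarrow> complex" where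
  "one_step_error Y \<theta> n \<omega> = Y n \<omega> + 2 * \<i> * of_real (Im (Y n \<omega>)) * average (cayley (Y n \<omega>)) n \<omega> - \<theta>
      - 2 * \<i> * of_real (Im \<theta>) * average (cayley \<theta>) n \<omega>"

lemma one_step_error_measurable [measurable]:
  assumes [measurable]: "Y n \<in> borel_measurable M"
  shows "one_step_error Y \<theta> n \<in> borel_measurable M"
proof -
  have [measurable]: "(\<lambda>\<omega>. complex_of_real (X j \<omega>)) \<in> borel_measurable M" if "j \<in> {1..n}" for j
    using that by (intro measurable_compose[OF rv_sample borel_measurable_of_real]) auto
  have [measurable]: "(\<lambda>\<omega>. average (cayley (Y n \<omega>)) n \<omega>) \<in> borel_measurable M"
    unfolding average_def cayley_def by measurable
  show ?thesis unfolding one_step_error_def[abs_def] by measurable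
qed

text \<open>\<open>F\<close> stands for the inverse of the generator, \<open>m\<close> for
  f(\<theta>) and \<open>c\<close> for f'(\<theta>). Two radii are at work: \<open>r0\<close> is
  fixed so that off \<open>B r0 n\<close> the deviation of Y_n from \<theta> is at most a constant
  times the average of \<open>q\<close> and stays in the range of the expansion, while
  \<open>r\<close> shrinks with the tolerance. With one fixed radius the error would only be bounded
  by a constant times the average itself, which is of the same order as the leading term.\<close>

lemma one_step_error_negligible:
  assumes s: "0 < Im \<theta>"
    and q[measurable]: "q \<in> borel_measurable borel"
    and sq: "integrable M (\<lambda>\<omega>. (cmod (q (X 1 \<omega>)))\<^sup>2)" and mean: "expectation (\<lambda>\<omega>. q (X 1 \<omega>)) = 0"
    and c1: "expectation (\<lambda>\<omega>. cayley \<theta> (X 1 \<omega>)) = 0" and c2: "expectation (\<lambda>\<omega>. (cayley \<theta> (X 1 \<omega>))\<^sup>2) = 0"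
    and F: "(F has_field_derivative inverse c) (at m)" "F m = \<theta>" "c \<noteq> 0"
    and Y: "\<And>n \<omega>. 1 \<le> n \<Longrightarrow> Y n \<omega> = F (m + average q n \<omega>)"
    and Ym[measurable]: "\<And>n. Y n \<in> borel_measurable M"
    and N: "1 \<le> N" and sqY: "\<And>n. N \<le> n \<Longrightarrow> integrable M (\<lambda>\<omega>. (cmod (Y n \<omega>))\<^sup>2)"
    and limY: "(\<lambda>n. real n * expectation (\<lambda>\<omega>. (cmod (Y n \<omega> - expectation (Y n)))\<^sup>2)) \<longlonglongrightarrow>
      expectation (\<lambda>\<omega>. (cmod (q (X 1 \<omega>)))\<^sup>2) / (cmod c)\<^sup>2"
  shows "\<And>n. N \<le> n \<Longrightarrow> integrable M (\<lambda>\<omega>. (cmod (one_step_error Y \<theta> n \<omega>))\<^sup>2)"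
    and "(\<lambda>n. real n * expectation (\<lambda>\<omega>. (cmod (one_step_error Y \<theta> n \<omega>))\<^sup>2)) \<longlonglongrightarrow> 0"
proof -
  define V where "V = expectation (\<lambda>\<omega>. (cmod (q (X 1 \<omega>)))\<^sup>2)"
  define g where "g = average q"
  define d where "d n \<omega> = Y n \<omega> - \<theta>" for n \<omega>
  define D where "D = one_step_error Y \<theta>"
  define B where "B r n = large_deviation q \<theta> r n" for r n
  note neg = large_deviation_negligible[OF q sq mean c1 c2, folded B_def g_def]
  have [measurable]: "B r n \<in> sets M" "g n \<in> borel_measurable M" "d n \<in> borel_measurable M" "D n \<in> borel_measurable M" for r n
    unfolding B_def g_def d_def[abs_def] D_def by measurable
  have V0: "0 \<le> V" unfolding V_def by (intro integral_nonneg_AE) auto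
  have sqg: "integrable M (\<lambda>\<omega>. (cmod (g n \<omega>))\<^sup>2)" and Eg: "expectation (\<lambda>\<omega>. (cmod (g n \<omega>))\<^sup>2) = V / real n" for n
    unfolding g_def V_def by (rule average_second_moment[OF q sq mean])+
  have sqd: "integrable M (\<lambda>\<omega>. (cmod (d n \<omega>))\<^sup>2)" if "N \<le> n" for n
    unfolding d_def by (rule complex_second_moment_shift(1)[OF Ym sqY[OF that]])
  have off: "cmod (g n \<omega>) \<le> r" "cmod (average (cayley \<theta>) n \<omega>) \<le> r" "cmod (average (\<lambda>x. (cayley \<theta> x)\<^sup>2) n \<omega>) \<le> r"
    if "\<omega> \<in> space M" "\<omega> \<notin> B r n" for \<omega> r n
    using that by (auto simp: B_def g_def large_deviation_def)
  have B_anti: "B r n \<subseteq> B r' n" if "r' \<le> r" for r r' n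
    using that by (auto simp: B_def large_deviation_def)

  have lin: "\<exists>\<rho>>0. \<forall>z. cmod z < \<rho> \<longrightarrow> cmod (F (m + z) - \<theta> - z / c) \<le> \<epsilon> * cmod z" if pos: "0 < \<epsilon>" for \<epsilon>
  proof -
    have "\<forall>e>0. \<exists>\<rho>>0. \<forall>y. cmod (y - m) < \<rho> \<longrightarrow> cmod (F y - F m - inverse c * (y - m)) \<le> e * cmod (y - m)"
      using F(1) unfolding has_field_derivative_def has_derivative_at_alt by (rule conjunct2)
    then obtain \<rho> where "\<rho> > 0" and \<rho>: "\<And>y. cmod (y - m) < \<rho> \<Longrightarrow> cmod (F y - F m - inverse c * (y - m)) \<le> \<epsilon> * cmod (y - m)"
      using pos by blast
    then have "cmod (F (m + z) - \<theta> - z / c) \<le> \<epsilon> * cmod z" if "cmod z < \<rho>" for z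
      using \<rho>[of "m + z"] that F(2) by (simp add: divide_inverse mult.commute)
    then show ?thesis using \<open>\<rho> > 0\<close> by blast
  qed
  have lin: "\<exists>\<rho>>0. \<forall>n\<ge>1. \<forall>\<omega>. cmod (g n \<omega>) < \<rho> \<longrightarrow> cmod (d n \<omega> - g n \<omega> / c) \<le> \<epsilon> * cmod (g n \<omega>)" if pos: "0 < \<epsilon>" for \<epsilon>
  proof -
    obtain \<rho> where "\<rho> > 0" and \<rho>: "\<And>z. cmod z < \<rho> \<Longrightarrow> cmod (F (m + z) - \<theta> - z / c) \<le> \<epsilon> * cmod z"
      using lin[OF pos] by blast
    then have "cmod (d n \<omega> - g n \<omega> / c) \<le> \<epsilon> * cmod (g n \<omega>)" if "1 \<le> n" "cmod (g n \<omega>) < \<rho>" for n \<omega>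
      using \<rho>[OF that(2)] Y[OF that(1)] by (simp add: d_def g_def)
    then show ?thesis using \<open>\<rho> > 0\<close> by blast
  qed
  obtain \<rho> where \<rho>: "\<rho> > 0" and lin1: "\<And>n \<omega>. 1 \<le> n \<Longrightarrow> cmod (g n \<omega>) < \<rho> \<Longrightarrow> cmod (d n \<omega> - g n \<omega> / c) \<le> cmod (g n \<omega>)"
    using lin[of 1] by auto
  \<comment> \<open>The linear part g / c contributes 1 / |c|, and the linearization error, taken
    with tolerance 1, contributes 1.\<close>
  define C where "C = 1 + 1 / cmod c"
  have C: "C > 0" using F(3) by (simp add: C_def add_pos_nonneg)
  \<comment> \<open>The first entry keeps the average inside the radius of linearization, the second
    keeps |d| below Im(\<theta>) / 2, as the quadratic error bound requires.\<close>
  define r0 where "r0 = min (\<rho> / 2) (Im \<theta> / (2 * C))"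
  have r0: "0 < r0" "r0 < \<rho>" "C * r0 \<le> Im \<theta> / 2"
  proof -
    show "0 < r0" "r0 < \<rho>" using \<rho> s C by (auto simp: r0_def min_def)
    have "C * r0 \<le> C * (Im \<theta> / (2 * C))" using C by (intro mult_left_mono) (auto simp: r0_def)
    then show "C * r0 \<le> Im \<theta> / 2" using C by simp
  qed
  have dg: "cmod (d n \<omega> - g n \<omega> / c) \<le> cmod (g n \<omega>)" "cmod (d n \<omega>) \<le> C * cmod (g n \<omega>)" "cmod (d n \<omega>) \<le> Im \<theta> / 2"
    if "1 \<le> n" "\<omega> \<in> space M" "\<omega> \<notin> B r0 n" for n \<omega>
  proof -
    have gr: "cmod (g n \<omega>) \<le> r0" using off that by blast
    show 1: "cmod (d n \<omega> - g n \<omega> / c) \<le> cmod (g n \<omega>)" using lin1[OF that(1)] gr r0 by simp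
    have "cmod (d n \<omega>) \<le> cmod (d n \<omega> - g n \<omega> / c) + cmod (g n \<omega> / c)"
      using norm_triangle_ineq[of "d n \<omega> - g n \<omega> / c" "g n \<omega> / c"] by simp
    then show 2: "cmod (d n \<omega>) \<le> C * cmod (g n \<omega>)" using 1 by (simp add: C_def norm_divide algebra_simps)
    have "C * cmod (g n \<omega>) \<le> C * r0" using gr C by (intro mult_left_mono) auto
    then show "cmod (d n \<omega>) \<le> Im \<theta> / 2" using 2 r0 by linarith
  qed

  \<comment> \<open>The scaling by the square root of n turns the assumed limit of n Var(Y_n) into
    convergence of the variance of \<open>W n\<close> to the second moment of
    \<open>G n\<close>.\<close>
  define W where "W n \<omega> = of_real (sqrt (real n)) * d n \<omega>" for n \<omega>
  define G where "G n \<omega> = of_real (sqrt (real n)) * (g n \<omega> / c)" for n \<omega>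
  have [measurable]: "W n \<in> borel_measurable M" "G n \<in> borel_measurable M" for n
    unfolding W_def[abs_def] G_def[abs_def] by measurable
  have W2: "(cmod (W n \<omega>))\<^sup>2 = real n * (cmod (d n \<omega>))\<^sup>2"
    and G2: "(cmod (G n \<omega>))\<^sup>2 = real n * (cmod (g n \<omega>))\<^sup>2 / (cmod c)\<^sup>2"
    for n \<omega>
    by (simp_all add: W_def G_def norm_mult norm_divide power_mult_distrib power_divide)
  have WG2: "(cmod (W n \<omega> - G n \<omega>))\<^sup>2 = real n * (cmod (d n \<omega> - g n \<omega> / c))\<^sup>2" for n \<omega>
    unfolding W_def G_def right_diff_distrib[symmetric] by (simp add: norm_mult power_mult_distrib)
  have "(\<lambda>n. expectation (\<lambda>\<omega>. indicat_real (B r0 n) \<omega> * (cmod (W n \<omega>))\<^sup>2)) \<longlonglongrightarrow> 0"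
  proof (rule no_second_moment_on_rare_events)
    show "integrable M (\<lambda>\<omega>. (cmod (W n \<omega>))\<^sup>2)" "integrable M (\<lambda>\<omega>. (cmod (G n \<omega>))\<^sup>2)" if "N \<le> n" for n
      unfolding W2 G2 using sqd[OF that] sqg by auto
    have g0: "expectation (g n) = 0" for n
    proof -
      have "integrable M (\<lambda>\<omega>. q (X j \<omega>)) \<and> expectation (\<lambda>\<omega>. q (X j \<omega>)) = 0" if "1 \<le> j" for j
        using sample_transfer[OF q that] mean complex_square_integrable[OF measurable_compose[OF rv_sample q] sq] by simp
      then show ?thesis unfolding g_def average_def[abs_def] by simp
    qed
    show "expectation (G n) = 0" for n
      unfolding G_def[abs_def] using g0 by simp
    have G: "expectation (\<lambda>\<omega>. (cmod (G n \<omega>))\<^sup>2) = V / (cmod c)\<^sup>2" if "1 \<le> n" for n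
      unfolding G2 using Eg[of n] that by simp
    show "(\<lambda>n. expectation (\<lambda>\<omega>. (cmod (G n \<omega>))\<^sup>2)) \<longlonglongrightarrow> V / (cmod c)\<^sup>2"
      by (rule tendsto_eventually) (rule eventually_mono[OF eventually_ge_at_top[of 1] G])
    have "(\<lambda>n. (real n * expectation (\<lambda>\<omega>. indicat_real (B r0 n) \<omega> * (cmod (g n \<omega>))\<^sup>2)) / (cmod c)\<^sup>2) \<longlonglongrightarrow> 0 / (cmod c)\<^sup>2"
      by (intro tendsto_intros neg r0) (use F(3) in auto)
    moreover have "expectation (\<lambda>\<omega>. indicat_real (B r0 n) \<omega> * (cmod (G n \<omega>))\<^sup>2) =
       real n * expectation (\<lambda>\<omega>. indicat_real (B r0 n) \<omega> * (cmod (g n \<omega>))\<^sup>2) / (cmod c)\<^sup>2" for n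
    proof -
      have "expectation (\<lambda>\<omega>. indicat_real (B r0 n) \<omega> * (cmod (G n \<omega>))\<^sup>2) =
        expectation (\<lambda>\<omega>. (real n / (cmod c)\<^sup>2) * (indicat_real (B r0 n) \<omega> * (cmod (g n \<omega>))\<^sup>2))"
        unfolding G2 by (simp add: mult_ac)
      then show ?thesis by simp
    qed
    ultimately show "(\<lambda>n. expectation (\<lambda>\<omega>. indicat_real (B r0 n) \<omega> * (cmod (G n \<omega>))\<^sup>2)) \<longlonglongrightarrow> 0" by simp
    show "(\<lambda>n. prob (B r0 n)) \<longlonglongrightarrow> 0"
    proof (rule Lim_null_comparison[OF _ neg(1)[OF r0(1)]])
      show "\<forall>\<^sub>F n in sequentially. norm (prob (B r0 n)) \<le> real n * prob (B r0 n)"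
        using eventually_ge_at_top[of 1]
      proof eventually_elim
        case (elim n)
        then show ?case using mult_right_mono[of 1 "real n" "prob (B r0 n)"] by simp
      qed
    qed
    show "(\<lambda>n. expectation (\<lambda>\<omega>. (1 - indicat_real (B r0 n) \<omega>) * (cmod (W n \<omega> - G n \<omega>))\<^sup>2)) \<longlonglongrightarrow> 0"
    proof (rule tendstoI)
      fix e :: real assume e: "0 < e"
      \<comment> \<open>Chosen so that \<epsilon>^2 V is below e / 2; the summand 1 covers V = 0.
        Outside \<open>B r0 n\<close> the linearization error is at most |g|, and outside
        \<open>B r n\<close> it is even at most \<epsilon> |g|. The cruder bound is thus needed only
        on \<open>B r n\<close>, where the moment of g is negligible.\<close>
      define \<epsilon> where "\<epsilon> = sqrt (e / (2 * (V + 1)))"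
      have \<epsilon>: "\<epsilon> > 0" "\<epsilon>\<^sup>2 * V < e / 2"
      proof -
        show "\<epsilon> > 0" using e V0 by (simp add: \<epsilon>_def)
        have "\<epsilon>\<^sup>2 = e / (2 * (V + 1))" using e V0 by (simp add: \<epsilon>_def)
        then have "\<epsilon>\<^sup>2 * (2 * (V + 1)) = e" using V0 by simp
        moreover have "0 < \<epsilon>\<^sup>2" using \<open>\<epsilon> > 0\<close> by simp
        ultimately show "\<epsilon>\<^sup>2 * V < e / 2" unfolding distrib_left by linarith
      qed
      obtain \<rho>' where \<rho>': "\<rho>' > 0" and lin': "\<And>n \<omega>. 1 \<le> n \<Longrightarrow> cmod (g n \<omega>) < \<rho>' \<Longrightarrow> cmod (d n \<omega> - g n \<omega> / c) \<le> \<epsilon> * cmod (g n \<omega>)"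
        using lin[OF \<epsilon>(1)] by auto
      define r where "r = \<rho>' / 2"
      have r: "0 < r" "r < \<rho>'" using \<rho>' by (auto simp: r_def)
      have "\<forall>\<^sub>F n in sequentially. real n * expectation (\<lambda>\<omega>. indicat_real (B r n) \<omega> * (cmod (g n \<omega>))\<^sup>2) < e / 2"
        by (rule order_tendstoD(2)[OF neg(2)[OF r(1)]]) (use e in simp)
      then show "\<forall>\<^sub>F n in sequentially.
          dist (expectation (\<lambda>\<omega>. (1 - indicat_real (B r0 n) \<omega>) * (cmod (W n \<omega> - G n \<omega>))\<^sup>2)) 0 < e"
        using eventually_ge_at_top[of N]
      proof eventually_elim
        case (elim n)
        have n1: "1 \<le> n" using elim(2) N by simp
        have igB: "integrable M (\<lambda>\<omega>. indicat_real (B r n) \<omega> * (cmod (g n \<omega>))\<^sup>2)"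
          by (rule integrable_restricted(1)[OF _ sqg]) simp
        have sqdg: "integrable M (\<lambda>\<omega>. (cmod (d n \<omega> - g n \<omega> / c))\<^sup>2)"
          using second_moment_add(1)[of "d n" "\<lambda>\<omega>. - (g n \<omega> / c)"] sqd[OF elim(2)] sqg[of n]
          by (simp add: norm_divide power_divide)
        have "expectation (\<lambda>\<omega>. (1 - indicat_real (B r0 n) \<omega>) * (cmod (W n \<omega> - G n \<omega>))\<^sup>2) \<le>
          expectation (\<lambda>\<omega>. real n * \<epsilon>\<^sup>2 * (cmod (g n \<omega>))\<^sup>2 + real n * (indicat_real (B r n) \<omega> * (cmod (g n \<omega>))\<^sup>2))"
        proof (rule integral_mono)
          show "integrable M (\<lambda>\<omega>. (1 - indicat_real (B r0 n) \<omega>) * (cmod (W n \<omega> - G n \<omega>))\<^sup>2)"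
            unfolding WG2 by (intro integrable_restricted(2) integrable_mult_right sqdg) simp
          show "integrable M (\<lambda>\<omega>. real n * \<epsilon>\<^sup>2 * (cmod (g n \<omega>))\<^sup>2 + real n * (indicat_real (B r n) \<omega> * (cmod (g n \<omega>))\<^sup>2))"
            by (intro Bochner_Integration.integrable_add integrable_mult_right sqg igB)
          fix \<omega> assume \<omega>: "\<omega> \<in> space M"
          show "(1 - indicat_real (B r0 n) \<omega>) * (cmod (W n \<omega> - G n \<omega>))\<^sup>2
            \<le> real n * \<epsilon>\<^sup>2 * (cmod (g n \<omega>))\<^sup>2 + real n * (indicat_real (B r n) \<omega> * (cmod (g n \<omega>))\<^sup>2)"
          proof (cases "\<omega> \<in> B r0 n")
            case False
            have "(cmod (d n \<omega> - g n \<omega> / c))\<^sup>2 \<le> \<epsilon>\<^sup>2 * (cmod (g n \<omega>))\<^sup>2 + indicat_real (B r n) \<omega> * (cmod (g n \<omega>))\<^sup>2"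
            proof (cases "\<omega> \<in> B r n")
              case True
              have "(cmod (d n \<omega> - g n \<omega> / c))\<^sup>2 \<le> (cmod (g n \<omega>))\<^sup>2"
                by (intro power_mono dg(1)[OF n1 \<omega> False]) auto
              moreover have "0 \<le> \<epsilon>\<^sup>2 * (cmod (g n \<omega>))\<^sup>2" by simp
              moreover have "indicat_real (B r n) \<omega> * (cmod (g n \<omega>))\<^sup>2 = (cmod (g n \<omega>))\<^sup>2" using True by simp
              ultimately show ?thesis by linarith
            next
              case False
              then have "cmod (d n \<omega> - g n \<omega> / c) \<le> \<epsilon> * cmod (g n \<omega>)"
                using off(1)[OF \<omega> False] r lin'[OF n1] by simp
              then have "(cmod (d n \<omega> - g n \<omega> / c))\<^sup>2 \<le> (\<epsilon> * cmod (g n \<omega>))\<^sup>2"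
                by (intro power_mono) auto
              then show ?thesis using False by (simp add: power_mult_distrib)
            qed
            then have "real n * (cmod (d n \<omega> - g n \<omega> / c))\<^sup>2 \<le>
                real n * (\<epsilon>\<^sup>2 * (cmod (g n \<omega>))\<^sup>2 + indicat_real (B r n) \<omega> * (cmod (g n \<omega>))\<^sup>2)"
              by (intro mult_left_mono) auto
            then show ?thesis unfolding WG2 using False by (simp add: algebra_simps)
          qed simp
        qed
        also have "\<dots> = real n * \<epsilon>\<^sup>2 * (V / real n) + real n * expectation (\<lambda>\<omega>. indicat_real (B r n) \<omega> * (cmod (g n \<omega>))\<^sup>2)"
          unfolding Eg[symmetric] using sqg[of n] igB by simp
        also have "\<dots> = \<epsilon>\<^sup>2 * V + real n * expectation (\<lambda>\<omega>. indicat_real (B r n) \<omega> * (cmod (g n \<omega>))\<^sup>2)"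
          using n1 by simp
        also have "\<dots> < e" using elim(1) \<epsilon>(2) by linarith
        finally have "expectation (\<lambda>\<omega>. (1 - indicat_real (B r0 n) \<omega>) * (cmod (W n \<omega> - G n \<omega>))\<^sup>2) < e" .
        moreover have "0 \<le> expectation (\<lambda>\<omega>. (1 - indicat_real (B r0 n) \<omega>) * (cmod (W n \<omega> - G n \<omega>))\<^sup>2)"
          by (intro integral_nonneg_AE) (auto simp: indicator_def)
        ultimately show ?case by simp
      qed
    qed
    have EW: "expectation (\<lambda>\<omega>. (cmod (W n \<omega> - expectation (W n)))\<^sup>2) =
        real n * expectation (\<lambda>\<omega>. (cmod (Y n \<omega> - expectation (Y n)))\<^sup>2)" if n: "N \<le> n" for n
    proof -
      have iY: "integrable M (Y n)" by (rule complex_square_integrable[OF Ym sqY[OF n]])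
      have "expectation (W n) = of_real (sqrt (real n)) * (expectation (Y n) - \<theta>)"
        unfolding W_def[abs_def] d_def using iY by (simp add: prob_space)
      then have "W n \<omega> - expectation (W n) = of_real (sqrt (real n)) * (Y n \<omega> - expectation (Y n))" for \<omega>
        by (simp add: W_def d_def algebra_simps)
      then have "(cmod (W n \<omega> - expectation (W n)))\<^sup>2 = real n * (cmod (Y n \<omega> - expectation (Y n)))\<^sup>2" for \<omega>
        by (simp add: norm_mult power_mult_distrib)
      then show ?thesis by simp
    qed
    show "(\<lambda>n. expectation (\<lambda>\<omega>. (cmod (W n \<omega> - expectation (W n)))\<^sup>2)) \<longlonglongrightarrow> V / (cmod c)\<^sup>2"
      by (rule Lim_transform_eventually[OF limY[folded V_def]])
        (rule eventually_mono[OF eventually_ge_at_top[of N] EW[symmetric]])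
  qed measurable
  then have limdB: "(\<lambda>n. real n * expectation (\<lambda>\<omega>. indicat_real (B r0 n) \<omega> * (cmod (d n \<omega>))\<^sup>2)) \<longlonglongrightarrow> 0"
    unfolding W2 by (simp add: mult.left_commute)

  have Dd: "cmod (D n \<omega>) \<le> 3 * cmod (d n \<omega>) + 4 * Im \<theta>" if "1 \<le> n" for n \<omega>
    using average_one_step_error_bounds(1)[OF s that] unfolding D_def one_step_error_def d_def by simp
  \<comment> \<open>The square of a sum is at most twice the sum of squares: 2 times 3^2 and 2 times
    4^2.\<close>
  have Dd2: "(cmod (D n \<omega>))\<^sup>2 \<le> 18 * (cmod (d n \<omega>))\<^sup>2 + 32 * (Im \<theta>)\<^sup>2" if "1 \<le> n" for n \<omega>
  proof -
    have "(cmod (D n \<omega>))\<^sup>2 \<le> (3 * cmod (d n \<omega>) + 4 * Im \<theta>)\<^sup>2" using Dd[OF that] by (intro power_mono) auto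
    also have "\<dots> \<le> 18 * (cmod (d n \<omega>))\<^sup>2 + 32 * (Im \<theta>)\<^sup>2"
      using sum_squares_bound[of "3 * cmod (d n \<omega>)" "4 * Im \<theta>"] by (simp add: power2_sum power_mult_distrib)
    finally show ?thesis .
  qed
  show sqD: "integrable M (\<lambda>\<omega>. (cmod (one_step_error Y \<theta> n \<omega>))\<^sup>2)" if "N \<le> n" for n
  proof (rule Bochner_Integration.integrable_bound)
    show "integrable M (\<lambda>\<omega>. 18 * (cmod (d n \<omega>))\<^sup>2 + 32 * (Im \<theta>)\<^sup>2)" using sqd[OF that] by simp
    show "AE \<omega> in M. norm ((cmod (one_step_error Y \<theta> n \<omega>))\<^sup>2) \<le> norm (18 * (cmod (d n \<omega>))\<^sup>2 + 32 * (Im \<theta>)\<^sup>2)"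
      using Dd2 that N unfolding D_def by simp
  qed measurable
  \<comment> \<open>In the quadratic bound each average is at most \<open>r\<close> and |d| at most
    C r: the 5 is 4 + 1 from the two averages, and the factor C in front replaces |d| by C
    |g|.\<close>
  define C2 where "C2 = C * (5 + 16 * C / Im \<theta>)"
  have C2: "C2 > 0" using C s by (simp add: C2_def add_pos_pos)
  have D_good: "cmod (D n \<omega>) \<le> C2 * r * cmod (g n \<omega>)"
    if n: "1 \<le> n" and \<omega>: "\<omega> \<in> space M" "\<omega> \<notin> B r n" and r: "0 < r" "r \<le> r0" for n \<omega> r
  proof -
    have \<omega>0: "\<omega> \<notin> B r0 n" using \<omega> B_anti[OF r(2)] by blast
    note dg = dg[OF n \<omega>(1) \<omega>0] and off = off[OF \<omega>]
    have "cmod (d n \<omega>) \<le> C * r" using dg(2) mult_left_mono[OF off(1), of C] C by linarith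
    then have "16 * cmod (d n \<omega>) / Im \<theta> \<le> 16 * (C * r) / Im \<theta>" using s by (intro divide_right_mono) auto
    then have "4 * cmod (average (cayley \<theta>) n \<omega>) + cmod (average (\<lambda>x. (cayley \<theta> x)\<^sup>2) n \<omega>) + 16 * cmod (d n \<omega>) / Im \<theta>
        \<le> 5 * r + 16 * (C * r) / Im \<theta>" using off by linarith
    moreover have "cmod (D n \<omega>) \<le> cmod (d n \<omega>) *
        (4 * cmod (average (cayley \<theta>) n \<omega>) + cmod (average (\<lambda>x. (cayley \<theta> x)\<^sup>2) n \<omega>) + 16 * cmod (d n \<omega>) / Im \<theta>)"
      using average_one_step_error_bounds(2)[OF s n] dg(3) unfolding D_def one_step_error_def d_def by simp
    ultimately have "cmod (D n \<omega>) \<le> (C * cmod (g n \<omega>)) * (5 * r + 16 * (C * r) / Im \<theta>)"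
      using dg(2) C s r by (elim order_trans) (intro mult_mono, auto)
    also have "\<dots> = C2 * r * cmod (g n \<omega>)" using s by (simp add: C2_def field_simps)
    finally show ?thesis .
  qed
  show "(\<lambda>n. real n * expectation (\<lambda>\<omega>. (cmod (one_step_error Y \<theta> n \<omega>))\<^sup>2)) \<longlonglongrightarrow> 0"
  proof (rule tendstoI)
    fix e :: real assume e: "0 < e"
    \<comment> \<open>The second entry makes (C2 r)^2 V smaller than e / 2, uniformly in n.\<close>
    define r where "r = min r0 (sqrt (e / (2 * (V + 1))) / C2)"
    have r: "0 < r" "r \<le> r0" using r0 e V0 C2 by (auto simp: r_def)
    have rV: "(C2 * r)\<^sup>2 * V < e / 2"
    proof -
      have "C2 * r \<le> C2 * (sqrt (e / (2 * (V + 1))) / C2)" using C2 by (intro mult_left_mono) (auto simp: r_def)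
      then have "(C2 * r)\<^sup>2 \<le> (sqrt (e / (2 * (V + 1))))\<^sup>2" using C2 r by (intro power_mono) auto
      also have "\<dots> = e / (2 * (V + 1))" using e V0 by simp
      finally have "(C2 * r)\<^sup>2 * V \<le> e / (2 * (V + 1)) * V" using V0 by (intro mult_right_mono)
      also have "\<dots> < e / 2" using e V0 by (simp add: field_simps)
      finally show ?thesis .
    qed
    have "(\<lambda>n. 18 * (real n * expectation (\<lambda>\<omega>. indicat_real (B r0 n) \<omega> * (cmod (d n \<omega>))\<^sup>2))
        + 18 * C\<^sup>2 * (real n * expectation (\<lambda>\<omega>. indicat_real (B r n) \<omega> * (cmod (g n \<omega>))\<^sup>2))
        + 32 * (Im \<theta>)\<^sup>2 * (real n * prob (B r n))) \<longlonglongrightarrow> 18 * 0 + 18 * C\<^sup>2 * 0 + 32 * (Im \<theta>)\<^sup>2 * 0"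
      by (intro tendsto_intros limdB neg r)
    then have "\<forall>\<^sub>F n in sequentially. 18 * (real n * expectation (\<lambda>\<omega>. indicat_real (B r0 n) \<omega> * (cmod (d n \<omega>))\<^sup>2))
        + 18 * C\<^sup>2 * (real n * expectation (\<lambda>\<omega>. indicat_real (B r n) \<omega> * (cmod (g n \<omega>))\<^sup>2))
        + 32 * (Im \<theta>)\<^sup>2 * (real n * prob (B r n)) < e / 2"
      using e by (intro order_tendstoD(2)) auto
    then show "\<forall>\<^sub>F n in sequentially. dist (real n * expectation (\<lambda>\<omega>. (cmod (one_step_error Y \<theta> n \<omega>))\<^sup>2)) 0 < e"
      using eventually_ge_at_top[of N]
    proof eventually_elim
      case (elim n)
      have n1: "1 \<le> n" using elim(2) N by simp
      have i1: "integrable M (\<lambda>\<omega>. indicat_real (B r0 n) \<omega> * (cmod (d n \<omega>))\<^sup>2)"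
        by (rule integrable_restricted(1)[OF _ sqd[OF elim(2)]]) simp
      have i2: "integrable M (\<lambda>\<omega>. indicat_real (B r n) \<omega> * (cmod (g n \<omega>))\<^sup>2)"
        by (rule integrable_restricted(1)[OF _ sqg]) simp
      have i3: "integrable M (indicat_real (B r n))" by (rule integrable_indicator_event) simp
      have "expectation (\<lambda>\<omega>. (cmod (D n \<omega>))\<^sup>2) \<le> expectation (\<lambda>\<omega>. (C2 * r)\<^sup>2 * (cmod (g n \<omega>))\<^sup>2
        + 18 * (indicat_real (B r0 n) \<omega> * (cmod (d n \<omega>))\<^sup>2)
        + 18 * C\<^sup>2 * (indicat_real (B r n) \<omega> * (cmod (g n \<omega>))\<^sup>2) + 32 * (Im \<theta>)\<^sup>2 * indicat_real (B r n) \<omega>)"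
      proof (rule integral_mono)
        show "integrable M (\<lambda>\<omega>. (cmod (D n \<omega>))\<^sup>2)" unfolding D_def by (rule sqD[OF elim(2)])
        show "integrable M (\<lambda>\<omega>. (C2 * r)\<^sup>2 * (cmod (g n \<omega>))\<^sup>2
          + 18 * (indicat_real (B r0 n) \<omega> * (cmod (d n \<omega>))\<^sup>2)
          + 18 * C\<^sup>2 * (indicat_real (B r n) \<omega> * (cmod (g n \<omega>))\<^sup>2) + 32 * (Im \<theta>)\<^sup>2 * indicat_real (B r n) \<omega>)"
          by (intro Bochner_Integration.integrable_add integrable_mult_right sqg i1 i2 i3)
        fix \<omega> assume \<omega>: "\<omega> \<in> space M"
        have nn: "0 \<le> (C2 * r)\<^sup>2 * (cmod (g n \<omega>))\<^sup>2" "0 \<le> 18 * C\<^sup>2 * (cmod (g n \<omega>))\<^sup>2" by simp_all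
        \<comment> \<open>Off \<open>B r n\<close> the quadratic bound applies. Between the radii
          only the crude bound is available, but there |d| is still at most C |g|, whose second
          moment on \<open>B r n\<close> is o(1/n). On \<open>B r0 n\<close> nothing relates d to g,
          and \<open>limdB\<close> is what remains. The additive constant of the crude bound is paid
          for by the probability of \<open>B r n\<close>.\<close>
        consider "\<omega> \<notin> B r n" | "\<omega> \<in> B r n" "\<omega> \<notin> B r0 n" | "\<omega> \<in> B r n" "\<omega> \<in> B r0 n" by blast
        then show "(cmod (D n \<omega>))\<^sup>2 \<le> (C2 * r)\<^sup>2 * (cmod (g n \<omega>))\<^sup>2
          + 18 * (indicat_real (B r0 n) \<omega> * (cmod (d n \<omega>))\<^sup>2)
          + 18 * C\<^sup>2 * (indicat_real (B r n) \<omega> * (cmod (g n \<omega>))\<^sup>2) + 32 * (Im \<theta>)\<^sup>2 * indicat_real (B r n) \<omega>"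
        proof cases
          case 1
          then have "\<omega> \<notin> B r0 n" using B_anti[OF r(2)] by blast
          moreover have "(cmod (D n \<omega>))\<^sup>2 \<le> (C2 * r * cmod (g n \<omega>))\<^sup>2"
            by (intro power_mono D_good[OF n1 \<omega> 1 r]) auto
          ultimately show ?thesis using 1 by (simp add: power_mult_distrib)
        next
          case 2
          have "(cmod (d n \<omega>))\<^sup>2 \<le> (C * cmod (g n \<omega>))\<^sup>2"
            by (intro power_mono dg(2)[OF n1 \<omega> 2(2)]) auto
          then have "(cmod (d n \<omega>))\<^sup>2 \<le> C\<^sup>2 * (cmod (g n \<omega>))\<^sup>2" by (simp add: power_mult_distrib)
          then have "(cmod (D n \<omega>))\<^sup>2 \<le> (C2 * r)\<^sup>2 * (cmod (g n \<omega>))\<^sup>2 + 18 * C\<^sup>2 * (cmod (g n \<omega>))\<^sup>2 + 32 * (Im \<theta>)\<^sup>2"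
            using Dd2[OF n1, of \<omega>] nn(1) by linarith
          then show ?thesis using 2 by simp
        next
          case 3
          have "(cmod (D n \<omega>))\<^sup>2 \<le> (C2 * r)\<^sup>2 * (cmod (g n \<omega>))\<^sup>2 + 18 * (cmod (d n \<omega>))\<^sup>2 + 18 * C\<^sup>2 * (cmod (g n \<omega>))\<^sup>2 + 32 * (Im \<theta>)\<^sup>2"
            using Dd2[OF n1, of \<omega>] nn by linarith
          then show ?thesis using 3 by simp
        qed
      qed
      also have "\<dots> = (C2 * r)\<^sup>2 * (V / real n)
        + 18 * expectation (\<lambda>\<omega>. indicat_real (B r0 n) \<omega> * (cmod (d n \<omega>))\<^sup>2)
        + 18 * C\<^sup>2 * expectation (\<lambda>\<omega>. indicat_real (B r n) \<omega> * (cmod (g n \<omega>))\<^sup>2) + 32 * (Im \<theta>)\<^sup>2 * prob (B r n)"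
        unfolding Eg[symmetric] using sqg[of n] i1 i2 i3 by simp
      finally have "real n * expectation (\<lambda>\<omega>. (cmod (D n \<omega>))\<^sup>2) \<le> real n * ((C2 * r)\<^sup>2 * (V / real n)
        + 18 * expectation (\<lambda>\<omega>. indicat_real (B r0 n) \<omega> * (cmod (d n \<omega>))\<^sup>2)
        + 18 * C\<^sup>2 * expectation (\<lambda>\<omega>. indicat_real (B r n) \<omega> * (cmod (g n \<omega>))\<^sup>2) + 32 * (Im \<theta>)\<^sup>2 * prob (B r n))"
        by (rule mult_left_mono) simp
      also have "\<dots> = (C2 * r)\<^sup>2 * V + (18 * (real n * expectation (\<lambda>\<omega>. indicat_real (B r0 n) \<omega> * (cmod (d n \<omega>))\<^sup>2))
        + 18 * C\<^sup>2 * (real n * expectation (\<lambda>\<omega>. indicat_real (B r n) \<omega> * (cmod (g n \<omega>))\<^sup>2))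
        + 32 * (Im \<theta>)\<^sup>2 * (real n * prob (B r n)))"
        using n1 by (simp add: distrib_left mult_ac)
      also have "\<dots> < e" using rV elim(1) by linarith
      finally have "real n * expectation (\<lambda>\<omega>. (cmod (D n \<omega>))\<^sup>2) < e" .
      moreover have "0 \<le> real n * expectation (\<lambda>\<omega>. (cmod (D n \<omega>))\<^sup>2)" by (intro mult_nonneg_nonneg integral_nonneg_AE) auto
      ultimately show ?case by (simp add: D_def)
    qed
  qed
qed

text \<open>After scaling by the square root of n, the leading term \<open>P n\<close> has constant
  second moment for n at least 1, and \<open>R n\<close> tends to 0 in mean square, so
  Cauchy-Schwarz removes the cross term. Since the leading term is centered, the bias of
  \<open>Z n\<close> is the mean of the error, whose square is at most its second moment and hence
  o(1/n); this is why the variance has the same limit.\<close>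

lemma one_step_second_moments:
  assumes s: "0 < Im \<theta>" and c1: "expectation (\<lambda>\<omega>. cayley \<theta> (X 1 \<omega>)) = 0"
    and Ym[measurable]: "\<And>n. Y n \<in> borel_measurable M" and N: "1 \<le> N"
    and sqD: "\<And>n. N \<le> n \<Longrightarrow> integrable M (\<lambda>\<omega>. (cmod (one_step_error Y \<theta> n \<omega>))\<^sup>2)"
    and limD: "(\<lambda>n. real n * expectation (\<lambda>\<omega>. (cmod (one_step_error Y \<theta> n \<omega>))\<^sup>2)) \<longlonglongrightarrow> 0"
    and Z: "\<And>n \<omega>. N \<le> n \<Longrightarrow> Z n \<omega> = \<theta> + 2 * \<i> * of_real (Im \<theta>) * average (cayley \<theta>) n \<omega> + one_step_error Y \<theta> n \<omega>"
  shows "\<And>n. N \<le> n \<Longrightarrow> integrable M (\<lambda>\<omega>. (cmod (Z n \<omega> - \<theta>))\<^sup>2)"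
    and "\<And>n. N \<le> n \<Longrightarrow> integrable M (\<lambda>\<omega>. (cmod (Z n \<omega> - expectation (Z n)))\<^sup>2)"
    and "(\<lambda>n. real n * expectation (\<lambda>\<omega>. (cmod (Z n \<omega> - \<theta>))\<^sup>2)) \<longlonglongrightarrow> 4 * (Im \<theta>)\<^sup>2"
    and "(\<lambda>n. real n * expectation (\<lambda>\<omega>. (cmod (Z n \<omega> - expectation (Z n)))\<^sup>2)) \<longlonglongrightarrow> 4 * (Im \<theta>)\<^sup>2"
proof -
  define D where "D = one_step_error Y \<theta>"
  define \<Phi> where "\<Phi> = average (cayley \<theta>)"
  define P where "P n \<omega> = of_real (sqrt (real n)) * (2 * \<i> * of_real (Im \<theta>) * \<Phi> n \<omega>)" for n \<omega>
  define R where "R n \<omega> = of_real (sqrt (real n)) * D n \<omega>" for n \<omega>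
  have [measurable]: "D n \<in> borel_measurable M" "\<Phi> n \<in> borel_measurable M" "P n \<in> borel_measurable M" "R n \<in> borel_measurable M" for n
    unfolding D_def \<Phi>_def P_def[abs_def] R_def[abs_def] by measurable
  have u1: "cmod (cayley \<theta> x) = 1" for x using s by (intro cmod_cayley) simp
  have sq1: "integrable M (\<lambda>\<omega>. (cmod (cayley \<theta> (X 1 \<omega>)))\<^sup>2)" unfolding u1 by simp
  have \<Phi>: "integrable M (\<lambda>\<omega>. (cmod (\<Phi> n \<omega>))\<^sup>2)" "expectation (\<lambda>\<omega>. (cmod (\<Phi> n \<omega>))\<^sup>2) = 1 / real n" for n
    using average_second_moment[OF cayley_measurable sq1 c1, of n] unfolding \<Phi>_def u1 by (auto simp: prob_space)
  have i\<Phi>: "integrable M (\<Phi> n)" for n by (rule complex_square_integrable[OF _ \<Phi>(1)]) simp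
  have E\<Phi>: "expectation (\<Phi> n) = 0" for n
  proof -
    have "integrable M (\<lambda>\<omega>. cayley \<theta> (X 1 \<omega>))"
      by (rule complex_square_integrable[OF measurable_compose[OF rv_sample cayley_measurable] sq1]) simp
    then have "integrable M (\<lambda>\<omega>. cayley \<theta> (X j \<omega>)) \<and> expectation (\<lambda>\<omega>. cayley \<theta> (X j \<omega>)) = 0" if "1 \<le> j" for j
      using sample_transfer[OF cayley_measurable that] c1 by simp
    then show ?thesis unfolding \<Phi>_def average_def[abs_def] by simp
  qed
  have P2: "(cmod (P n \<omega>))\<^sup>2 = 4 * (Im \<theta>)\<^sup>2 * (real n * (cmod (\<Phi> n \<omega>))\<^sup>2)"
    and R2: "(cmod (R n \<omega>))\<^sup>2 = real n * (cmod (D n \<omega>))\<^sup>2" for n \<omega>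
    by (simp_all add: P_def R_def norm_mult power_mult_distrib)
  have sqP: "integrable M (\<lambda>\<omega>. (cmod (P n \<omega>))\<^sup>2)" for n unfolding P2 by (intro integrable_mult_right \<Phi>)
  have sqR: "integrable M (\<lambda>\<omega>. (cmod (R n \<omega>))\<^sup>2)" if "N \<le> n" for n
    unfolding R2 D_def by (intro integrable_mult_right sqD that)
  have EP: "expectation (\<lambda>\<omega>. (cmod (P n \<omega>))\<^sup>2) = 4 * (Im \<theta>)\<^sup>2" if "1 \<le> n" for n
    unfolding P2 using \<Phi>(2)[of n] that by simp
  have limP: "(\<lambda>n. expectation (\<lambda>\<omega>. (cmod (P n \<omega>))\<^sup>2)) \<longlonglongrightarrow> 4 * (Im \<theta>)\<^sup>2"
    by (rule tendsto_eventually) (rule eventually_mono[OF eventually_ge_at_top[of 1] EP])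
  have limR: "(\<lambda>n. expectation (\<lambda>\<omega>. (cmod (R n \<omega>))\<^sup>2)) \<longlonglongrightarrow> 0"
    unfolding R2 using limD by (simp add: D_def)
  have cross: "(\<lambda>n. expectation (\<lambda>\<omega>. P n \<omega> * cnj (R n \<omega>))) \<longlonglongrightarrow> 0"
    by (rule cross_expectation_tendsto_0[OF _ _ sqP sqR limP limR]) auto
  have Zt: "Z n \<omega> - \<theta> = 2 * \<i> * of_real (Im \<theta>) * \<Phi> n \<omega> + D n \<omega>" if "N \<le> n" for n \<omega>
    using Z[OF that] by (simp add: \<Phi>_def D_def)
  then have PR: "of_real (sqrt (real n)) * (Z n \<omega> - \<theta>) = P n \<omega> + R n \<omega>" if "N \<le> n" for n \<omega>
    using that by (simp add: P_def R_def distrib_left)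
  have Z2: "(cmod (P n \<omega> + R n \<omega>))\<^sup>2 = real n * (cmod (Z n \<omega> - \<theta>))\<^sup>2" if "N \<le> n" for n \<omega>
    unfolding PR[OF that, symmetric] by (simp add: norm_mult power_mult_distrib)
  have Zm: "(\<lambda>\<omega>. Z n \<omega> - \<theta>) \<in> borel_measurable M" if "N \<le> n" for n
    unfolding Zt[OF that] by measurable
  show sqZ: "integrable M (\<lambda>\<omega>. (cmod (Z n \<omega> - \<theta>))\<^sup>2)" if n: "N \<le> n" for n
  proof -
    have "integrable M (\<lambda>\<omega>. (cmod (2 * \<i> * of_real (Im \<theta>) * \<Phi> n \<omega>))\<^sup>2)"
      using \<Phi>(1)[of n] by (simp add: norm_mult power_mult_distrib)
    then show ?thesis unfolding Zt[OF n]
      by (intro second_moment_add(1)) (use sqD[OF n] in \<open>auto simp: D_def\<close>)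
  qed
  have iZ: "integrable M (\<lambda>\<omega>. Z n \<omega> - \<theta>)" if "N \<le> n" for n
    by (rule complex_square_integrable[OF Zm sqZ]) (use that in auto)
  have EZ: "expectation (Z n) = \<theta> + expectation (D n)" if n: "N \<le> n" for n
  proof -
    have iD: "integrable M (D n)"
      using sqD[OF n] by (intro complex_square_integrable) (auto simp: D_def)
    have "Z n = (\<lambda>\<omega>. \<theta> + 2 * \<i> * of_real (Im \<theta>) * \<Phi> n \<omega> + D n \<omega>)"
      using Z[OF n] by (simp add: \<Phi>_def D_def fun_eq_iff)
    then show ?thesis using iD i\<Phi>[of n] E\<Phi>[of n] by (simp add: prob_space)
  qed
  have var: "integrable M (\<lambda>\<omega>. (cmod (Z n \<omega> - expectation (Z n)))\<^sup>2)"
    "expectation (\<lambda>\<omega>. (cmod (Z n \<omega> - expectation (Z n)))\<^sup>2) =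
      expectation (\<lambda>\<omega>. (cmod (Z n \<omega> - \<theta>))\<^sup>2) - (cmod (expectation (D n)))\<^sup>2" if n: "N \<le> n" for n
  proof -
    have eq: "Z n \<omega> - expectation (Z n) = (Z n \<omega> - \<theta>) - expectation (D n)" for \<omega>
      using EZ[OF n] by simp
    have ed: "expectation (\<lambda>\<omega>. Z n \<omega> - \<theta>) = expectation (D n)"
    proof -
      have "integrable M (\<lambda>\<omega>. (Z n \<omega> - \<theta>) + \<theta>)" using iZ[OF n] by (intro Bochner_Integration.integrable_add) auto
      then have "integrable M (Z n)" by simp
      then show ?thesis using EZ[OF n] by (simp add: prob_space)
    qed
    show "integrable M (\<lambda>\<omega>. (cmod (Z n \<omega> - expectation (Z n)))\<^sup>2)"
      unfolding eq by (rule complex_second_moment_shift(1)[OF Zm[OF n] sqZ[OF n]])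
    have "Re (cnj (expectation (D n)) * expectation (D n)) = (cmod (expectation (D n)))\<^sup>2"
      unfolding cmod_power2 by (simp add: power2_eq_square)
    then show "expectation (\<lambda>\<omega>. (cmod (Z n \<omega> - expectation (Z n)))\<^sup>2) =
      expectation (\<lambda>\<omega>. (cmod (Z n \<omega> - \<theta>))\<^sup>2) - (cmod (expectation (D n)))\<^sup>2"
      unfolding eq complex_second_moment_shift(2)[OF Zm[OF n] sqZ[OF n]] ed by simp
  qed
  then show "\<And>n. N \<le> n \<Longrightarrow> integrable M (\<lambda>\<omega>. (cmod (Z n \<omega> - expectation (Z n)))\<^sup>2)" by blast
  have eqZ: "expectation (\<lambda>\<omega>. (cmod (P n \<omega>))\<^sup>2) + expectation (\<lambda>\<omega>. (cmod (R n \<omega>))\<^sup>2)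
      + 2 * Re (expectation (\<lambda>\<omega>. P n \<omega> * cnj (R n \<omega>))) = real n * expectation (\<lambda>\<omega>. (cmod (Z n \<omega> - \<theta>))\<^sup>2)"
    if n: "N \<le> n" for n
    using second_moment_add(2)[of "P n" "R n"] sqP sqR[OF n] unfolding Z2[OF n] by simp
  have "(\<lambda>n. expectation (\<lambda>\<omega>. (cmod (P n \<omega>))\<^sup>2) + expectation (\<lambda>\<omega>. (cmod (R n \<omega>))\<^sup>2)
      + 2 * Re (expectation (\<lambda>\<omega>. P n \<omega> * cnj (R n \<omega>)))) \<longlonglongrightarrow> 4 * (Im \<theta>)\<^sup>2 + 0 + 2 * Re 0"
    by (intro tendsto_add tendsto_mult tendsto_const tendsto_Re limP limR cross)
  then have lim: "(\<lambda>n. expectation (\<lambda>\<omega>. (cmod (P n \<omega>))\<^sup>2) + expectation (\<lambda>\<omega>. (cmod (R n \<omega>))\<^sup>2)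
      + 2 * Re (expectation (\<lambda>\<omega>. P n \<omega> * cnj (R n \<omega>)))) \<longlonglongrightarrow> 4 * (Im \<theta>)\<^sup>2" by simp
  show limZ: "(\<lambda>n. real n * expectation (\<lambda>\<omega>. (cmod (Z n \<omega> - \<theta>))\<^sup>2)) \<longlonglongrightarrow> 4 * (Im \<theta>)\<^sup>2"
    by (rule Lim_transform_eventually[OF lim]) (rule eventually_mono[OF eventually_ge_at_top[of N] eqZ])
  have limED: "(\<lambda>n. real n * (cmod (expectation (D n)))\<^sup>2) \<longlonglongrightarrow> 0"
  proof (rule Lim_null_comparison[OF _ limD])
    show "\<forall>\<^sub>F n in sequentially. norm (real n * (cmod (expectation (D n)))\<^sup>2)
        \<le> real n * expectation (\<lambda>\<omega>. (cmod (one_step_error Y \<theta> n \<omega>))\<^sup>2)"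
      using eventually_ge_at_top[of N]
    proof eventually_elim
      case (elim n)
      have "(cmod (expectation (D n)))\<^sup>2 \<le> expectation (\<lambda>\<omega>. (cmod (D n \<omega>))\<^sup>2)"
        by (intro expectation_square_bound) (use sqD[OF elim] in \<open>auto simp: D_def\<close>)
      then show ?case unfolding D_def by (simp add: mult_left_mono)
    qed
  qed
  have "(\<lambda>n. real n * expectation (\<lambda>\<omega>. (cmod (Z n \<omega> - \<theta>))\<^sup>2) - real n * (cmod (expectation (D n)))\<^sup>2) \<longlonglongrightarrow> 4 * (Im \<theta>)\<^sup>2 - 0"
    by (intro tendsto_diff limZ limED)
  moreover have "real n * expectation (\<lambda>\<omega>. (cmod (Z n \<omega> - \<theta>))\<^sup>2) - real n * (cmod (expectation (D n)))\<^sup>2 =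
      real n * expectation (\<lambda>\<omega>. (cmod (Z n \<omega> - expectation (Z n)))\<^sup>2)" if "N \<le> n" for n
    unfolding var(2)[OF that] by (simp add: right_diff_distrib)
  ultimately show "(\<lambda>n. real n * expectation (\<lambda>\<omega>. (cmod (Z n \<omega> - expectation (Z n)))\<^sup>2)) \<longlonglongrightarrow> 4 * (Im \<theta>)\<^sup>2"
    by (subst diff_zero[symmetric], elim Lim_transform_eventually) (rule eventually_mono[OF eventually_ge_at_top[of N]])
qed

end

section \<open>Extended nonnegative moments and the final assembly\<close>

lemma second_moment_eq:
  assumes "integrable M (\<lambda>\<omega>. (cmod (T \<omega>))\<^sup>2)"
  shows "second_moment M T = ennreal (integral\<^sup>L M (\<lambda>\<omega>. (cmod (T \<omega>))\<^sup>2))"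
  unfolding second_moment_def by (rule nn_integral_eq_integral[OF assms]) simp

lemma second_moment_finite_iff:
  assumes [measurable]: "T \<in> borel_measurable M"
  shows "second_moment M T < \<infinity> \<longleftrightarrow> integrable M (\<lambda>\<omega>. (cmod (T \<omega>))\<^sup>2)"
  unfolding second_moment_def integrable_iff_bounded by simp

lemma measurable_inv_into_holomorphic:
  assumes "open U" "f holomorphic_on U" "inj_on f U"
  shows "inv_into U f \<in> borel_measurable borel"
proof -
  obtain g where g: "g holomorphic_on f ` U" "\<And>z. z \<in> U \<Longrightarrow> g (f z) = z"
    using holomorphic_has_inverse[OF assms(2,1,3)] by metis
  have op: "open (f ` U)" by (rule open_mapping_thm3[OF assms(2,1,3)])
  define k where "k = (SOME z::complex. False)"
  have "inv_into U f = (\<lambda>w. if w \<in> f ` U then g w else k)"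
  proof
    fix w show "inv_into U f w = (if w \<in> f ` U then g w else k)"
    proof (cases "w \<in> f ` U")
      case True
      then show ?thesis using g assms(3) by auto
    next
      case False
      then have "(\<lambda>z. z \<in> U \<and> f z = w) = (\<lambda>z. False)" by auto
      then show ?thesis using False by (simp add: inv_into_def k_def)
    qed
  qed
  moreover have "(\<lambda>w. if w \<in> f ` U then g w else k) \<in> borel_measurable borel"
    by (rule borel_measurable_continuous_on_if)
      (use op g(1) in \<open>auto intro: holomorphic_on_imp_continuous_on\<close>)
  ultimately show ?thesis by simp
qed

text \<open>The quotient extends holomorphically to the upper half-plane, where a point is at least
  as far from \<open>cnj \<theta>\<close> as from \<theta>, and it vanishes at \<theta>. The cases
  \<open>k = 1\<close> and \<open>k = 2\<close> are the ones used below.\<close>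

lemma (in prob_space) cauchy_mean_value_cayley:
  assumes D: "distributed M lborel X (\<lambda>x. ennreal (cauchy_density \<theta> x))" and \<theta>: "0 < Im \<theta>"
    and k: "0 < k"
  shows "expectation (\<lambda>\<omega>. (cayley \<theta> (X \<omega>)) ^ k) = 0"
proof -
  define h where "h z = ((z - \<theta>) / (z - cnj \<theta>)) ^ k" for z
  have ne: "z - cnj \<theta> \<noteq> 0" if "0 \<le> Im z" for z using that \<theta> by (auto simp: complex_eq_iff)
  have "cmod (h z) \<le> 1" if "0 \<le> Im z" for z
  proof -
    have "(Im z - Im \<theta>)\<^sup>2 \<le> (Im z + Im \<theta>)\<^sup>2" using that \<theta> by (simp add: power2_sum power2_diff)
    then have "cmod (z - \<theta>) \<le> cmod (z - cnj \<theta>)" by (simp add: cmod_def)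
    then have "cmod ((z - \<theta>) / (z - cnj \<theta>)) \<le> 1" using ne[OF that] by (simp add: norm_divide)
    then show ?thesis unfolding h_def norm_power by (rule power_le_one[OF norm_ge_zero])
  qed
  moreover have "continuous_on closed_upper_half_plane h"
    unfolding h_def by (intro continuous_intros) (auto simp: closed_upper_half_plane_def dest: ne)
  moreover have "h holomorphic_on {z. 0 < Im z}"
    unfolding h_def by (intro holomorphic_intros) (use ne in force)
  ultimately have "expectation (\<lambda>\<omega>. h (of_real (X \<omega>))) = h \<theta>"
    by (intro cauchy_mean_value[OF D \<theta>])
  then show ?thesis using k by (simp add: h_def cayley_def)
qed

theorem theorem4p2:
  fixes M :: "'a measure"
    and X :: "nat \<Rightarrow> 'a \<Rightarrow> real"
    and Y Z :: "nat \<Rightarrow> 'a \<Rightarrow> complex"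
    and f :: "complex \<Rightarrow> complex"
    and U :: "complex set"
    and \<theta> :: complex
  assumes "prob_space M"
    and "0 < Im \<theta>"
    and "prob_space.indep_vars M (\<lambda>_. borel) X {1..}"
    and "\<And>j. 1 \<le> j \<Longrightarrow> distributed M lborel (X j) (\<lambda>x. ennreal (cauchy_density \<theta> x))"
    and "admissible_generator U f"
    and "Y = quasi_arithmetic_mean U f X"
    and "Z = one_step_estimator X Y"
    and "second_moment M (\<lambda>\<omega>. f (complex_of_real (X 1 \<omega>))) < \<infinity>"
    and "(\<lambda>n. of_nat n * complex_variance M (Y n)) \<longlonglongrightarrow>
           complex_variance M (\<lambda>\<omega>. f (complex_of_real (X 1 \<omega>))) / ennreal ((cmod (deriv f \<theta>))\<^sup>2)"
  shows "(\<lambda>n. of_nat n * second_moment M (\<lambda>\<omega>. Z n \<omega> - \<theta>)) \<longlonglongrightarrow> ennreal (4 * (Im \<theta>)\<^sup>2) \<and>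
         (\<exists>L. (\<lambda>n. of_nat n * complex_variance M (Z n)) \<longlonglongrightarrow> L \<and> L \<le> ennreal (4 * (Im \<theta>)\<^sup>2))"
proof -
  interpret prob_space M by fact
  note s = assms(2) and D = assms(4)
  obtain a where a: "Im a \<le> 0" "closed_upper_half_plane - {a} \<subseteq> U" and U: "open U" and inj: "inj_on f U"
    and holo: "f holomorphic_on U"
    and lim_a: "((\<lambda>z. (z - a) * f z) \<longlongrightarrow> 0) (at a within U)"
    and lim_inf: "((\<lambda>z. f z / complex_of_real (cmod z)) \<longlongrightarrow> 0) (inf at_infinity (principal U))"
    using assms(5) unfolding admissible_generator_def by blast
  have distr: "distr M borel (X j) = density lborel (\<lambda>x. ennreal (cauchy_density \<theta> x))" if "1 \<le> j" for j
    using distributed_distr_eq_density[OF D[OF that]] by (metis distr_cong sets_lborel)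
  interpret iid_sample M X
    using assms(3) distr by unfold_locales auto
  define q0 where "q0 x = f (complex_of_real x)" for x
  define q where "q x = q0 x - f \<theta>" for x
  have q0m[measurable]: "q0 \<in> borel_measurable borel"
    unfolding q0_def[abs_def] by (rule measurable_boundary_values[OF a(2) holo])
  have qm[measurable]: "q \<in> borel_measurable borel" unfolding q_def[abs_def] by measurable
  have q0X[measurable]: "(\<lambda>\<omega>. q0 (X 1 \<omega>)) \<in> borel_measurable M"
    by (rule measurable_compose[OF rv_sample q0m]) simp
  have sq0: "integrable M (\<lambda>\<omega>. (cmod (q0 (X 1 \<omega>)))\<^sup>2)"
    using assms(8) second_moment_finite_iff[OF q0X] by (simp add: q0_def)
  have i0: "integrable M (\<lambda>\<omega>. q0 (X 1 \<omega>))" by (rule complex_square_integrable[OF q0X sq0])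
  have mean0: "expectation (\<lambda>\<omega>. q0 (X 1 \<omega>)) = f \<theta>"
    using cauchy_mean_value_generator[OF D[of 1] s a(1) U a(2) holo lim_a lim_inf] i0 by (simp add: q0_def)
  have mean: "expectation (\<lambda>\<omega>. q (X 1 \<omega>)) = 0" unfolding q_def using i0 mean0 by (simp add: prob_space)
  have sq: "integrable M (\<lambda>\<omega>. (cmod (q (X 1 \<omega>)))\<^sup>2)"
    unfolding q_def by (rule complex_second_moment_shift(1)[OF q0X sq0])
  define V where "V = expectation (\<lambda>\<omega>. (cmod (q (X 1 \<omega>)))\<^sup>2)"
  have V0: "0 \<le> V" unfolding V_def by (intro integral_nonneg_AE) auto
  have V: "complex_variance M (\<lambda>\<omega>. f (complex_of_real (X 1 \<omega>))) = ennreal V"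
    using second_moment_eq[OF sq] mean0 by (simp add: complex_variance_def V_def q_def q0_def)
  have \<theta>U: "\<theta> \<in> U" using a s by (force simp: closed_upper_half_plane_def)
  define c where "c = deriv f \<theta>"
  have c: "c \<noteq> 0" unfolding c_def by (rule holomorphic_injective_imp_regular[OF holo U inj \<theta>U])
  define F where "F = inv_into U f"
  have Ff: "F (f z) = z" if "z \<in> U" for z unfolding F_def using inj that by simp
  have Fm[measurable]: "F \<in> borel_measurable borel"
    unfolding F_def by (rule measurable_inv_into_holomorphic[OF U holo inj])
  have F': "(F has_field_derivative inverse c) (at (f \<theta>))"
    by (rule has_field_derivative_inverse_strong[OF _ c U \<theta>U holomorphic_on_imp_continuous_on[OF holo] Ff])
      (use holomorphic_derivI[OF holo U \<theta>U] in \<open>simp add: c_def\<close>)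
  have Y0: "Y n = (\<lambda>\<omega>. F (average q0 n \<omega>))" for n
    by (simp add: assms(6) quasi_arithmetic_mean_def F_def average_def q0_def fun_eq_iff)
  have Ym[measurable]: "Y n \<in> borel_measurable M" for n unfolding Y0 by measurable
  \<comment> \<open>At \<open>n = 0\<close> the average of \<open>q0\<close> is 0 by the convention
    for division, not f(\<theta>), so the formula starts at 1.\<close>
  have Y: "Y n \<omega> = F (f \<theta> + average q n \<omega>)" if "1 \<le> n" for n \<omega>
  proof -
    have "average q n \<omega> = average q0 n \<omega> - f \<theta>"
      using that by (simp add: average_def q_def sum_subtractf diff_divide_distrib)
    then show ?thesis by (simp add: Y0)
  qed
  have c1: "expectation (\<lambda>\<omega>. cayley \<theta> (X 1 \<omega>)) = 0" and c2: "expectation (\<lambda>\<omega>. (cayley \<theta> (X 1 \<omega>))\<^sup>2) = 0"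
    using cauchy_mean_value_cayley[OF D[of 1] s, of 1] cauchy_mean_value_cayley[OF D[of 1] s, of 2] by auto
  have lim: "(\<lambda>n. of_nat n * complex_variance M (Y n)) \<longlonglongrightarrow> ennreal (V / (cmod c)\<^sup>2)"
    using assms(9) c V0 unfolding V c_def[symmetric] by (simp add: divide_ennreal)
  \<comment> \<open>A finite limit of extended values forces finite variances from some index on;
    this is the source of square integrability of Y_n.\<close>
  have "\<forall>\<^sub>F n in sequentially. of_nat n * complex_variance M (Y n) < \<infinity>"
    by (rule order_tendstoD(2)[OF lim]) simp
  then obtain N0 where N0: "\<And>n. N0 \<le> n \<Longrightarrow> of_nat n * complex_variance M (Y n) < \<infinity>"
    by (auto simp: eventually_sequentially)
  \<comment> \<open>The index 0 is excluded because 0 times infinity is 0 in \<open>ennreal\<close>,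
    so a finite product would not give a finite variance.\<close>
  define N where "N = max 1 N0"
  have N: "1 \<le> N" by (simp add: N_def)
  have sqV: "integrable M (\<lambda>\<omega>. (cmod (Y n \<omega> - expectation (Y n)))\<^sup>2)" if "N \<le> n" for n
  proof -
    have "of_nat n * complex_variance M (Y n) < \<infinity>" "n \<noteq> 0" using N0[of n] that by (auto simp: N_def)
    then have "complex_variance M (Y n) < \<infinity>" by (auto simp: ennreal_mult_less_top)
    then show ?thesis unfolding complex_variance_def by (subst (asm) second_moment_finite_iff) measurable
  qed
  have sqY: "integrable M (\<lambda>\<omega>. (cmod (Y n \<omega>))\<^sup>2)" if "N \<le> n" for n
    using complex_second_moment_shift(1)[OF _ sqV[OF that], of "- expectation (Y n)"] by simp
  have limY: "(\<lambda>n. real n * expectation (\<lambda>\<omega>. (cmod (Y n \<omega> - expectation (Y n)))\<^sup>2)) \<longlonglongrightarrow> V / (cmod c)\<^sup>2"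
  proof (rule tendsto_ennrealD)
    have "of_nat n * complex_variance M (Y n) = ennreal (real n * expectation (\<lambda>\<omega>. (cmod (Y n \<omega> - expectation (Y n)))\<^sup>2))"
      if "N \<le> n" for n
      unfolding complex_variance_def second_moment_eq[OF sqV[OF that]]
      by (simp add: ennreal_mult' ennreal_of_nat_eq_real_of_nat)
    then show "(\<lambda>n. ennreal (real n * expectation (\<lambda>\<omega>. (cmod (Y n \<omega> - expectation (Y n)))\<^sup>2))) \<longlonglongrightarrow> ennreal (V / (cmod c)\<^sup>2)"
      by (intro Lim_transform_eventually[OF lim] eventually_mono[OF eventually_ge_at_top[of N]])
  qed (use V0 in \<open>auto intro!: always_eventually mult_nonneg_nonneg integral_nonneg_AE\<close>)
  note err = one_step_error_negligible[OF s qm sq mean c1 c2 F' Ff[OF \<theta>U] c Y Ym N sqY limY[unfolded V_def]]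
  have sqD: "integrable M (\<lambda>\<omega>. (cmod (one_step_error Y \<theta> n \<omega>))\<^sup>2)" if "N \<le> n" for n
    by (rule err(1)) (use that in simp_all)
  have limD: "(\<lambda>n. real n * expectation (\<lambda>\<omega>. (cmod (one_step_error Y \<theta> n \<omega>))\<^sup>2)) \<longlonglongrightarrow> 0"
    by (rule err(2)) simp_all
  have Zeq: "Z n \<omega> = \<theta> + 2 * \<i> * of_real (Im \<theta>) * average (cayley \<theta>) n \<omega> + one_step_error Y \<theta> n \<omega>" for n \<omega>
    by (simp add: assms(7) one_step_estimator_def one_step_error_def average_def cayley_def)
  note mom = one_step_second_moments[OF s c1 Ym N sqD limD Zeq]
  have sqZ: "integrable M (\<lambda>\<omega>. (cmod (Z n \<omega> - \<theta>))\<^sup>2)" if "N \<le> n" for n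
    by (rule mom(1)) (use that in simp_all)
  have sqVZ: "integrable M (\<lambda>\<omega>. (cmod (Z n \<omega> - expectation (Z n)))\<^sup>2)" if "N \<le> n" for n
    by (rule mom(2)) (use that in simp_all)
  have limZ: "(\<lambda>n. ennreal (real n * expectation (\<lambda>\<omega>. (cmod (Z n \<omega> - \<theta>))\<^sup>2))) \<longlonglongrightarrow> ennreal (4 * (Im \<theta>)\<^sup>2)"
    by (rule tendsto_ennrealI[OF mom(3)]) simp_all
  have limVZ: "(\<lambda>n. ennreal (real n * expectation (\<lambda>\<omega>. (cmod (Z n \<omega> - expectation (Z n)))\<^sup>2))) \<longlonglongrightarrow> ennreal (4 * (Im \<theta>)\<^sup>2)"
    by (rule tendsto_ennrealI[OF mom(4)]) simp_all
  have e1: "of_nat n * second_moment M (\<lambda>\<omega>. Z n \<omega> - \<theta>) = ennreal (real n * expectation (\<lambda>\<omega>. (cmod (Z n \<omega> - \<theta>))\<^sup>2))"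
    if "N \<le> n" for n
    unfolding second_moment_eq[OF sqZ[OF that]] by (simp add: ennreal_mult' ennreal_of_nat_eq_real_of_nat)
  have l1: "(\<lambda>n. of_nat n * second_moment M (\<lambda>\<omega>. Z n \<omega> - \<theta>)) \<longlonglongrightarrow> ennreal (4 * (Im \<theta>)\<^sup>2)"
    by (rule Lim_transform_eventually[OF limZ]) (rule eventually_mono[OF eventually_ge_at_top[of N] e1[symmetric]])
  have e2: "of_nat n * complex_variance M (Z n) = ennreal (real n * expectation (\<lambda>\<omega>. (cmod (Z n \<omega> - expectation (Z n)))\<^sup>2))"
    if "N \<le> n" for n
    unfolding complex_variance_def second_moment_eq[OF sqVZ[OF that]] by (simp add: ennreal_mult' ennreal_of_nat_eq_real_of_nat)
  have l2: "(\<lambda>n. of_nat n * complex_variance M (Z n)) \<longlonglongrightarrow> ennreal (4 * (Im \<theta>)\<^sup>2)"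
    by (rule Lim_transform_eventually[OF limVZ]) (rule eventually_mono[OF eventually_ge_at_top[of N] e2[symmetric]])
  \<comment> \<open>The inequality for the variances holds with equality.\<close>
  show ?thesis by (intro conjI exI[of _ "ennreal (4 * (Im \<theta>)\<^sup>2)"] l1 l2 order_refl)
qed

end
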